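(* Let $p\in[1,+\infty]$ and $\rho_0\in\mathcal P_p(\mathbb R)$. Then there exists one and only one dissipative measure solution $\rho$ with initial datum $\rho_0$ to $$\partial_t\rho+\partial_x\big(\rho\, v(V*\rho)\big)=0,\qquad x\in\mathbb R,\ t\ge 0.$$ Moreover, $\rho$ satisfies the following. (i) Setting $X(\cdot,t)=X_{\rho(\cdot,t)}$ (the quantile function of $\rho(\cdot,t)$), one has $X(\cdot,0)=X_{\rho_0}$ and $$\partial_t X(z,t)=v\left(\int_0^1 U(X(z,t)-X(\zeta,t))\,d\zeta-\lambda z\right)$$ for almost every $(z,t)\in[0,1]\times(0,+\infty)$. (ii) $\rho\in L^\infty_{\mathrm{loc}}((0,+\infty);L^\infty(\mathbb R))$ and, for all $t>0$, $$\|\rho(\cdot,t)\|_{L^\infty(\mathbb R)}\le\frac{[v]_{\mathrm{Lip}}[U]_{\mathrm{Lip}}}{b\lambda}\left(1-e^{-[v]_{\mathrm{Lip}}[U]_{\mathrm{Lip}}t}\right)^{-1}.$$ Furthermore, if $\rho_1,\rho_2$ are two dissipative measure solutions with initial data $\rho_{0,1},\rho_{0,2}\in\mathcal P_p(\mathbb R)$ respectively, for some $p\in[1,+\infty]$, then $$\mathcal W_p(\rho_1(\cdot,t),\rho_2(\cdot,t))\le e^{Ct}\,\mathcal W_p(\rho_{0,1},\rho_{0,2}),$$ where $C=2^{\frac{p+1}{p}}[v]_{\mathrm{Lip}}[V]_{\mathrm{Lip}((-\infty,0])}$ if $p<+\infty$ and $C=2[v]_{\mathrm{Lip}}[V]_{\mathrm{Lip}((-\infty,0])}$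 if $p=+\infty$.
   Context: Standing assumptions. The kernel $V:\mathbb R\to\mathbb R$ satisfies: $\mathrm{supp}(V)\subset(-\infty,0]$; $V$ is left-continuous at $0$ with $V(0^-)=\lambda>0$; $V$ is Lipschitz continuous on $(-\infty,0]$. The velocity map $v:\mathbb R\to\mathbb R$ is Lipschitz on $\mathbb R$, and there is $b>0$ such that $v(\rho_2)-v(\rho_1)\le -b(\rho_2-\rho_1)$ for all $\rho_2\ge\rho_1\ge0$. $[\cdot]_{\mathrm{Lip}}$ denotes the Lipschitz seminorm. $U:\mathbb R\to\mathbb R$ is defined by $U(x)=V(x)$ for $x\le0$ and $U(x)=\lambda$ for $x>0$; it is Lipschitz with $[U]_{\mathrm{Lip}}=[V]_{\mathrm{Lip}((-\infty,0])}$. If $[U]_{\mathrm{Lip}}=0$, the right-hand side of the bound in (ii) is understood as its limit $1/(b\lambda t)$. $(V*\rho)(x)=\int_{\mathbb R}V(x-y)\,d\rho(y)$. An absolutely continuous measure is identified with its density. $\mathcal P_p(\mathbb R)$ is the set of Borel probability measures on $\mathbb R$ with finite $p$-th moment (compactly supported if $p=+\infty$), with the $p$-Wasserstein distance $\mathcal W_p$. For $\rho\in\mathcal P(\mathbb R)$, $F_\rho(x)=\rho((-\infty,x])$, and the quantile function is $X_\rho(z)=\inf\{x\in\mathbb R: F_\rho(x)\ge z\}$, $z\in[0,1]$ (identified with its right-continuous representative); $\rho\mapsto X_\rho$ is an isometric bijection from $\mathcal P_p(\mathbb R)$ onto the cone of non-decreasing functions in $L^p([0,1])$, i.e. $\mathcal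 W_p(\rho_1,\rho_2)=\|X_{\rho_1}-X_{\rho_2}\|_{L^p([0,1])}$. Definition. A curve $\rho\in C([0,+\infty);\mathcal P_p(\mathbb R))$ is a dissipative measure solution with initial datum $\rho_0\in\mathcal P_p(\mathbb R)$ if: (1) $\rho(\cdot,t)\in L^\infty(\mathbb R)$ for all $t>0$; (2) for all $\varphi\in C^1_c(\mathbb R\times(0,+\infty))$, $$\int_0^{+\infty}\!\!\int_{\mathbb R}\rho\,\partial_t\varphi\,dx\,dt+\int_0^{+\infty}\!\!\int_{\mathbb R}\rho\, v(V*\rho)\,\partial_x\varphi\,dx\,dt=0;$$ (3) $\rho(\cdot,0)=\rho_0$.
   Formalization: Added hypothesis: if V takes a negative value V(x), then v(ρ₂)−v(ρ₁) ≤ −b(ρ₂−ρ₁) also for ρ₂ ≥ ρ₁ ≥ V(x); this is vacuous for V ≥ 0, and without it the claim fails, since atoms can persist where V*ρ < 0. *)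

theory Defs
  imports "HOL-Probability.Probability"
begin

definition lip_seminorm :: "real set \<Rightarrow> (real \<Rightarrow> real) \<Rightarrow> real" where
  "lip_seminorm S f = Sup {\<bar>f x - f y\<bar> / \<bar>x - y\<bar> | x y. x \<in> S \<and> y \<in> S \<and> x \<noteq> y}"

definition extended_kernel :: "(real \<Rightarrow> real) \<Rightarrow> real \<Rightarrow> real \<Rightarrow> real" where
  "extended_kernel V lam x = (if x \<le> 0 then V x else lam)"

definition conv_measure :: "(real \<Rightarrow> real) \<Rightarrow> real measure \<Rightarrow> real \<Rightarrow> real" where
  "conv_measure V \<mu> x = (\<integral>y. V (x - y) \<partial>\<mu>)"

definition prob_moment :: "ennreal \<Rightarrow> real measure set" where
  "prob_moment p = {\<mu>. real_distribution \<mu> \<and>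
     (if p = \<infinity> then \<exists>K. compact K \<and> (AE x in \<mu>. x \<in> K)
      else integrable \<mu> (\<lambda>x. \<bar>x\<bar> powr enn2real p))}"

definition couplings :: "real measure \<Rightarrow> real measure \<Rightarrow> (real \<times> real) measure set" where
  "couplings \<mu> \<nu> = {\<gamma>. sets \<gamma> = sets (borel \<Otimes>\<^sub>M borel)
     \<and> distr \<gamma> borel fst = \<mu> \<and> distr \<gamma> borel snd = \<nu>}"

text \<open>The infima are taken in the extended nonnegative reals. They are finite for
  \<open>\<mu>, \<nu> \<in> prob_moment p\<close>, the only case in which \<open>wasserstein p \<mu> \<nu>\<close> is meaningful:
  elsewhere \<open>enn2real\<close> turns an infinite value into \<open>0\<close>.\<close>

definition wasserstein :: "ennreal \<Rightarrow> real measure \<Rightarrow> real measure \<Rightarrow> real" where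
  "wasserstein p \<mu> \<nu> =
     (if p = \<infinity>
      then enn2real (INF \<gamma>\<in>couplings \<mu> \<nu>. esssup \<gamma> (\<lambda>(x, y). ennreal \<bar>x - y\<bar>))
      else enn2real (INF \<gamma>\<in>couplings \<mu> \<nu>.
             \<integral>\<^sup>+(x, y). ennreal (\<bar>x - y\<bar> powr enn2real p) \<partial>\<gamma>) powr (1 / enn2real p))"

text \<open>This is the left-continuous version. Its right-continuous representative differs from
  it at countably many points only. At \<open>z = 0\<close> the infimum is that of the whole real line,
  and the value is arbitrary.\<close>

definition quantile :: "real measure \<Rightarrow> real \<Rightarrow> real" where
  "quantile \<mu> z = Inf {x. cdf \<mu> x \<ge> z}"

text \<open>The \<open>L\<^sup>\<infinity>\<close> norm of the density of \<open>\<mu>\<close>, infinite if \<open>\<mu>\<close> has no density.\<close>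

definition Linf_norm :: "real measure \<Rightarrow> ennreal" where
  "Linf_norm \<mu> = (if absolutely_continuous lborel \<mu> then esssup lborel (RN_deriv lborel \<mu>) else \<infinity>)"

text \<open>The space \<open>L\<^sup>\<infinity>\<^sub>l\<^sub>o\<^sub>c((0,\<infinity>); L\<^sup>\<infinity>(\<real>))\<close>. As usual for the non-separable target, measurability
  in time is meant as joint measurability of the densities, not in the strong (Bochner) sense.\<close>

definition Linf_loc_Linf :: "(real \<Rightarrow> real measure) \<Rightarrow> bool" where
  "Linf_loc_Linf \<rho> \<longleftrightarrow>
     (\<exists>r :: real \<times> real \<Rightarrow> ennreal. r \<in> borel_measurable (borel \<Otimes>\<^sub>M borel)
        \<and> (AE t in lborel. t > 0 \<longrightarrow> \<rho> t = density lborel (\<lambda>x. r (x, t))))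
     \<and> (\<forall>K. compact K \<and> K \<subseteq> {0<..} \<longrightarrow>
          (\<exists>C<\<infinity>. AE t in lborel. t \<in> K \<longrightarrow> Linf_norm (\<rho> t) \<le> C))"

text \<open>A function in \<open>C\<^sup>1\<^sub>c(\<real> \<times> (0,\<infinity>))\<close>, extended by zero to the plane.\<close>

definition test_function :: "(real \<Rightarrow> real \<Rightarrow> real) \<Rightarrow> bool" where
  "test_function \<phi> \<longleftrightarrow>
     (\<exists>K. compact K \<and> K \<subseteq> UNIV \<times> {0<..} \<and> (\<forall>x t. (x, t) \<notin> K \<longrightarrow> \<phi> x t = 0))
     \<and> (\<forall>x t. (\<lambda>y. \<phi> y t) differentiable (at x) \<and> (\<lambda>s. \<phi> x s) differentiable (at t))
     \<and> continuous_on UNIV (\<lambda>(x, t). deriv (\<lambda>y. \<phi> y t) x)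
     \<and> continuous_on UNIV (\<lambda>(x, t). deriv (\<lambda>s. \<phi> x s) t)"

text \<open>A curve is a function on all of \<open>\<real>\<close> of which only the values at \<open>t \<ge> 0\<close> matter. In the
  weak formulation, \<open>\<rho>(x,t) dx\<close> is integration against the measure \<open>\<rho> t\<close>.\<close>

definition dissipative_measure_solution ::
  "(real \<Rightarrow> real) \<Rightarrow> (real \<Rightarrow> real) \<Rightarrow> ennreal \<Rightarrow> real measure \<Rightarrow> (real \<Rightarrow> real measure) \<Rightarrow> bool" where
  "dissipative_measure_solution V v p \<rho>\<^sub>0 \<rho> \<longleftrightarrow>
     (\<forall>t\<ge>0. \<rho> t \<in> prob_moment p)
     \<and> (\<forall>t\<ge>0. ((\<lambda>s. wasserstein p (\<rho> s) (\<rho> t)) \<longlongrightarrow> 0) (at t within {0..}))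
     \<and> (\<forall>t>0. Linf_norm (\<rho> t) < \<infinity>)
     \<and> (\<forall>\<phi>. test_function \<phi> \<longrightarrow>
          (LBINT t:{0<..}. (\<integral>x. deriv (\<lambda>s. \<phi> x s) t \<partial>\<rho> t))
          + (LBINT t:{0<..}. (\<integral>x. v (conv_measure V (\<rho> t) x) * deriv (\<lambda>y. \<phi> y t) x \<partial>\<rho> t)) = 0)
     \<and> \<rho> 0 = \<rho>\<^sub>0"

text \<open>The constant in the smoothing estimate; \<open>K\<close> stands for \<open>[v] [U]\<close>, and the value at
  \<open>K = 0\<close> is the limit as \<open>K \<rightarrow> 0\<close>.\<close>

definition smoothing_bound :: "real \<Rightarrow> real \<Rightarrow> real \<Rightarrow> real \<Rightarrow> real" where
  "smoothing_bound K b lam t =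
     (if K = 0 then 1 / (b * lam * t) else K / (b * lam) * inverse (1 - exp (- K * t)))"

definition stability_exponent :: "ennreal \<Rightarrow> real \<Rightarrow> real \<Rightarrow> real" where
  "stability_exponent p lip_v lip_V =
     (if p = \<infinity> then 2 else 2 powr ((enn2real p + 1) / enn2real p)) * lip_v * lip_V"

end

theory Submission
  imports Defs
begin

text \<open>In terms of the quantile functions \<open>X z t\<close> the equation is the mean-field system
  \<open>X' = v (\<integral>U (X z - X \<zeta>) d\<zeta> - \<lambda> z)\<close>, because \<open>V = U - \<lambda> 1\<^bsub>(0,\<infinity>)\<^esub>\<close>. A weak solution has no
  atoms for \<open>t > 0\<close>, so its velocity is jointly continuous there; testing the equation with smoothed
  indicators of \<open>{x \<le> g + c t}\<close> shows that the mass to the left of such a front increases as long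
  as the velocity on the front is at most \<open>c\<close> (and decreases if it is at least \<open>c\<close>), and squeezing a
  quantile between two fronts gives the ODE for every \<open>z\<close>. Since \<open>v\<close> decreases at rate \<open>b\<close>, the
  distance of two quantiles satisfies \<open>d' \<ge> b \<lambda> (z\<^sub>2 - z\<^sub>1) - K d\<close>, which is the smoothing estimate.
  For the difference \<open>D\<close> of two solutions, Gronwall bounds \<open>e\<^bsup>-2Lt\<^esup> |D z t|\<close> by a convex combination of
  \<open>|D z 0|\<close> and its mean, so every \<open>L\<^sup>p\<close> norm grows at most like \<open>e\<^bsup>2Lt\<^esup>\<close>; as the monotone coupling is
  optimal this is the stability in \<open>W\<^sub>p\<close>, with the constant \<open>2\<close> for all \<open>p\<close>. Existence is Picard
  iteration for the ODE.\<close>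

section \<open>Preliminaries\<close>

text \<open>The initial datum may have atoms, so the ODE is available for positive times only.
  Estimates are therefore made on \<open>[s, t]\<close> with \<open>0 < s\<close>, and then
  \<open>s\<close> tends to 0: the smoothing bound asks of time \<open>s\<close> only that quantiles
  are ordered, and for stability \<open>X z\<close> is continuous at time 0 for all but countably
  many labels \<open>z\<close>. Absence of atoms also gives \<open>cdf (rho t) (X z t) = z\<close>,
  which turns the jump of the kernel into the smooth term \<open>- lam * z\<close> and leaves the
  Lipschitz kernel \<open>U\<close>. Indicators of half-lines are not compactly supported. They are
  cut off between \<open>- 2 * R\<close> and \<open>- R\<close>; as the velocity grows at most
  linearly and the first moment is finite, the flux through the cut is of order
  \<open>1 / R\<close>. The rate \<open>2 * L\<close> in the stability estimate collects one
  \<open>L\<close> from the displacement of the particle itself and one from the mean displacement.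
  Quantiles are unbounded in \<open>z\<close>, so Picard iteration is controlled relative to the
  weight \<open>1 + \<bar>x0 z\<bar>\<close>. Strict monotonicity of the resulting flow follows from
  the expansion estimate, and only then is its velocity recognised as \<open>v\<close> of a
  convolution.\<close>

lemma nonpos_barrier:
  fixes e :: "real \<Rightarrow> real"
  assumes "a \<le> c" and cont: "continuous_on {a..c} e" and a: "e a \<le> 0"
    and deriv: "\<And>t. a < t \<Longrightarrow> t < c \<Longrightarrow> e t > 0 \<Longrightarrow> \<exists>D. (e has_real_derivative D) (at t) \<and> D \<le> L * e t"
  shows "e c \<le> 0"
proof (rule ccontr)
  assume "\<not> e c \<le> 0"
  define S where "S = {t \<in> {a..c}. e t \<le> 0}"
  have clS: "closed S"
    unfolding S_def by (rule continuous_on_closed_Collect_le[OF cont continuous_on_const closed_atLeastAtMost])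
  have neS: "S \<noteq> {}" "bdd_above S"
    using assms by (auto simp: S_def)
  define s where "s = Sup S"
  have "s \<in> S"
    unfolding s_def by (rule closed_contains_Sup[OF neS clS])
  then have s: "a \<le> s" "s \<le> c" "e s \<le> 0" by (auto simp: S_def)
  then have "s < c" using \<open>\<not> e c \<le> 0\<close> by (cases "s = c") auto
  have pos: "e t > 0" if "s < t" "t \<le> c" for t
  proof (rule ccontr)
    assume "\<not> e t > 0"
    then have "t \<in> S" using that s by (auto simp: S_def)
    then have "t \<le> s" unfolding s_def using neS by (intro cSup_upper)
    then show False using that by simp
  qed
  let ?f = "\<lambda>t. e t * exp (- L * t)"
  have "?f c \<le> ?f s"
  proof (rule DERIV_nonpos_imp_decreasing_open[where f = ?f])
    show "s \<le> c" by fact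
    fix t assume t: "s < t" "t < c"
    then obtain D where D: "(e has_real_derivative D) (at t)" "D \<le> L * e t"
      using deriv[of t] pos[of t] s by auto
    have "(?f has_real_derivative ((D - L * e t) * exp (- L * t))) (at t)"
      by (rule derivative_eq_intros D refl | simp add: algebra_simps)+
    moreover have "(D - L * e t) * exp (- L * t) \<le> 0"
      using D by (intro mult_nonpos_nonneg) auto
    ultimately show "\<exists>y. (?f has_real_derivative y) (at t) \<and> y \<le> 0" by blast
  next
    show "continuous_on {s..c} ?f"
      using cont s by (intro continuous_intros) (auto intro: continuous_on_subset)
  qed
  also have "\<dots> \<le> 0" using s by (intro mult_nonpos_nonneg) auto
  finally show False using \<open>\<not> e c \<le> 0\<close> by (simp add: mult_le_0_iff)
qed

lemma lip_seminorm_bound: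
  assumes "\<exists>L. L-lipschitz_on S f" and "x \<in> S" "y \<in> S"
  shows "\<bar>f x - f y\<bar> \<le> lip_seminorm S f * \<bar>x - y\<bar>"
proof (cases "x = y")
  case False
  obtain L where L: "L-lipschitz_on S f" using assms by auto
  have "\<bar>f x - f y\<bar> / \<bar>x - y\<bar> \<le> lip_seminorm S f"
    unfolding lip_seminorm_def
  proof (rule cSup_upper)
    \<comment> \<open>A real \<open>Sup\<close> bounds the quotients only if they are bounded above,
      which any Lipschitz constant guarantees.\<close>
    show "bdd_above {\<bar>f x - f y\<bar> / \<bar>x - y\<bar> |x y. x \<in> S \<and> y \<in> S \<and> x \<noteq> y}"
      using lipschitz_onD[OF L] by (intro bdd_aboveI[of _ L]) (auto simp: dist_real_def pos_divide_le_eq)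
  qed (use assms False in auto)
  then show ?thesis using False by (simp add: divide_simps)
qed simp

lemma lip_seminorm_nonneg:
  assumes "\<exists>L. L-lipschitz_on S f" and "x \<in> S" "y \<in> S" "x \<noteq> y"
  shows "lip_seminorm S f \<ge> 0"
proof -
  have "0 \<le> lip_seminorm S f * \<bar>x - y\<bar>"
    using lip_seminorm_bound[OF assms(1-3)] by linarith
  then show ?thesis using \<open>x \<noteq> y\<close> by (simp add: zero_le_mult_iff)
qed

text \<open>The endpoints are left out because a quantile function has arbitrary values there. The
  carrier is the whole line, so that measurability with respect to \<open>unif\<close> is plain
  Borel measurability.\<close>

definition unif :: "real measure" where
  "unif = density lborel (indicator {0<..<1})"

lemma sets_unif [simp, measurable_cong]: "sets unif = sets borel"
  by (simp add: unif_def)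

lemma space_unif [simp]: "space unif = UNIV"
  by (simp add: unif_def)

lemma measurable_unif [simp]: "measurable unif N = measurable borel N"
  by (rule measurable_cong_sets) auto

lemma emeasure_unif: "A \<in> sets borel \<Longrightarrow> emeasure unif A = emeasure lborel (A \<inter> {0<..<1})"
  by (simp add: unif_def emeasure_density flip: indicator_inter_arith)
     (simp add: Int_commute)

interpretation unif: prob_space unif
  by standard (simp add: emeasure_unif)

lemma measure_unif_UNIV [simp]: "measure unif UNIV = 1"
  using unif.prob_space by simp

lemma AE_unif: "(AE z in unif. P z) \<longleftrightarrow> (AE z in lborel. 0 < z \<and> z < 1 \<longrightarrow> P z)"
proof -
  have "(0 < (indicator {0<..<1} z :: ennreal)) = (0 < z \<and> z < 1)" for z :: real
    by (simp add: indicator_def)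
  then show ?thesis
    unfolding unif_def by (subst AE_density) simp_all
qed

lemma AE_unifI: "(\<And>z. 0 < z \<Longrightarrow> z < 1 \<Longrightarrow> P z) \<Longrightarrow> AE z in unif. P z"
  by (simp add: AE_unif)

lemma integral_unif:
  fixes f :: "real \<Rightarrow> real"
  assumes [measurable]: "f \<in> borel_measurable borel"
  shows "(\<integral>z. f z \<partial>unif) = (LBINT z:{0..1}. f z)"
proof -
  have "(\<integral>z. f z \<partial>unif) = (\<integral>z. indicator {0<..<1} z *\<^sub>R f z \<partial>lborel)"
    unfolding unif_def ennreal_indicator[symmetric] by (rule integral_density) auto
  also have "\<dots> = (LBINT z:{0..1}. f z)"
    unfolding set_lebesgue_integral_def
  proof (intro integral_cong_AE)
    show "AE z in lborel. indicator {0<..<1} z *\<^sub>R f z = indicator {0..1} z *\<^sub>R f z"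
      using AE_lborel_singleton[of 0] AE_lborel_singleton[of 1]
      by eventually_elim (auto simp: indicator_def)
  qed auto
  finally show ?thesis .
qed

lemma measure_unif_le:
  assumes [measurable]: "A \<in> sets borel" and "A \<inter> {0<..<1} \<subseteq> {a..b}" "a \<le> b"
  shows "measure unif A \<le> b - a"
proof -
  have "emeasure unif A \<le> emeasure lborel {a..b}"
    by (subst emeasure_unif[OF assms(1)]) (rule emeasure_mono[OF assms(2)], simp)
  then have "ennreal (measure unif A) \<le> ennreal (b - a)"
    using \<open>a \<le> b\<close> by (simp add: unif.emeasure_eq_measure)
  then show ?thesis using \<open>a \<le> b\<close> by simp
qed

lemma measure_unif_ge:
  assumes [measurable]: "A \<in> sets borel" and "{a<..<b} \<subseteq> A" "0 \<le> a" "b \<le> 1"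
  shows "b - a \<le> measure unif A"
proof (cases "a \<le> b")
  case True
  have "emeasure lborel {a<..<b} \<le> emeasure unif A"
    using assms by (subst emeasure_unif) (auto intro!: emeasure_mono)
  then have "ennreal (b - a) \<le> ennreal (measure unif A)"
    using True by (simp add: unif.emeasure_eq_measure)
  then show ?thesis by simp
qed (simp add: order_trans[OF _ measure_nonneg])

section \<open>Quantile functions\<close>

lemma quantile_le_iff:
  assumes "real_distribution \<mu>" "0 < z" "z < 1"
  shows "quantile \<mu> z \<le> x \<longleftrightarrow> z \<le> cdf \<mu> x"
proof -
  interpret cdf_distribution \<mu> using assms by (simp add: cdf_distribution_def)
  show ?thesis unfolding quantile_def by (rule pseudoinverse[OF assms(2,3), symmetric])
qed

lemma quantile_mono:
  assumes "real_distribution \<mu>" "0 < z" "z \<le> z'" "z' < 1"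
  shows "quantile \<mu> z \<le> quantile \<mu> z'"
proof -
  have "z' \<le> cdf \<mu> (quantile \<mu> z')"
    using assms by (subst quantile_le_iff[symmetric]) auto
  then show ?thesis
    using assms by (subst quantile_le_iff) auto
qed

text \<open>Monotonicity settles the open unit interval. For \<open>z \<le> 0\<close> the infimum is
  over all reals and for \<open>z > 1\<close> over the empty set, so the function is constant on
  each of these sets, whatever those values are.\<close>

lemma borel_measurable_quantile:
  assumes "real_distribution \<mu>"
  shows "quantile \<mu> \<in> borel_measurable borel"
proof -
  interpret real_distribution \<mu> by fact
  have 1: "quantile \<mu> \<in> borel_measurable (restrict_space borel {0<..<1})"
    by (intro borel_measurable_mono_on_fnc mono_onI) (use quantile_mono[OF assms] in auto)
  have 2: "quantile \<mu> z = Inf UNIV" if "z \<le> 0" for z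
  proof -
    have "{x. cdf \<mu> x \<ge> z} = UNIV" using that cdf_nonneg by (auto intro: order_trans)
    then show ?thesis by (simp add: quantile_def)
  qed
  have 3: "quantile \<mu> z = Inf {}" if "z > 1" for z
  proof -
    have "{x. cdf \<mu> x \<ge> z} = {}" using that cdf_bounded_prob by (auto simp: not_le intro: le_less_trans)
    then show ?thesis by (simp add: quantile_def)
  qed
  have 4: "quantile \<mu> z = (if z \<in> {0<..<1} then quantile \<mu> z else
     if z \<le> 0 then Inf UNIV else if z = 1 then quantile \<mu> 1 else Inf {})" for z
    using 2[of z] 3[of z] by auto
  show ?thesis
    using 1 by (subst 4[abs_def], subst measurable_If_restrict_space_iff)
      (auto simp del: greaterThanLessThan_iff intro!: measurable_restrict_space1)
qed

lemma cdf_distr_unif: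
  assumes [measurable]: "X \<in> borel_measurable borel"
  shows "cdf (distr unif borel X) x = measure unif {z. X z \<le> x}"
  by (auto simp: cdf_def measure_distr vimage_def)

lemma real_distribution_distr_unif:
  assumes [measurable]: "X \<in> borel_measurable borel"
  shows "real_distribution (distr unif borel X)"
  using unif.prob_space_distr[OF assms[unfolded measurable_unif[symmetric, of borel]]]
  by (simp add: real_distribution_def real_distribution_axioms_def)

text \<open>Within the unit interval the labels with \<open>quantile \<mu> z \<le> x\<close> are
  those up to \<open>cdf \<mu> x\<close>, so both measures have the same distribution
  function.\<close>

lemma distr_quantile:
  assumes "real_distribution \<mu>"
  shows "distr unif borel (quantile \<mu>) = \<mu>"
proof (rule cdf_unique)
  interpret real_distribution \<mu> by fact
  note [measurable] = borel_measurable_quantile[OF assms]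
  show "real_distribution (distr unif borel (quantile \<mu>))"
    by (rule real_distribution_distr_unif) auto
  show "cdf (distr unif borel (quantile \<mu>)) = cdf \<mu>"
  proof
    fix x
    have "measure unif {z. quantile \<mu> z \<le> x} \<le> cdf \<mu> x - 0"
      using cdf_nonneg[of x] by (intro measure_unif_le) (auto simp: quantile_le_iff[OF assms])
    moreover have "cdf \<mu> x - 0 \<le> measure unif {z. quantile \<mu> z \<le> x}"
      using cdf_bounded_prob[of x] by (intro measure_unif_ge) (auto simp: quantile_le_iff[OF assms])
    ultimately have "measure unif {z. quantile \<mu> z \<le> x} = cdf \<mu> x" by simp
    then show "cdf (distr unif borel (quantile \<mu>)) x = cdf \<mu> x"
      by (simp add: cdf_distr_unif)
  qed
qed fact

lemma
  fixes f :: "real \<Rightarrow> real"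
  assumes "real_distribution \<mu>" and [measurable]: "f \<in> borel_measurable borel"
  shows integral_quantile: "(\<integral>x. f x \<partial>\<mu>) = (\<integral>z. f (quantile \<mu> z) \<partial>unif)"
    and integrable_quantile: "integrable \<mu> f \<longleftrightarrow> integrable unif (\<lambda>z. f (quantile \<mu> z))"
proof -
  note [measurable] = borel_measurable_quantile[OF assms(1)]
  show "(\<integral>x. f x \<partial>\<mu>) = (\<integral>z. f (quantile \<mu> z) \<partial>unif)"
    using integral_distr[of "quantile \<mu>" unif borel f] by (simp add: distr_quantile[OF assms(1)])
  show "integrable \<mu> f \<longleftrightarrow> integrable unif (\<lambda>z. f (quantile \<mu> z))"
    using integrable_distr_eq[of "quantile \<mu>" unif borel f] by (simp add: distr_quantile[OF assms(1)])
qed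

lemma cdf_quantile:
  assumes "real_distribution \<mu>"
  shows "cdf \<mu> x = measure unif {z. quantile \<mu> z \<le> x}"
  unfolding cdf_distr_unif[OF borel_measurable_quantile[OF assms], symmetric] distr_quantile[OF assms] ..

section \<open>Optimality of the monotone coupling\<close>

text \<open>The cost \<open>(x - y)\<^sub>+\<^sup>q\<close> is the integral of this kernel over \<open>s \<ge> y\<close>. As the kernel is monotone
  in \<open>x\<close>, the cost is a superposition of indicators of sets \<open>{y \<le> s, x \<in> B}\<close> with \<open>B\<close> an up-set,
  and on each of these the monotone coupling has the least possible mass.\<close>

definition cost_kernel :: "real \<Rightarrow> real \<Rightarrow> real \<Rightarrow> real" where
  "cost_kernel q s x = (if s < x then q * (x - s) powr (q - 1) else 0)"

lemma borel_measurable_cost_kernel [measurable]: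
  assumes [measurable]: "f \<in> borel_measurable M" "g \<in> borel_measurable M"
  shows "(\<lambda>w. cost_kernel q (f w) (g w)) \<in> borel_measurable M"
  unfolding cost_kernel_def by measurable

lemma cost_kernel_mono:
  assumes "q \<ge> 1" "x \<le> y"
  shows "cost_kernel q s x \<le> cost_kernel q s y"
  using assms by (auto simp: cost_kernel_def intro!: mult_left_mono powr_mono2)

lemma nn_integral_cost_kernel:
  assumes "q \<ge> 1"
  shows "(\<integral>\<^sup>+s. indicator {y..} s * ennreal (cost_kernel q s x) \<partial>lborel) = ennreal (max 0 (x - y) powr q)"
proof (cases "y < x")
  case True
  let ?f = "\<lambda>s. q * (x - s) powr (q - 1)" and ?F = "\<lambda>s. - ((x - s) powr q)"
  have d: "DERIV ?F s :> ?f s" if "ereal y < ereal s" "ereal s < ereal x" for s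
    using that by (auto intro!: derivative_eq_intros simp: divide_simps powr_diff)
  have c: "isCont ?f s" if "ereal y < ereal s" "ereal s < ereal x" for s
    using that by (auto intro!: continuous_intros)
  have n: "AE s in lborel. ereal y < ereal s \<longrightarrow> ereal s < ereal x \<longrightarrow> 0 \<le> ?f s"
    using assms by auto
  have "((\<lambda>s. - ((x - s) powr q)) \<longlongrightarrow> - ((x - y) powr q)) (at_right y)"
    using True by (auto intro!: tendsto_eq_intros)
  then have A: "((?F \<circ> real_of_ereal) \<longlongrightarrow> - ((x - y) powr q)) (at_right (ereal y))"
    by (simp add: ereal_tendsto_simps1)
  have "((\<lambda>s. - ((x - s) powr q)) \<longlongrightarrow> - (0 powr q)) (at_left x)"
  proof (rule tendsto_minus, rule tendsto_powr')
    show "((\<lambda>s. x - s) \<longlongrightarrow> 0) (at_left x)" by (auto intro!: tendsto_eq_intros)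
    show "0 \<noteq> (0::real) \<or> 0 < q \<and> (\<forall>\<^sub>F s in at_left x. 0 \<le> x - s)"
      using assms by (auto simp: eventually_at_filter)
  qed auto
  then have B: "((?F \<circ> real_of_ereal) \<longlongrightarrow> 0) (at_left (ereal x))"
    using assms by (simp add: ereal_tendsto_simps1)
  \<comment> \<open>The open-interval form of the fundamental theorem takes one-sided limits of the
    primitive; this avoids the point \<open>s = x\<close>, where the base of \<open>powr\<close>
    vanishes.\<close>
  note FTC = interval_integral_FTC_nonneg[OF _ d c n A B]
  have int: "set_integrable lborel {y<..<x} ?f" and val: "(LBINT s:{y<..<x}. ?f s) = (x - y) powr q"
    using FTC True by (simp_all add: interval_lebesgue_integral_def)
  have "(\<integral>\<^sup>+s. indicator {y..} s * ennreal (cost_kernel q s x) \<partial>lborel)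
      = (\<integral>\<^sup>+s. ennreal (indicator {y<..<x} s *\<^sub>R ?f s) \<partial>lborel)"
    using AE_lborel_singleton[of y]
    by (intro nn_integral_cong_AE, eventually_elim) (auto simp: cost_kernel_def indicator_def)
  also have "\<dots> = ennreal (LBINT s:{y<..<x}. ?f s)"
    unfolding set_lebesgue_integral_def using int assms
    by (intro nn_integral_eq_integral) (auto simp: set_integrable_def)
  finally show ?thesis using val True by simp
next
  case False
  then have "indicator {y..} s * ennreal (cost_kernel q s x) = 0" for s
    by (auto simp: indicator_def cost_kernel_def)
  then have "(\<integral>\<^sup>+s. indicator {y..} s * ennreal (cost_kernel q s x) \<partial>lborel) = (\<integral>\<^sup>+(s::real). 0 \<partial>lborel)"
    by (rule nn_integral_cong)
  with False assms show ?thesis by simp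
qed

lemma nn_integral_layer:
  "(\<integral>\<^sup>+u. indicator {u. 0 \<le> u \<and> u < c} u \<partial>lborel) = ennreal c"
proof -
  have "{u. 0 \<le> u \<and> u < c} = {0..<c}" by auto
  then show ?thesis by (cases "0 \<le> c") (auto simp: ennreal_neg)
qed

text \<open>Fubini moves the integral over \<open>s\<close> outside, and the value of the kernel is
  in turn written as the length of the set of \<open>u\<close> below it. What remains are
  probabilities of single events, which can be compared one by one.\<close>

lemma powr_cost_layers:
  assumes "q \<ge> 1" and "sigma_finite_measure \<Omega>"
    and [measurable]: "x \<in> borel_measurable \<Omega>" "y \<in> borel_measurable \<Omega>"
  shows "(\<integral>\<^sup>+w. ennreal (max 0 (x w - y w) powr q) \<partial>\<Omega>)
    = (\<integral>\<^sup>+s. \<integral>\<^sup>+u. emeasure \<Omega> {w \<in> space \<Omega>. y w \<le> s \<and> 0 \<le> u \<and> u < cost_kernel q s (x w)} \<partial>lborel \<partial>lborel)"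
proof -
  interpret \<Omega>: sigma_finite_measure \<Omega> by fact
  interpret P: pair_sigma_finite \<Omega> lborel ..
  have "(\<integral>\<^sup>+w. ennreal (max 0 (x w - y w) powr q) \<partial>\<Omega>)
     = (\<integral>\<^sup>+w. \<integral>\<^sup>+s. indicator {y w..} s * ennreal (cost_kernel q s (x w)) \<partial>lborel \<partial>\<Omega>)"
    using assms by (simp add: nn_integral_cost_kernel)
  also have "\<dots> = (\<integral>\<^sup>+w. \<integral>\<^sup>+s. (if y w \<le> s then ennreal (cost_kernel q s (x w)) else 0) \<partial>lborel \<partial>\<Omega>)"
    by (intro nn_integral_cong) (auto simp: indicator_def)
  also have "\<dots> = (\<integral>\<^sup>+s. \<integral>\<^sup>+w. (if y w \<le> s then ennreal (cost_kernel q s (x w)) else 0) \<partial>\<Omega> \<partial>lborel)"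
    by (rule P.Fubini'[symmetric]) measurable
  also have "\<dots> = (\<integral>\<^sup>+s. \<integral>\<^sup>+w. \<integral>\<^sup>+u. (if y w \<le> s \<and> 0 \<le> u \<and> u < cost_kernel q s (x w) then 1 else 0) \<partial>lborel \<partial>\<Omega> \<partial>lborel)"
  proof (intro nn_integral_cong)
    fix s w
    have "(\<integral>\<^sup>+u. (if y w \<le> s \<and> 0 \<le> u \<and> u < cost_kernel q s (x w) then 1 else 0) \<partial>lborel)
        = (\<integral>\<^sup>+u. (if y w \<le> s then 1 else 0) * indicator {u. 0 \<le> u \<and> u < cost_kernel q s (x w)} u \<partial>lborel)"
      by (intro nn_integral_cong) (auto simp: indicator_def)
    also have "\<dots> = (if y w \<le> s then ennreal (cost_kernel q s (x w)) else 0)"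
      by (subst nn_integral_cmult) (auto simp: nn_integral_layer)
    finally show "(if y w \<le> s then ennreal (cost_kernel q s (x w)) else 0) =
       (\<integral>\<^sup>+u. (if y w \<le> s \<and> 0 \<le> u \<and> u < cost_kernel q s (x w) then 1 else 0) \<partial>lborel)" ..
  qed
  also have "\<dots> = (\<integral>\<^sup>+s. \<integral>\<^sup>+u. \<integral>\<^sup>+w. (if y w \<le> s \<and> 0 \<le> u \<and> u < cost_kernel q s (x w) then 1 else 0) \<partial>\<Omega> \<partial>lborel \<partial>lborel)"
    by (intro nn_integral_cong P.Fubini'[symmetric]) measurable
  also have "\<dots> = (\<integral>\<^sup>+s. \<integral>\<^sup>+u. emeasure \<Omega> {w \<in> space \<Omega>. y w \<le> s \<and> 0 \<le> u \<and> u < cost_kernel q s (x w)} \<partial>lborel \<partial>lborel)"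
  proof (intro nn_integral_cong)
    fix s u
    have "(\<integral>\<^sup>+w. (if y w \<le> s \<and> 0 \<le> u \<and> u < cost_kernel q s (x w) then 1 else 0) \<partial>\<Omega>)
       = (\<integral>\<^sup>+w. indicator {w \<in> space \<Omega>. y w \<le> s \<and> 0 \<le> u \<and> u < cost_kernel q s (x w)} w \<partial>\<Omega>)"
      by (intro nn_integral_cong) (auto simp: indicator_def)
    then show "(\<integral>\<^sup>+w. (if y w \<le> s \<and> 0 \<le> u \<and> u < cost_kernel q s (x w) then 1 else 0) \<partial>\<Omega>)
       = emeasure \<Omega> {w \<in> space \<Omega>. y w \<le> s \<and> 0 \<le> u \<and> u < cost_kernel q s (x w)}"
      by simp
  qed
  finally show ?thesis .
qed

text \<open>Any coupling gives the event at least \<open>P(y \<le> s) + P(x \<in> B) - 1\<close>.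
  The monotone coupling attains the positive part of this: labels with \<open>quantile\<close> of
  \<open>x\<close> in the up-set \<open>B\<close> lie to the right of \<open>1 - P(B)\<close>, those
  with \<open>quantile\<close> of \<open>y\<close> at most \<open>s\<close> to the left of the
  distribution function of \<open>y\<close> at \<open>s\<close>.\<close>

lemma upset_coupling_bound:
  assumes \<Omega>: "prob_space \<Omega>" and [measurable]: "x \<in> borel_measurable \<Omega>" "y \<in> borel_measurable \<Omega>" "B \<in> sets borel"
    and up: "\<And>a b. a \<in> B \<Longrightarrow> a \<le> b \<Longrightarrow> b \<in> B"
  shows "emeasure unif {z. quantile (distr \<Omega> borel y) z \<le> s \<and> quantile (distr \<Omega> borel x) z \<in> B}
    \<le> emeasure \<Omega> {w \<in> space \<Omega>. y w \<le> s \<and> x w \<in> B}"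
proof -
  interpret \<Omega>: prob_space \<Omega> by fact
  define \<mu> \<nu> where "\<mu> = distr \<Omega> borel x" and "\<nu> = distr \<Omega> borel y"
  have \<mu>: "real_distribution \<mu>" and \<nu>: "real_distribution \<nu>"
    unfolding \<mu>_def \<nu>_def by (simp_all add: \<Omega>.real_distribution_distr)
  note [measurable] = borel_measurable_quantile[OF \<mu>] borel_measurable_quantile[OF \<nu>]
  have xB: "measure \<Omega> {w \<in> space \<Omega>. x w \<in> B} = measure unif {z. quantile \<mu> z \<in> B}"
  proof -
    have "measure \<Omega> {w \<in> space \<Omega>. x w \<in> B} = measure \<mu> B"
      unfolding \<mu>_def by (subst measure_distr) (auto intro!: arg_cong[where f="measure \<Omega>"])
    also have "\<dots> = measure unif {z. quantile \<mu> z \<in> B}"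
      by (subst distr_quantile[OF \<mu>, symmetric], subst measure_distr) (auto simp: vimage_def)
    finally show ?thesis .
  qed
  have yS: "measure \<Omega> {w \<in> space \<Omega>. y w \<le> s} = cdf \<nu> s"
    unfolding \<nu>_def cdf_def by (subst measure_distr) (auto intro!: arg_cong[where f="measure \<Omega>"])
  let ?m = "measure unif {z. quantile \<mu> z \<in> B}"
  have ge: "1 - ?m \<le> z" if "0 < z" "z < 1" "quantile \<mu> z \<in> B" for z
  proof -
    have "1 - z \<le> ?m"
      using that quantile_mono[OF \<mu>, of z] by (intro measure_unif_ge) (auto intro: up)
    then show ?thesis by simp
  qed
  have "measure unif {z. quantile \<nu> z \<le> s \<and> quantile \<mu> z \<in> B} \<le> max (1 - ?m) (cdf \<nu> s) - (1 - ?m)"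
    by (rule measure_unif_le) (auto simp: quantile_le_iff[OF \<nu>] ge)
  also have "\<dots> \<le> measure \<Omega> {w \<in> space \<Omega>. y w \<le> s \<and> x w \<in> B}"
  proof -
    have "measure \<Omega> {w \<in> space \<Omega>. y w \<le> s} + measure \<Omega> {w \<in> space \<Omega>. x w \<in> B}
      = measure \<Omega> {w \<in> space \<Omega>. y w \<le> s \<or> x w \<in> B} + measure \<Omega> {w \<in> space \<Omega>. y w \<le> s \<and> x w \<in> B}"
    proof -
      have *: "{w \<in> space \<Omega>. y w \<le> s \<or> x w \<in> B} = {w \<in> space \<Omega>. y w \<le> s} \<union> {w \<in> space \<Omega>. x w \<in> B}"
        "{w \<in> space \<Omega>. y w \<le> s \<and> x w \<in> B} = {w \<in> space \<Omega>. y w \<le> s} \<inter> {w \<in> space \<Omega>. x w \<in> B}"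
        by auto
      show ?thesis unfolding * by (subst measure_Un3) (auto simp: \<Omega>.fmeasurable_eq_sets)
    qed
    moreover have "measure \<Omega> {w \<in> space \<Omega>. y w \<le> s \<or> x w \<in> B} \<le> 1"
      by (rule \<Omega>.prob_le_1)
    ultimately show ?thesis
      using xB yS measure_nonneg[of \<Omega> "{w \<in> space \<Omega>. y w \<le> s \<and> x w \<in> B}"] by (simp add: max_def; linarith)
  qed
  finally show ?thesis
    by (simp add: unif.emeasure_eq_measure \<Omega>.emeasure_eq_measure \<mu>_def \<nu>_def)
qed

text \<open>As \<open>cost_kernel\<close> is monotone in its last argument, its superlevel sets are
  up-sets, and the layers of the two costs are ordered pointwise in \<open>s\<close> and
  \<open>u\<close>. The other half of the cost follows by exchanging \<open>x\<close> and
  \<open>y\<close>.\<close>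

lemma quantile_coupling_half:
  assumes "q \<ge> 1" and \<Omega>: "prob_space \<Omega>" and [measurable]: "x \<in> borel_measurable \<Omega>" "y \<in> borel_measurable \<Omega>"
  shows "(\<integral>\<^sup>+z. ennreal (max 0 (quantile (distr \<Omega> borel x) z - quantile (distr \<Omega> borel y) z) powr q) \<partial>unif)
    \<le> (\<integral>\<^sup>+w. ennreal (max 0 (x w - y w) powr q) \<partial>\<Omega>)"
proof -
  interpret \<Omega>: prob_space \<Omega> by fact
  have [measurable]: "quantile (distr \<Omega> borel x) \<in> borel_measurable borel"
    "quantile (distr \<Omega> borel y) \<in> borel_measurable borel"
    by (simp_all add: borel_measurable_quantile \<Omega>.real_distribution_distr)
  show ?thesis
    apply (subst (1 2) powr_cost_layers[OF \<open>q \<ge> 1\<close>])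
    apply (simp_all add: unif.sigma_finite_measure_axioms \<Omega>.sigma_finite_measure_axioms)
  proof (intro nn_integral_mono)
    fix s u :: real
    let ?B = "{x. 0 \<le> u \<and> u < cost_kernel q s x}"
    have "emeasure unif {z. quantile (distr \<Omega> borel y) z \<le> s \<and> quantile (distr \<Omega> borel x) z \<in> ?B}
    \<le> emeasure \<Omega> {w \<in> space \<Omega>. y w \<le> s \<and> x w \<in> ?B}"
      using cost_kernel_mono[OF \<open>q \<ge> 1\<close>, of _ _ s]
      by (intro upset_coupling_bound \<Omega>) (auto intro: less_le_trans)
    then show "emeasure unif {w. quantile (distr \<Omega> borel y) w \<le> s \<and> 0 \<le> u \<and> u < cost_kernel q s (quantile (distr \<Omega> borel x) w)}
       \<le> emeasure \<Omega> {w \<in> space \<Omega>. y w \<le> s \<and> 0 \<le> u \<and> u < cost_kernel q s (x w)}"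
      by simp
  qed
qed

lemma abs_powr_split:
  "q > 0 \<Longrightarrow> \<bar>a - b\<bar> powr q = max 0 (a - b) powr q + max 0 (b - a :: real) powr q"
  by (cases "a \<le> b") (auto simp: max_def)

lemma quantile_coupling_optimal:
  assumes "q \<ge> 1" and \<Omega>: "prob_space \<Omega>" and [measurable]: "x \<in> borel_measurable \<Omega>" "y \<in> borel_measurable \<Omega>"
  shows "(\<integral>\<^sup>+z. ennreal (\<bar>quantile (distr \<Omega> borel x) z - quantile (distr \<Omega> borel y) z\<bar> powr q) \<partial>unif)
    \<le> (\<integral>\<^sup>+w. ennreal (\<bar>x w - y w\<bar> powr q) \<partial>\<Omega>)"
proof -
  interpret \<Omega>: prob_space \<Omega> by fact
  have [measurable]: "quantile (distr \<Omega> borel x) \<in> borel_measurable borel"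
    "quantile (distr \<Omega> borel y) \<in> borel_measurable borel"
    by (simp_all add: borel_measurable_quantile \<Omega>.real_distribution_distr)
  show ?thesis
    using \<open>q \<ge> 1\<close> quantile_coupling_half[OF assms] quantile_coupling_half[OF assms(1,2,4,3)]
    by (simp add: abs_powr_split ennreal_plus nn_integral_add add_mono)
qed

text \<open>If two variables differ by at most \<open>M\<close>, one distribution function lies
  below the other shifted by \<open>M\<close>, and quantiles inherit the shift. This treats the
  exponent infinity directly, without a limit of finite exponents.\<close>

lemma quantile_coupling_sup:
  assumes \<Omega>: "prob_space \<Omega>" and [measurable]: "x \<in> borel_measurable \<Omega>" "y \<in> borel_measurable \<Omega>"
    and b: "AE w in \<Omega>. \<bar>x w - y w\<bar> \<le> M" and z: "0 < z" "z < 1"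
  shows "\<bar>quantile (distr \<Omega> borel x) z - quantile (distr \<Omega> borel y) z\<bar> \<le> M"
proof -
  interpret \<Omega>: prob_space \<Omega> by fact
  have half: "quantile (distr \<Omega> borel g) z \<le> quantile (distr \<Omega> borel f) z + M"
    if [measurable]: "f \<in> borel_measurable \<Omega>" "g \<in> borel_measurable \<Omega>" and b: "AE w in \<Omega>. \<bar>f w - g w\<bar> \<le> M" for f g
  proof -
    have d: "real_distribution (distr \<Omega> borel f)" "real_distribution (distr \<Omega> borel g)"
      by (simp_all add: \<Omega>.real_distribution_distr)
    have "cdf (distr \<Omega> borel f) t \<le> cdf (distr \<Omega> borel g) (t + M)" for t
      unfolding cdf_def by (subst (1 2) measure_distr, simp, simp, simp, simp,
        intro \<Omega>.finite_measure_mono_AE) (use b in auto)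
    moreover have "z \<le> cdf (distr \<Omega> borel f) (quantile (distr \<Omega> borel f) z)"
      using z by (subst quantile_le_iff[OF d(1), symmetric]) auto
    ultimately show ?thesis
      using z by (subst quantile_le_iff[OF d(2)]) (auto intro: order_trans)
  qed
  have "AE w in \<Omega>. \<bar>y w - x w\<bar> \<le> M" using b by eventually_elim (simp add: abs_minus_commute)
  from half[OF _ _ b] half[OF _ _ this] show ?thesis by auto
qed

section \<open>Wasserstein distances and moments through quantile functions\<close>

text \<open>Convexity of the power covers positive arguments; if one argument is 0 the claim reduces
  to \<open>t powr q \<le> t\<close> for \<open>0 \<le> t \<le> 1\<close>.\<close>

lemma powr_avg:
  assumes "q \<ge> 1" "0 \<le> \<theta>" "\<theta> \<le> 1" "0 \<le> a" "0 \<le> (m::real)"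
  shows "(\<theta> * a + (1 - \<theta>) * m) powr q \<le> \<theta> * a powr q + (1 - \<theta>) * m powr q"
proof (cases "a = 0 \<or> m = 0")
  case False
  then show ?thesis
    using convex_onD[OF powr_convex[OF \<open>q \<ge> 1\<close>], of "1 - \<theta>" a m] assms by simp
next
  case True
  have *: "(t * c) powr q \<le> t * c powr q" if "0 \<le> t" "t \<le> 1" "0 \<le> c" for t c :: real
  proof -
    have "t powr q \<le> t powr 1"
      using that assms by (intro powr_mono') auto
    then show ?thesis using that by (simp add: powr_mult mult_right_mono)
  qed
  show ?thesis using True *[of \<theta> a] *[of "1 - \<theta>" m] assms by auto
qed

lemma convex_on_abs_powr: "q \<ge> 1 \<Longrightarrow> convex_on UNIV (\<lambda>x::real. \<bar>x\<bar> powr q)"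
proof (rule convex_onI)
  fix t x y :: real assume "q \<ge> 1" "0 < t" "t < 1"
  then have "\<bar>(1 - t) *\<^sub>R x + t *\<^sub>R y\<bar> powr q \<le> ((1 - t) * \<bar>x\<bar> + (1 - (1 - t)) * \<bar>y\<bar>) powr q"
    by (intro powr_mono2) (auto intro!: order_trans[OF abs_triangle_ineq] simp: abs_mult)
  also have "\<dots> \<le> (1 - t) * \<bar>x\<bar> powr q + (1 - (1 - t)) * \<bar>y\<bar> powr q"
    using \<open>q \<ge> 1\<close> \<open>0 < t\<close> \<open>t < 1\<close> by (intro powr_avg) auto
  finally show "\<bar>(1 - t) *\<^sub>R x + t *\<^sub>R y\<bar> powr q \<le> (1 - t) * \<bar>x\<bar> powr q + t * \<bar>y\<bar> powr q" by simp
qed simp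

section \<open>Integrability and norms of functions of the label\<close>

definition in_Lp :: "ennreal \<Rightarrow> (real \<Rightarrow> real) \<Rightarrow> bool" where
  "in_Lp p f \<longleftrightarrow> f \<in> borel_measurable borel \<and>
     (if p = \<infinity> then \<exists>K. AE z in unif. \<bar>f z\<bar> \<le> K else integrable unif (\<lambda>z. \<bar>f z\<bar> powr enn2real p))"

definition Lp_norm :: "ennreal \<Rightarrow> (real \<Rightarrow> real) \<Rightarrow> real" where
  "Lp_norm p f = (if p = \<infinity> then enn2real (esssup unif (\<lambda>z. ennreal \<bar>f z\<bar>))
     else enn2real (\<integral>\<^sup>+z. ennreal (\<bar>f z\<bar> powr enn2real p) \<partial>unif) powr (1 / enn2real p))"

lemma enn2real_ge_1: "1 \<le> p \<Longrightarrow> p \<noteq> \<infinity> \<Longrightarrow> 1 \<le> enn2real p"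
  using enn2real_mono[of 1 p] by (auto simp: top.not_eq_extremum infinity_ennreal_def)

lemma in_Lp_measurable: "in_Lp p f \<Longrightarrow> f \<in> borel_measurable borel"
  by (simp add: in_Lp_def)

lemma in_Lp_mono:
  assumes "1 \<le> p" "in_Lp p g" "f \<in> borel_measurable borel" "AE z in unif. \<bar>f z\<bar> \<le> \<bar>g z\<bar>"
  shows "in_Lp p f"
proof -
  note [measurable] = assms(3)
  show ?thesis
  proof (cases "p = \<infinity>")
    case True
    then obtain K where "AE z in unif. \<bar>g z\<bar> \<le> K" using assms by (auto simp: in_Lp_def)
    with assms(4) have "AE z in unif. \<bar>f z\<bar> \<le> K" by eventually_elim auto
    then show ?thesis using True by (auto simp: in_Lp_def)
  next
    case False
    have "integrable unif (\<lambda>z. \<bar>f z\<bar> powr enn2real p)"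
    proof (rule Bochner_Integration.integrable_bound)
      show "integrable unif (\<lambda>z. \<bar>g z\<bar> powr enn2real p)" using False assms by (simp add: in_Lp_def)
      show "AE z in unif. norm (\<bar>f z\<bar> powr enn2real p) \<le> norm (\<bar>g z\<bar> powr enn2real p)"
        using assms(4) by eventually_elim (auto intro!: powr_mono2)
    qed simp
    then show ?thesis using False by (simp add: in_Lp_def)
  qed
qed

lemma in_Lp_const: "in_Lp p (\<lambda>_. c)"
  by (auto simp: in_Lp_def)

lemma in_Lp_cmult:
  assumes "1 \<le> p" "in_Lp p f"
  shows "in_Lp p (\<lambda>z. c * f z)"
proof (cases "p = \<infinity>")
  case True
  then obtain K where "AE z in unif. \<bar>f z\<bar> \<le> K" using assms by (auto simp: in_Lp_def)
  then have "AE z in unif. \<bar>c * f z\<bar> \<le> \<bar>c\<bar> * K"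
    by eventually_elim (auto simp: abs_mult intro: mult_left_mono)
  then show ?thesis using assms True by (auto simp: in_Lp_def)
qed (use assms in \<open>auto simp: in_Lp_def abs_mult powr_mult\<close>)

lemma in_Lp_abs_add:
  assumes "1 \<le> p" "in_Lp p f" "in_Lp p g"
  shows "in_Lp p (\<lambda>z. \<bar>f z\<bar> + \<bar>g z\<bar>)"
proof -
  note [measurable] = assms(2,3)[THEN in_Lp_measurable]
  show ?thesis
  proof (cases "p = \<infinity>")
    case True
    then obtain K L where "AE z in unif. \<bar>f z\<bar> \<le> K" "AE z in unif. \<bar>g z\<bar> \<le> L"
      using assms by (auto simp: in_Lp_def)
    then have "AE z in unif. \<bar>\<bar>f z\<bar> + \<bar>g z\<bar>\<bar> \<le> K + L" by eventually_elim auto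
    then show ?thesis using assms True by (auto simp: in_Lp_def)
  next
    case False
    define q where "q = enn2real p"
    have q: "q \<ge> 1" unfolding q_def by (rule enn2real_ge_1[OF assms(1) False])
    have "integrable unif (\<lambda>z. \<bar>\<bar>f z\<bar> + \<bar>g z\<bar>\<bar> powr q)"
    proof (rule Bochner_Integration.integrable_bound)
      show "integrable unif (\<lambda>z. 2 powr q * (\<bar>f z\<bar> powr q + \<bar>g z\<bar> powr q))"
        using assms False by (auto simp: in_Lp_def q_def)
      have "\<bar>\<bar>a\<bar> + \<bar>b\<bar>\<bar> powr q \<le> 2 powr q * (\<bar>a\<bar> powr q + \<bar>b\<bar> powr q)" for a b :: real
      proof -
        have "\<bar>\<bar>a\<bar> + \<bar>b\<bar>\<bar> powr q = (2 * (1/2 * \<bar>a\<bar> + (1 - 1/2) * \<bar>b\<bar>)) powr q" by simp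
        also have "\<dots> = 2 powr q * (1/2 * \<bar>a\<bar> + (1 - 1/2) * \<bar>b\<bar>) powr q"
          by (subst powr_mult) auto
        also have "\<dots> \<le> 2 powr q * (1/2 * \<bar>a\<bar> powr q + (1 - 1/2) * \<bar>b\<bar> powr q)"
          using q by (intro mult_left_mono powr_avg) auto
        also have "\<dots> \<le> 2 powr q * (\<bar>a\<bar> powr q + \<bar>b\<bar> powr q)"
          by (intro mult_left_mono) (auto intro!: add_mono)
        finally show ?thesis .
      qed
      then show "AE z in unif. norm (\<bar>\<bar>f z\<bar> + \<bar>g z\<bar>\<bar> powr q) \<le> norm (2 powr q * (\<bar>f z\<bar> powr q + \<bar>g z\<bar> powr q))"
        by (auto simp: abs_mult)
    qed simp
    then show ?thesis using False by (simp add: in_Lp_def q_def)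
  qed
qed

lemma in_Lp_diff:
  assumes "1 \<le> p" "in_Lp p f" "in_Lp p g"
  shows "in_Lp p (\<lambda>z. f z - g z)"
  using assms(2,3)[THEN in_Lp_measurable]
  by (intro in_Lp_mono[OF assms(1) in_Lp_abs_add[OF assms]]) auto

lemma in_Lp_integrable:
  assumes "1 \<le> p" "in_Lp p f"
  shows "integrable unif f"
proof -
  note [measurable] = assms(2)[THEN in_Lp_measurable]
  show ?thesis
  proof (cases "p = \<infinity>")
    case True
    then obtain K where K: "AE z in unif. \<bar>f z\<bar> \<le> K" using assms by (auto simp: in_Lp_def)
    show ?thesis by (rule unif.integrable_const_bound[of _ K]) (use K in auto)
  next
    case False
    define q where "q = enn2real p"
    have q: "q \<ge> 1" unfolding q_def by (rule enn2real_ge_1[OF assms(1) False])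
    show ?thesis
    proof (rule Bochner_Integration.integrable_bound)
      show "integrable unif (\<lambda>z. 1 + \<bar>f z\<bar> powr q)"
        using assms False by (auto simp: in_Lp_def q_def)
      have "\<bar>x\<bar> \<le> 1 + \<bar>x\<bar> powr q" for x :: real
        using powr_mono[of 1 q "\<bar>x\<bar>"] q by (cases "\<bar>x\<bar> \<le> 1") (auto simp: add_increasing2)
      then show "AE z in unif. norm (f z) \<le> norm (1 + \<bar>f z\<bar> powr q)"
        by (auto intro!: AE_I2 simp: abs_of_nonneg add_nonneg_nonneg)
    qed simp
  qed
qed

lemma Lp_norm_nonneg: "Lp_norm p f \<ge> 0"
  by (simp add: Lp_norm_def)

lemma Lp_norm_finite:
  assumes "in_Lp p f" "p \<noteq> \<infinity>"
  shows "Lp_norm p f = (\<integral>z. \<bar>f z\<bar> powr enn2real p \<partial>unif) powr (1 / enn2real p)"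
  using assms by (simp add: Lp_norm_def in_Lp_def nn_integral_eq_integral)

lemma Lp_norm_powr:
  assumes "1 \<le> p" "in_Lp p f" "p \<noteq> \<infinity>"
  shows "Lp_norm p f powr enn2real p = (\<integral>z. \<bar>f z\<bar> powr enn2real p \<partial>unif)"
  using enn2real_ge_1[OF assms(1,3)] by (simp add: Lp_norm_finite[OF assms(2,3)] powr_powr)

lemma Lp_norm_leI:
  assumes "1 \<le> p" "in_Lp p f" "p \<noteq> \<infinity>" "(\<integral>z. \<bar>f z\<bar> powr enn2real p \<partial>unif) \<le> c powr enn2real p" "0 \<le> c"
  shows "Lp_norm p f \<le> c"
proof -
  have "Lp_norm p f \<le> (c powr enn2real p) powr (1 / enn2real p)"
    using assms unfolding Lp_norm_finite[OF assms(2,3)] by (intro powr_mono2) auto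
  also have "\<dots> = c" using enn2real_ge_1[OF assms(1,3)] assms by (simp add: powr_powr)
  finally show ?thesis .
qed

text \<open>The bound contained in \<open>in_Lp\<close> makes the essential supremum finite, so that
  \<open>enn2real\<close> does not collapse it to 0.\<close>

lemma Linf_norm_AE:
  assumes "in_Lp \<infinity> f"
  shows "AE z in unif. \<bar>f z\<bar> \<le> Lp_norm \<infinity> f"
proof -
  note [measurable] = assms[THEN in_Lp_measurable]
  obtain K where K: "AE z in unif. \<bar>f z\<bar> \<le> K" using assms by (auto simp: in_Lp_def)
  have "esssup unif (\<lambda>z. ennreal \<bar>f z\<bar>) \<le> ennreal K"
    by (rule esssup_I) (use K in \<open>auto simp: ennreal_leI\<close>)
  then have "ennreal (Lp_norm \<infinity> f) = esssup unif (\<lambda>z. ennreal \<bar>f z\<bar>)"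
    by (simp add: Lp_norm_def le_less_trans[OF _ ennreal_less_top])
  then have "AE z in unif. ennreal \<bar>f z\<bar> \<le> ennreal (Lp_norm \<infinity> f)"
    using esssup_AE[of "\<lambda>z. ennreal \<bar>f z\<bar>" unif] by simp
  then show ?thesis by eventually_elim (simp add: ennreal_le_iff[OF Lp_norm_nonneg])
qed

lemma Linf_norm_leI:
  assumes [measurable]: "f \<in> borel_measurable borel" and "AE z in unif. \<bar>f z\<bar> \<le> c" "0 \<le> c"
  shows "Lp_norm \<infinity> f \<le> c"
proof -
  have "esssup unif (\<lambda>z. ennreal \<bar>f z\<bar>) \<le> ennreal c"
    by (rule esssup_I) (use assms(2) in \<open>auto simp: ennreal_leI\<close>)
  then show ?thesis using \<open>0 \<le> c\<close> by (simp add: Lp_norm_def enn2real_leI)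
qed

lemma Lp_norm_mono:
  assumes "1 \<le> p" "in_Lp p g" "f \<in> borel_measurable borel" "AE z in unif. \<bar>f z\<bar> \<le> \<bar>g z\<bar>"
  shows "Lp_norm p f \<le> Lp_norm p g"
proof (cases "p = \<infinity>")
  case True
  with assms(2) have "AE z in unif. \<bar>g z\<bar> \<le> Lp_norm \<infinity> g" using Linf_norm_AE[of g] by simp
  with assms(4) have "AE z in unif. \<bar>f z\<bar> \<le> Lp_norm \<infinity> g" by eventually_elim simp
  then show ?thesis using True Linf_norm_leI[OF assms(3) _ Lp_norm_nonneg] by simp
next
  case False
  have f: "in_Lp p f" using assms by (rule in_Lp_mono)
  have "(\<integral>z. \<bar>f z\<bar> powr enn2real p \<partial>unif) \<le> (\<integral>z. \<bar>g z\<bar> powr enn2real p \<partial>unif)"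
    using f assms False
    by (intro integral_mono_AE) (auto simp: in_Lp_def intro!: powr_mono2 elim!: eventually_mono)
  then show ?thesis
    using assms f False by (intro Lp_norm_leI) (auto simp: Lp_norm_powr Lp_norm_nonneg)
qed

lemma Lp_norm_cmult:
  assumes "1 \<le> p" "in_Lp p f" "0 \<le> c"
  shows "Lp_norm p (\<lambda>z. c * f z) \<le> c * Lp_norm p f"
proof (cases "p = \<infinity>")
  case True
  note [measurable] = assms(2)[THEN in_Lp_measurable]
  have "AE z in unif. \<bar>f z\<bar> \<le> Lp_norm \<infinity> f" using assms True Linf_norm_AE[of f] by simp
  then have "AE z in unif. \<bar>c * f z\<bar> \<le> c * Lp_norm \<infinity> f"
    by eventually_elim (use \<open>0 \<le> c\<close> in \<open>auto simp: abs_mult intro: mult_left_mono\<close>)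
  then have "Lp_norm \<infinity> (\<lambda>z. c * f z) \<le> c * Lp_norm \<infinity> f"
    using assms(3) by (intro Linf_norm_leI) (auto simp: Lp_norm_nonneg)
  then show ?thesis using True by simp
next
  case False
  then show ?thesis
    using assms by (intro Lp_norm_leI in_Lp_cmult)
      (auto simp: Lp_norm_nonneg powr_mult Lp_norm_powr abs_mult)
qed

lemma L1_le_Lp_norm:
  assumes "1 \<le> p" "in_Lp p f"
  shows "(\<integral>z. \<bar>f z\<bar> \<partial>unif) \<le> Lp_norm p f"
proof (cases "p = \<infinity>")
  case True
  have "AE z in unif. \<bar>f z\<bar> \<le> Lp_norm p f" using assms True Linf_norm_AE[of f] by simp
  moreover have "integrable unif f" using in_Lp_integrable[OF assms] .
  ultimately have "(\<integral>z. \<bar>f z\<bar> \<partial>unif) \<le> (\<integral>z. Lp_norm p f \<partial>unif)"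
    by (intro integral_mono_AE) auto
  then show ?thesis by simp
next
  case False
  define q where "q = enn2real p"
  have q: "q \<ge> 1" unfolding q_def by (rule enn2real_ge_1[OF assms(1) False])
  have "(\<integral>z. \<bar>f z\<bar> \<partial>unif) powr q = \<bar>\<integral>z. \<bar>f z\<bar> \<partial>unif\<bar> powr q" by simp
  also have "\<dots> \<le> (\<integral>z. \<bar>\<bar>f z\<bar>\<bar> powr q \<partial>unif)"
    using in_Lp_integrable[OF assms] assms False
    by (intro unif.jensens_inequality[where I=UNIV and X="\<lambda>z. \<bar>f z\<bar>"] convex_on_abs_powr q)
      (auto simp: in_Lp_def q_def)
  also have "\<dots> = Lp_norm p f powr q"
    using assms False by (simp add: Lp_norm_powr q_def)
  finally show ?thesis
    using q powr_less_mono2[of q "Lp_norm p f" "\<integral>z. \<bar>f z\<bar> \<partial>unif"] Lp_norm_nonneg[of p f] by force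
qed

text \<open>The power of a convex combination is at most the combination of the powers, and over a
  probability space the mean of \<open>\<bar>g\<bar>\<close> is at most its norm. No factor
  depending on \<open>p\<close> arises, which is why the stability rate is the same for all
  exponents.\<close>

lemma Lp_norm_avg:
  assumes p: "1 \<le> p" and g: "in_Lp p g" and "0 \<le> \<theta>" "\<theta> \<le> 1" and [measurable]: "f \<in> borel_measurable borel"
    and f: "AE z in unif. \<bar>f z\<bar> \<le> \<theta> * \<bar>g z\<bar> + (1 - \<theta>) * (\<integral>z. \<bar>g z\<bar> \<partial>unif)"
  shows "Lp_norm p f \<le> Lp_norm p g"
proof -
  note [measurable] = in_Lp_measurable[OF g]
  define m where "m = (\<integral>z. \<bar>g z\<bar> \<partial>unif)"
  have m: "0 \<le> m" "m \<le> Lp_norm p g" using L1_le_Lp_norm[OF p g] by (simp_all add: m_def)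
  show ?thesis
  proof (cases "p = \<infinity>")
    case True
    have "AE z in unif. \<bar>g z\<bar> \<le> Lp_norm p g" using g True Linf_norm_AE[of g] by simp
    with f have "AE z in unif. \<bar>f z\<bar> \<le> Lp_norm p g"
    proof eventually_elim
      case (elim z)
      have "\<theta> * \<bar>g z\<bar> + (1 - \<theta>) * m \<le> \<theta> * Lp_norm p g + (1 - \<theta>) * Lp_norm p g"
        using elim m assms by (intro add_mono mult_left_mono) auto
      with elim show ?case by (simp add: m_def algebra_simps)
    qed
    then show ?thesis using True Lp_norm_nonneg Linf_norm_leI by auto
  next
    case False
    define q where "q = enn2real p"
    have q: "q \<ge> 1" unfolding q_def by (rule enn2real_ge_1[OF p False])
    have int: "integrable unif (\<lambda>z. \<bar>g z\<bar> powr q)" using g False by (simp add: in_Lp_def q_def)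
    have b: "AE z in unif. \<bar>f z\<bar> powr q \<le> \<theta> * \<bar>g z\<bar> powr q + (1 - \<theta>) * m powr q"
      using f
    proof eventually_elim
      case (elim z)
      have "\<bar>f z\<bar> powr q \<le> (\<theta> * \<bar>g z\<bar> + (1 - \<theta>) * m) powr q"
        using elim q by (intro powr_mono2) (auto simp: m_def)
      also have "\<dots> \<le> \<theta> * \<bar>g z\<bar> powr q + (1 - \<theta>) * m powr q"
        using assms q m by (intro powr_avg) auto
      finally show ?case .
    qed
    have int': "integrable unif (\<lambda>z. \<theta> * \<bar>g z\<bar> powr q + (1 - \<theta>) * m powr q)" using int by auto
    have intf: "integrable unif (\<lambda>z. \<bar>f z\<bar> powr q)"
      by (rule Bochner_Integration.integrable_bound[OF int']) (use b in \<open>auto elim!: eventually_mono\<close>)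
    have "(\<integral>z. \<bar>f z\<bar> powr q \<partial>unif) \<le> (\<integral>z. \<theta> * \<bar>g z\<bar> powr q + (1 - \<theta>) * m powr q \<partial>unif)"
      by (rule integral_mono_AE[OF intf int' b])
    also have "\<dots> = \<theta> * Lp_norm p g powr q + (1 - \<theta>) * m powr q"
      using int Lp_norm_powr[OF p g False] by (simp add: q_def)
    also have "\<dots> \<le> \<theta> * Lp_norm p g powr q + (1 - \<theta>) * Lp_norm p g powr q"
      using m assms q by (intro add_left_mono mult_left_mono powr_mono2) auto
    finally have "(\<integral>z. \<bar>f z\<bar> powr q \<partial>unif) \<le> Lp_norm p g powr q" by (simp add: algebra_simps)
    then show ?thesis
      using intf False p by (intro Lp_norm_leI Lp_norm_nonneg) (auto simp: in_Lp_def q_def)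
  qed
qed

section \<open>Moments and couplings in terms of quantiles\<close>

lemma prob_moment_real_distribution: "\<mu> \<in> prob_moment p \<Longrightarrow> real_distribution \<mu>"
  by (simp add: prob_moment_def)

lemma in_Lp_quantile:
  assumes "\<mu> \<in> prob_moment p"
  shows "in_Lp p (quantile \<mu>)"
proof -
  have \<mu>: "real_distribution \<mu>" using assms by (rule prob_moment_real_distribution)
  note [measurable] = borel_measurable_quantile[OF \<mu>]
  show ?thesis
  proof (cases "p = \<infinity>")
    case True
    then obtain K where K: "compact K" "AE x in \<mu>. x \<in> K" using assms by (auto simp: prob_moment_def)
    then obtain B where B: "\<And>x. x \<in> K \<Longrightarrow> \<bar>x\<bar> \<le> B"
      using compact_imp_bounded[OF K(1)] by (auto simp: bounded_iff)
    have "AE x in distr unif borel (quantile \<mu>). \<bar>x\<bar> \<le> B"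
      using K(2) B unfolding distr_quantile[OF \<mu>] by (auto elim!: eventually_mono)
    then have "AE z in unif. \<bar>quantile \<mu> z\<bar> \<le> B" by (subst (asm) AE_distr_iff) auto
    then show ?thesis using True by (auto simp: in_Lp_def)
  next
    case False
    then show ?thesis
      using assms integrable_quantile[OF \<mu>, of "\<lambda>x. \<bar>x\<bar> powr enn2real p"]
      by (simp add: in_Lp_def prob_moment_def)
  qed
qed

lemma distr_unif_prob_moment:
  assumes "in_Lp p X"
  shows "distr unif borel X \<in> prob_moment p"
proof -
  note [measurable] = in_Lp_measurable[OF assms]
  show ?thesis
  proof (cases "p = \<infinity>")
    case True
    then obtain K where K: "AE z in unif. \<bar>X z\<bar> \<le> K" using assms by (auto simp: in_Lp_def)
    then have "AE x in distr unif borel X. x \<in> {-K..K}"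
      by (subst AE_distr_iff) (auto elim!: eventually_mono)
    then show ?thesis
      unfolding prob_moment_def mem_Collect_eq if_P[OF True]
      by (intro conjI exI[of _ "{-K..K}"] real_distribution_distr_unif compact_Icc in_Lp_measurable[OF assms])
  next
    case False
    then show ?thesis
      using assms real_distribution_distr_unif[of X]
      by (simp add: in_Lp_def prob_moment_def integrable_distr_eq)
  qed
qed

lemma distr_pair_coupling:
  assumes [measurable]: "X \<in> borel_measurable borel" "Y \<in> borel_measurable borel"
  shows "distr unif (borel \<Otimes>\<^sub>M borel) (\<lambda>z. (X z, Y z)) \<in> couplings (distr unif borel X) (distr unif borel Y)"
  by (simp add: couplings_def distr_distr comp_def)

lemma couplingD:
  assumes "\<gamma> \<in> couplings \<mu> \<nu>" "real_distribution \<mu>"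
  shows "prob_space \<gamma>" "fst \<in> borel_measurable \<gamma>" "snd \<in> borel_measurable \<gamma>"
    "distr \<gamma> borel fst = \<mu>" "distr \<gamma> borel snd = \<nu>"
proof -
  have s: "sets \<gamma> = sets (borel \<Otimes>\<^sub>M borel)" and d: "distr \<gamma> borel fst = \<mu>" "distr \<gamma> borel snd = \<nu>"
    using assms by (auto simp: couplings_def)
  show m: "fst \<in> borel_measurable \<gamma>" "snd \<in> borel_measurable \<gamma>"
    by (simp_all add: measurable_cong_sets[OF s refl])
  interpret real_distribution \<mu> by fact
  have "prob_space (distr \<gamma> borel fst)" unfolding d by (rule prob_space_axioms)
  then show "prob_space \<gamma>" by (rule prob_space_distrD[OF m(1)])
  show "distr \<gamma> borel fst = \<mu>" "distr \<gamma> borel snd = \<nu>" by (fact d)+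
qed

text \<open>The pair of quantile functions is an admissible coupling, and the optimality results
  make it minimal. The infima are identified in the extended reals, before \<open>enn2real\<close>
  is applied, so infinite values match as well.\<close>

lemma wasserstein_eq_Lp_norm:
  assumes p: "1 \<le> p" and \<mu>: "real_distribution \<mu>" and \<nu>: "real_distribution \<nu>"
  shows "wasserstein p \<mu> \<nu> = Lp_norm p (\<lambda>z. quantile \<mu> z - quantile \<nu> z)"
proof -
  note [measurable] = borel_measurable_quantile[OF \<mu>] borel_measurable_quantile[OF \<nu>]
  let ?\<gamma> = "distr unif (borel \<Otimes>\<^sub>M borel) (\<lambda>z. (quantile \<mu> z, quantile \<nu> z))"
  have \<gamma>: "?\<gamma> \<in> couplings \<mu> \<nu>"
    using distr_pair_coupling[of "quantile \<mu>" "quantile \<nu>"] by (simp add: distr_quantile \<mu> \<nu>)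
  show ?thesis
  proof (cases "p = \<infinity>")
    case True
    have "(INF \<gamma>\<in>couplings \<mu> \<nu>. esssup \<gamma> (\<lambda>(x, y). ennreal \<bar>x - y\<bar>))
      = esssup unif (\<lambda>z. ennreal \<bar>quantile \<mu> z - quantile \<nu> z\<bar>)"
    proof (rule antisym)
      have "esssup ?\<gamma> (\<lambda>(x, y). ennreal \<bar>x - y\<bar>) \<le> esssup unif (\<lambda>z. ennreal \<bar>quantile \<mu> z - quantile \<nu> z\<bar>)"
        by (rule esssup_I) (auto simp: AE_distr_iff esssup_AE)
      then show "(INF \<gamma>\<in>couplings \<mu> \<nu>. esssup \<gamma> (\<lambda>(x, y). ennreal \<bar>x - y\<bar>))
        \<le> esssup unif (\<lambda>z. ennreal \<bar>quantile \<mu> z - quantile \<nu> z\<bar>)"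
        using \<gamma> by (rule INF_lower2[rotated])
    next
      show "esssup unif (\<lambda>z. ennreal \<bar>quantile \<mu> z - quantile \<nu> z\<bar>)
        \<le> (INF \<gamma>\<in>couplings \<mu> \<nu>. esssup \<gamma> (\<lambda>(x, y). ennreal \<bar>x - y\<bar>))"
      proof (rule INF_greatest)
        fix \<gamma> assume "\<gamma> \<in> couplings \<mu> \<nu>"
        note c = couplingD[OF this \<mu>]
        show "esssup unif (\<lambda>z. ennreal \<bar>quantile \<mu> z - quantile \<nu> z\<bar>) \<le> esssup \<gamma> (\<lambda>(x, y). ennreal \<bar>x - y\<bar>)"
        proof (cases "esssup \<gamma> (\<lambda>(x, y). ennreal \<bar>x - y\<bar>)")
          case (real M)
          have "AE w in \<gamma>. (\<lambda>(x, y). ennreal \<bar>x - y\<bar>) w \<le> esssup \<gamma> (\<lambda>(x, y). ennreal \<bar>x - y\<bar>)"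
            by (rule esssup_AE)
          then have "AE w in \<gamma>. \<bar>fst w - snd w\<bar> \<le> M"
            unfolding real by eventually_elim (use real in \<open>auto simp: split_beta\<close>)
          from quantile_coupling_sup[OF c(1-3) this]
          show ?thesis
            unfolding real c(4,5) by (intro esssup_I AE_unifI ennreal_leI) auto
        qed simp
      qed
    qed
    then show ?thesis using True by (simp add: wasserstein_def Lp_norm_def)
  next
    case False
    define q where "q = enn2real p"
    have q: "q \<ge> 1" unfolding q_def by (rule enn2real_ge_1[OF p False])
    have "(INF \<gamma>\<in>couplings \<mu> \<nu>. \<integral>\<^sup>+(x, y). ennreal (\<bar>x - y\<bar> powr q) \<partial>\<gamma>)
      = (\<integral>\<^sup>+z. ennreal (\<bar>quantile \<mu> z - quantile \<nu> z\<bar> powr q) \<partial>unif)"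
    proof (rule antisym)
      have "(\<integral>\<^sup>+(x, y). ennreal (\<bar>x - y\<bar> powr q) \<partial>?\<gamma>) = (\<integral>\<^sup>+z. ennreal (\<bar>quantile \<mu> z - quantile \<nu> z\<bar> powr q) \<partial>unif)"
        by (subst nn_integral_distr) auto
      then show "(INF \<gamma>\<in>couplings \<mu> \<nu>. \<integral>\<^sup>+(x, y). ennreal (\<bar>x - y\<bar> powr q) \<partial>\<gamma>)
        \<le> (\<integral>\<^sup>+z. ennreal (\<bar>quantile \<mu> z - quantile \<nu> z\<bar> powr q) \<partial>unif)"
        using INF_lower[OF \<gamma>, of "\<lambda>\<gamma>. \<integral>\<^sup>+(x, y). ennreal (\<bar>x - y\<bar> powr q) \<partial>\<gamma>"] by simp
    next
      show "(\<integral>\<^sup>+z. ennreal (\<bar>quantile \<mu> z - quantile \<nu> z\<bar> powr q) \<partial>unif)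
        \<le> (INF \<gamma>\<in>couplings \<mu> \<nu>. \<integral>\<^sup>+(x, y). ennreal (\<bar>x - y\<bar> powr q) \<partial>\<gamma>)"
      proof (rule INF_greatest)
        fix \<gamma> assume "\<gamma> \<in> couplings \<mu> \<nu>"
        note c = couplingD[OF this \<mu>]
        show "(\<integral>\<^sup>+z. ennreal (\<bar>quantile \<mu> z - quantile \<nu> z\<bar> powr q) \<partial>unif) \<le> (\<integral>\<^sup>+(x, y). ennreal (\<bar>x - y\<bar> powr q) \<partial>\<gamma>)"
          using quantile_coupling_optimal[OF q c(1-3)] unfolding c(4,5) case_prod_beta .
      qed
    qed
    then show ?thesis using False by (simp add: wasserstein_def Lp_norm_def q_def)
  qed
qed

text \<open>Any two functions of a common label form a coupling. Existence applies this to the flow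
  map at two times, which is not identified with a quantile function.\<close>

lemma wasserstein_distr_le:
  assumes p: "1 \<le> p" and [measurable]: "X \<in> borel_measurable borel" "Y \<in> borel_measurable borel"
    and XY: "in_Lp p (\<lambda>z. X z - Y z)"
  shows "wasserstein p (distr unif borel X) (distr unif borel Y) \<le> Lp_norm p (\<lambda>z. X z - Y z)"
proof -
  let ?\<gamma> = "distr unif (borel \<Otimes>\<^sub>M borel) (\<lambda>z. (X z, Y z))"
  have \<gamma>: "?\<gamma> \<in> couplings (distr unif borel X) (distr unif borel Y)"
    by (rule distr_pair_coupling) auto
  show ?thesis
  proof (cases "p = \<infinity>")
    case True
    have "AE z in unif. \<bar>X z - Y z\<bar> \<le> Lp_norm \<infinity> (\<lambda>z. X z - Y z)"
      using XY True Linf_norm_AE[of "\<lambda>z. X z - Y z"] by simp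
    then have "esssup ?\<gamma> (\<lambda>(x, y). ennreal \<bar>x - y\<bar>) \<le> ennreal (Lp_norm \<infinity> (\<lambda>z. X z - Y z))"
      by (intro esssup_I) (auto simp: AE_distr_iff ennreal_leI)
    then have "(INF \<gamma>\<in>couplings (distr unif borel X) (distr unif borel Y). esssup \<gamma> (\<lambda>(x, y). ennreal \<bar>x - y\<bar>))
      \<le> ennreal (Lp_norm \<infinity> (\<lambda>z. X z - Y z))"
      by (rule INF_lower2[OF \<gamma>])
    then show ?thesis using True by (auto simp: wasserstein_def Lp_norm_nonneg intro!: enn2real_leI)
  next
    case False
    define q where "q = enn2real p"
    have q: "q \<ge> 1" unfolding q_def by (rule enn2real_ge_1[OF p False])
    have int: "integrable unif (\<lambda>z. \<bar>X z - Y z\<bar> powr q)" using XY False by (simp add: in_Lp_def q_def)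
    have "(\<integral>\<^sup>+(x, y). ennreal (\<bar>x - y\<bar> powr q) \<partial>?\<gamma>) = (\<integral>\<^sup>+z. ennreal (\<bar>X z - Y z\<bar> powr q) \<partial>unif)"
      by (subst nn_integral_distr) auto
    also have "\<dots> = ennreal (\<integral>z. \<bar>X z - Y z\<bar> powr q \<partial>unif)"
      using int by (simp add: nn_integral_eq_integral)
    finally have "(INF \<gamma>\<in>couplings (distr unif borel X) (distr unif borel Y). \<integral>\<^sup>+(x, y). ennreal (\<bar>x - y\<bar> powr q) \<partial>\<gamma>)
      \<le> ennreal (\<integral>z. \<bar>X z - Y z\<bar> powr q \<partial>unif)"
      using INF_lower[OF \<gamma>, of "\<lambda>\<gamma>. \<integral>\<^sup>+(x, y). ennreal (\<bar>x - y\<bar> powr q) \<partial>\<gamma>"] by simp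
    then have "enn2real (INF \<gamma>\<in>couplings (distr unif borel X) (distr unif borel Y). \<integral>\<^sup>+(x, y). ennreal (\<bar>x - y\<bar> powr q) \<partial>\<gamma>)
      \<le> (\<integral>z. \<bar>X z - Y z\<bar> powr q \<partial>unif)"
      by (intro enn2real_leI) auto
    then show ?thesis
      using False q by (auto simp: wasserstein_def Lp_norm_finite[OF XY False] q_def intro!: powr_mono2)
  qed
qed

section \<open>Bounded densities\<close>

text \<open>The measure with distribution function \<open>C x - F x\<close> complements \<open>\<rho>\<close> to \<open>C\<close> times the Lebesgue
  measure.\<close>

lemma lipschitz_cdf_density:
  assumes \<rho>: "real_distribution \<rho>" and C: "C \<ge> 0"
    and lip: "\<And>a b. a \<le> b \<Longrightarrow> cdf \<rho> b - cdf \<rho> a \<le> C * (b - a)"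
  shows "Linf_norm \<rho> \<le> ennreal C"
proof -
  interpret real_distribution \<rho> by fact
  define G where "G x = C * x - cdf \<rho> x" for x
  have G_mono: "G x \<le> G y" if "x \<le> y" for x y
    using lip[OF that] by (simp add: G_def algebra_simps)
  have G_cont: "continuous (at_right a) G" for a
    unfolding G_def[abs_def] by (intro continuous_intros cdf_is_right_cont)
  let ?G = "interval_measure G"
  let ?S = "measure_of UNIV (sets borel) (\<lambda>A. emeasure \<rho> A + emeasure ?G A)"
  have S: "emeasure ?S A = emeasure \<rho> A + emeasure ?G A" if "A \<in> sets borel" for A
  proof (rule emeasure_measure_of_sigma)
    show "sigma_algebra UNIV (sets (borel::real measure))"
      using sets.sigma_algebra_axioms[of "borel::real measure"] by simp
    show "countably_additive (sets borel) (\<lambda>A. emeasure \<rho> A + emeasure ?G A)"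
    proof (rule countably_additiveI)
      fix A :: "nat \<Rightarrow> real set" assume A: "range A \<subseteq> sets borel" "disjoint_family A"
      then show "(\<Sum>i. emeasure \<rho> (A i) + emeasure ?G (A i)) = emeasure \<rho> (\<Union>(range A)) + emeasure ?G (\<Union>(range A))"
        by (subst suminf_add[symmetric]) (auto simp: suminf_emeasure)
    qed
  qed (use that in \<open>auto simp: positive_def\<close>)
  have Ioc: "emeasure ?S {a<..b} = emeasure (density lborel (\<lambda>_. ennreal C)) {a<..b}" for a b
  proof (cases "a \<le> b")
    case True
    have "emeasure ?S {a<..b} = ennreal (cdf \<rho> b - cdf \<rho> a) + ennreal (G b - G a)"
      using True by (simp add: S emeasure_Ioc emeasure_interval_measure_Ioc G_mono G_cont)
    also have "\<dots> = ennreal (C * (b - a))"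
      using True G_mono[OF True] cdf_nondecreasing[OF True]
      by (subst ennreal_plus[symmetric]) (auto simp: G_def algebra_simps)
    finally show ?thesis using True C by (simp add: emeasure_density ennreal_mult nn_integral_cmult_indicator)
  qed (use S in simp)
  have borel: "sigma_sets UNIV (range (\<lambda>(a, b). {a<..b::real})) = sets borel"
    by (subst borel_sigma_sets_Ioc) simp
  have eq: "?S = density lborel (\<lambda>_. ennreal C)"
  proof (rule measure_eqI_generator_eq[where \<Omega>=UNIV])
    fix X assume "X \<in> range (\<lambda>(a, b). {a<..b::real})"
    then show "emeasure ?S X = emeasure (density lborel (\<lambda>_. ennreal C)) X" using Ioc by auto
  next
    show "(\<Union>i. {- real (i::nat)<..real i}) = UNIV" by (rule UN_Ioc_eq_UNIV)
  next
    fix i :: nat show "emeasure ?S {- real i<..real i} \<noteq> \<infinity>"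
      by (subst Ioc) (simp add: emeasure_density ennreal_mult_eq_top_iff nn_integral_cmult_indicator)
  next
    show "sets ?S = sigma_sets UNIV (range (\<lambda>(a, b). {a<..b::real}))"
      and "sets (density lborel (\<lambda>_. ennreal C)) = sigma_sets UNIV (range (\<lambda>(a, b). {a<..b::real}))"
      unfolding borel by (simp_all add: sets.sigma_sets_eq[of "borel::real measure", simplified])
  qed (auto simp: Int_stable_def)
  have sum: "emeasure \<rho> A + emeasure ?G A = ennreal C * emeasure lborel A" if "A \<in> sets borel" for A
    using S[OF that] that unfolding eq by (simp add: emeasure_density nn_integral_cmult_indicator)
  have ac\<rho>: "absolutely_continuous lborel \<rho>" and acG: "absolutely_continuous lborel ?G"
  proof -
    have "emeasure \<rho> A = 0 \<and> emeasure ?G A = 0" if "A \<in> sets borel" "emeasure lborel A = 0" for A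
      using sum[OF that(1)] that(2) by (simp add: add_eq_0_iff_both_eq_0)
    then show "absolutely_continuous lborel \<rho>" "absolutely_continuous lborel ?G"
      unfolding absolutely_continuous_def null_sets_def by auto
  qed
  define r g where "r = RN_deriv lborel \<rho>" and "g = RN_deriv lborel ?G"
  have [measurable]: "r \<in> borel_measurable borel" "g \<in> borel_measurable borel"
    using borel_measurable_RN_deriv[of lborel] by (auto simp: r_def g_def)
  have dr: "density lborel r = \<rho>" and dg: "density lborel g = ?G"
    unfolding r_def g_def by (auto intro!: sigma_finite_measure.density_RN_deriv[OF sigma_finite_lborel] ac\<rho> acG)
  \<comment> \<open>Equality of these two measures forces \<open>r + g = C\<close> almost
    everywhere, and \<open>g \<ge> 0\<close> then bounds \<open>r\<close>.\<close>
  have "density lborel (\<lambda>x. r x + g x) = density lborel (\<lambda>_. ennreal C)"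
  proof (rule measure_eqI)
    fix A assume "A \<in> sets (density lborel (\<lambda>x. r x + g x))"
    then have A[measurable]: "A \<in> sets borel" by simp
    have "emeasure (density lborel (\<lambda>x. r x + g x)) A = emeasure (density lborel r) A + emeasure (density lborel g) A"
      by (simp add: emeasure_density distrib_right nn_integral_add)
    also have "\<dots> = emeasure (density lborel (\<lambda>_. ennreal C)) A"
      using sum[OF A] by (simp add: dr dg emeasure_density nn_integral_cmult_indicator)
    finally show "emeasure (density lborel (\<lambda>x. r x + g x)) A = emeasure (density lborel (\<lambda>_. ennreal C)) A" .
  qed simp
  then have "AE x in lborel. r x + g x = ennreal C"
    by (intro sigma_finite_measure.density_unique[OF sigma_finite_lborel]) auto
  then have "AE x in lborel. r x \<le> ennreal C"
    by eventually_elim (metis le_add1 order_refl le_iff_add)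
  then show ?thesis
    using ac\<rho> unfolding Linf_norm_def r_def[symmetric] by (auto intro!: esssup_I)
qed

text \<open>Labels mapped into \<open>(x, y]\<close> are at most \<open>C * (y - x)\<close> apart,
  so they fit into an interval of that length: the distribution function is Lipschitz with constant
  \<open>C\<close>.\<close>

lemma expanding_distr_density:
  assumes [measurable]: "X \<in> borel_measurable borel" and C: "0 \<le> C"
    and X: "\<And>z1 z2. 0 < z1 \<Longrightarrow> z1 < z2 \<Longrightarrow> z2 < 1 \<Longrightarrow> z2 - z1 \<le> C * (X z2 - X z1)"
  shows "Linf_norm (distr unif borel X) \<le> ennreal C"
proof (rule lipschitz_cdf_density[OF real_distribution_distr_unif[OF assms(1)] C])
  fix x y :: real assume xy: "x \<le> y"
  let ?A = "{z. x < X z \<and> X z \<le> y}"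
  have Cxy: "0 \<le> C * (y - x)" using C xy by simp
  have diff: "measure unif {z. X z \<le> y} - measure unif {z. X z \<le> x} = measure unif ?A"
  proof -
    have "{z. X z \<le> y} = {z. X z \<le> x} \<union> ?A" using xy by auto
    then show ?thesis by (subst \<open>{z. X z \<le> y} = _\<close>, subst unif.finite_measure_Union) auto
  qed
  have near: "z2 - z1 \<le> C * (y - x)" if "z1 \<in> ?A \<inter> {0<..<1}" "z2 \<in> ?A \<inter> {0<..<1}" for z1 z2
  proof (cases "z1 < z2")
    case True
    have "C * (X z2 - X z1) \<le> C * (y - x)" using that C by (intro mult_left_mono) auto
    then show ?thesis using X[of z1 z2] that True by auto
  qed (use Cxy in simp)
  have "measure unif ?A \<le> C * (y - x)"
  proof (cases "?A \<inter> {0<..<1} = {}")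
    case True
    then show ?thesis using measure_unif_le[of ?A 0 0] Cxy by simp
  next
    case False
    define i where "i = Inf (?A \<inter> {0<..<1})"
    have bdd: "bdd_below (?A \<inter> {0<..<1})" by (intro bdd_belowI[of _ 0]) auto
    have "z \<in> {i..i + C * (y - x)}" if z: "z \<in> ?A \<inter> {0<..<1}" for z
    proof -
      have "i \<le> z" unfolding i_def using z bdd by (rule cInf_lower)
      moreover have "z - C * (y - x) \<le> i"
        unfolding i_def using False near[OF _ z] by (intro cInf_greatest) (auto simp: algebra_simps)
      ultimately show ?thesis by auto
    qed
    then have "measure unif ?A \<le> (i + C * (y - x)) - i"
      using Cxy by (intro measure_unif_le subsetI) auto
    then show ?thesis by simp
  qed
  then show "cdf (distr unif borel X) y - cdf (distr unif borel X) x \<le> C * (y - x)"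
    unfolding cdf_distr_unif[OF assms(1)] diff .
qed

section \<open>Comparison principles\<close>

text \<open>The solution of \<open>g' = 1 - K * g\<close> with \<open>g 0 = 0\<close>; its
  reciprocal is the time profile of the smoothing bound.\<close>

definition growth :: "real \<Rightarrow> real \<Rightarrow> real" where
  "growth K t = (if K = 0 then t else (1 - exp (- K * t)) / K)"

lemma growth_0 [simp]: "growth K 0 = 0"
  by (simp add: growth_def)

lemma growth_deriv: "(growth K has_real_derivative (1 - K * growth K t)) (at t)"
proof (cases "K = 0")
  case True
  then show ?thesis unfolding growth_def[abs_def] by (auto intro!: derivative_eq_intros)
next
  case False
  then show ?thesis unfolding growth_def[abs_def]
    by (auto intro!: derivative_eq_intros simp: field_simps)
qed

lemma continuous_on_growth: "continuous_on S (growth K)"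
  by (meson DERIV_isCont growth_deriv continuous_at_imp_continuous_on)

lemma growth_pos: "0 \<le> K \<Longrightarrow> 0 < t \<Longrightarrow> 0 < growth K t"
  by (auto simp: growth_def)

lemma growth_mono: "0 \<le> K \<Longrightarrow> s \<le> t \<Longrightarrow> growth K s \<le> growth K t"
  by (auto simp: growth_def divide_right_mono mult_left_mono)

lemma growth_nonneg: "0 \<le> K \<Longrightarrow> 0 \<le> t \<Longrightarrow> 0 \<le> growth K t"
  using growth_mono[of K 0 t] by simp

text \<open>\<open>c * growth K\<close> solves the equality version of the inequality for
  nonnegative \<open>d\<close>. The hypothesis carries \<open>\<bar>d \<tau>\<bar>\<close> because
  the Lipschitz estimates producing it do not know the sign of \<open>d\<close>.\<close>

lemma expansion_lower_bound:
  fixes d :: "real \<Rightarrow> real"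
  assumes "s \<le> t" "0 \<le> c" "0 \<le> K" and cont: "continuous_on {s..t} d" and "0 \<le> d s"
    and deriv: "\<And>\<tau>. s < \<tau> \<Longrightarrow> \<tau> < t \<Longrightarrow> \<exists>D. (d has_real_derivative D) (at \<tau>) \<and> c - K * \<bar>d \<tau>\<bar> \<le> D"
  shows "c * growth K (t - s) \<le> d t"
proof -
  let ?e = "\<lambda>\<tau>. c * growth K (\<tau> - s) - d \<tau>"
  have "?e t \<le> 0"
  proof (rule nonpos_barrier[where L = K and e = ?e])
    show "continuous_on {s..t} ?e"
      by (intro continuous_intros cont continuous_on_compose2[OF continuous_on_growth[of UNIV]]) auto
    fix \<tau> assume \<tau>: "s < \<tau>" "\<tau> < t" "0 < ?e \<tau>"
    let ?g = "growth K (\<tau> - s)"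
    obtain D where D: "(d has_real_derivative D) (at \<tau>)" "c - K * \<bar>d \<tau>\<bar> \<le> D"
      using deriv \<tau> by blast
    have "((\<lambda>\<tau>. growth K (\<tau> - s)) has_real_derivative (1 - K * ?g) * (1 - 0)) (at \<tau>)"
      by (rule DERIV_chain2[OF growth_deriv]) (intro derivative_intros)
    then have "(?e has_real_derivative (c * (1 - K * ?g) - D)) (at \<tau>)"
      using D by (auto intro!: derivative_eq_intros)
    moreover have "c * (1 - K * ?g) - D \<le> K * ?e \<tau>"
    proof -
      have g: "0 \<le> K * (c * ?g)" using growth_nonneg[of K "\<tau> - s"] assms \<tau> by auto
      have "0 \<le> K * ?e \<tau>" using \<tau> assms by auto
      \<comment> \<open>For \<open>d \<ge> 0\<close> the left side is at most
        \<open>- K * ?e\<close>, which is nonpositive. For \<open>d < 0\<close> the estimate holds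
        with the term \<open>2 * K * c * ?g\<close> to spare.\<close>
      with D(2) g show ?thesis
        by (cases "0 \<le> d \<tau>") (simp_all add: algebra_simps)
    qed
    ultimately show "\<exists>D. (?e has_real_derivative D) (at \<tau>) \<and> D \<le> K * ?e \<tau>" by blast
  qed (use assms in auto)
  then show ?thesis by simp
qed

lemma abs_comparison:
  fixes y u :: "real \<Rightarrow> real"
  assumes "s \<le> t" and cont: "continuous_on {s..t} y" and init: "\<bar>y s\<bar> \<le> u s"
    and y: "\<And>\<tau>. s < \<tau> \<Longrightarrow> \<tau> < t \<Longrightarrow> \<exists>D. (y has_real_derivative D) (at \<tau>) \<and> \<bar>D\<bar> \<le> L * \<bar>y \<tau>\<bar> + h \<tau>"
    and u: "\<And>\<tau>. (u has_real_derivative (L * u \<tau> + h \<tau>)) (at \<tau>)"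
    and pos: "\<And>\<tau>. s < \<tau> \<Longrightarrow> \<tau> < t \<Longrightarrow> 0 \<le> u \<tau>"
  shows "\<bar>y t\<bar> \<le> u t"
proof -
  have half: "f t - u t \<le> 0"
    if c: "continuous_on {s..t} f" and i: "f s \<le> u s"
      and f: "\<And>\<tau>. s < \<tau> \<Longrightarrow> \<tau> < t \<Longrightarrow> \<exists>D. (f has_real_derivative D) (at \<tau>) \<and> \<bar>D\<bar> \<le> L * \<bar>f \<tau>\<bar> + h \<tau>"
    for f
  proof (rule nonpos_barrier[where L = L and e = "\<lambda>\<tau>. f \<tau> - u \<tau>"])
    show "continuous_on {s..t} (\<lambda>\<tau>. f \<tau> - u \<tau>)"
      using u by (intro continuous_intros c) (meson DERIV_isCont continuous_at_imp_continuous_on)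
    fix \<tau> assume \<tau>: "s < \<tau>" "\<tau> < t" "0 < f \<tau> - u \<tau>"
    obtain D where D: "(f has_real_derivative D) (at \<tau>)" "\<bar>D\<bar> \<le> L * \<bar>f \<tau>\<bar> + h \<tau>"
      using f \<tau> by blast
    have "((\<lambda>\<tau>. f \<tau> - u \<tau>) has_real_derivative (D - (L * u \<tau> + h \<tau>))) (at \<tau>)"
      by (intro derivative_intros D u)
    moreover have "D - (L * u \<tau> + h \<tau>) \<le> L * (f \<tau> - u \<tau>)"
      using D(2) pos[OF \<tau>(1,2)] \<tau>(3) by (simp add: algebra_simps)
    ultimately show "\<exists>D. ((\<lambda>\<tau>. f \<tau> - u \<tau>) has_real_derivative D) (at \<tau>) \<and> D \<le> L * (f \<tau> - u \<tau>)"
      by blast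
  qed (use assms i in auto)
  have "y t - u t \<le> 0" by (rule half) (use cont init y in auto)
  moreover have "- y t - u t \<le> 0"
  proof (rule half[of "\<lambda>\<tau>. - y \<tau>"])
    fix \<tau> assume "s < \<tau>" "\<tau> < t"
    then obtain D where D: "(y has_real_derivative D) (at \<tau>)" "\<bar>D\<bar> \<le> L * \<bar>y \<tau>\<bar> + h \<tau>"
      using y by blast
    show "\<exists>D. ((\<lambda>\<tau>. - y \<tau>) has_real_derivative D) (at \<tau>) \<and> \<bar>D\<bar> \<le> L * \<bar>- y \<tau>\<bar> + h \<tau>"
      using D by (intro exI[of _ "- D"]) (auto intro!: derivative_intros)
  qed (use cont init in \<open>auto intro!: continuous_intros\<close>)
  ultimately show ?thesis by auto
qed

text \<open>The mean \<open>m\<close> is only continuous, so it is not differentiated. An a priori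
  bound \<open>A * exp (2 * L * (\<tau> - s))\<close> on it gives a pointwise bound on
  \<open>D\<close>; integrating that bound over the labels shows that the best \<open>A\<close> is
  at most \<open>m s\<close>.\<close>

lemma mean_field_gronwall:
  fixes D :: "real \<Rightarrow> real \<Rightarrow> real"
  defines "m \<equiv> \<lambda>\<tau>. \<integral>z. \<bar>D z \<tau>\<bar> \<partial>unif"
  assumes "s \<le> T" "0 \<le> L"
    and int: "\<And>\<tau>. s \<le> \<tau> \<Longrightarrow> \<tau> \<le> T \<Longrightarrow> integrable unif (\<lambda>z. D z \<tau>)"
    and m: "continuous_on {s..T} m"
    and cont: "\<And>z. 0 < z \<Longrightarrow> z < 1 \<Longrightarrow> continuous_on {s..T} (D z)"
    and deriv: "\<And>z \<tau>. 0 < z \<Longrightarrow> z < 1 \<Longrightarrow> s < \<tau> \<Longrightarrow> \<tau> < T \<Longrightarrow>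
      \<exists>d. (D z has_real_derivative d) (at \<tau>) \<and> \<bar>d\<bar> \<le> L * (\<bar>D z \<tau>\<bar> + m \<tau>)"
    and z: "0 < z" "z < 1"
  shows "\<bar>D z T\<bar> \<le> exp (L * (T - s)) * \<bar>D z s\<bar> + (exp (2 * L * (T - s)) - exp (L * (T - s))) * m s"
proof -
  have m0: "0 \<le> m \<tau>" for \<tau> unfolding m_def by simp
  have pointwise: "\<bar>D z t\<bar> \<le> exp (L * (t - s)) * \<bar>D z s\<bar> + A * (exp (2 * L * (t - s)) - exp (L * (t - s)))"
    if t: "s \<le> t" "t \<le> T" and A: "0 \<le> A" "\<And>\<tau>. s \<le> \<tau> \<Longrightarrow> \<tau> \<le> t \<Longrightarrow> m \<tau> \<le> A * exp (2 * L * (\<tau> - s))"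
      and z: "0 < z" "z < 1" for t A z
  proof (rule abs_comparison[where y = "D z" and L = L and h = "\<lambda>\<tau>. L * (A * exp (2 * L * (\<tau> - s)))"
      and u = "\<lambda>t. exp (L * (t - s)) * \<bar>D z s\<bar> + A * (exp (2 * L * (t - s)) - exp (L * (t - s)))"])
    fix \<tau> assume \<tau>: "s < \<tau>" "\<tau> < t"
    then obtain d where d: "(D z has_real_derivative d) (at \<tau>)" "\<bar>d\<bar> \<le> L * (\<bar>D z \<tau>\<bar> + m \<tau>)"
      using deriv[OF z, of \<tau>] t by auto
    have "L * m \<tau> \<le> L * (A * exp (2 * L * (\<tau> - s)))"
      using A \<tau> \<open>0 \<le> L\<close> by (intro mult_left_mono) auto
    with d show "\<exists>d. (D z has_real_derivative d) (at \<tau>) \<and> \<bar>d\<bar> \<le> L * \<bar>D z \<tau>\<bar> + L * (A * exp (2 * L * (\<tau> - s)))"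
      by (intro exI[of _ d]) (auto simp: algebra_simps)
    have "exp (L * (\<tau> - s)) \<le> exp (2 * L * (\<tau> - s))"
      using \<open>0 \<le> L\<close> \<tau> by (auto intro!: mult_right_mono)
    then show "0 \<le> exp (L * (\<tau> - s)) * \<bar>D z s\<bar> + A * (exp (2 * L * (\<tau> - s)) - exp (L * (\<tau> - s)))"
      using A by auto
  next
    fix \<tau>
    show "((\<lambda>t. exp (L * (t - s)) * \<bar>D z s\<bar> + A * (exp (2 * L * (t - s)) - exp (L * (t - s)))) has_real_derivative
        L * (exp (L * (\<tau> - s)) * \<bar>D z s\<bar> + A * (exp (2 * L * (\<tau> - s)) - exp (L * (\<tau> - s)))) +
        L * (A * exp (2 * L * (\<tau> - s)))) (at \<tau>)"
      by (auto intro!: derivative_eq_intros simp: algebra_simps)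
  qed (use t continuous_on_subset[OF cont[OF z]] in auto)
  have "continuous_on {s..T} (\<lambda>\<tau>. m \<tau> * exp (- 2 * L * (\<tau> - s)))"
    by (intro continuous_intros m)
  then obtain t where t: "t \<in> {s..T}"
    and tmax: "\<And>\<tau>. \<tau> \<in> {s..T} \<Longrightarrow> m \<tau> * exp (- 2 * L * (\<tau> - s)) \<le> m t * exp (- 2 * L * (t - s))"
    using continuous_attains_sup[of "{s..T}" "\<lambda>\<tau>. m \<tau> * exp (- 2 * L * (\<tau> - s))"] \<open>s \<le> T\<close> by auto
  \<comment> \<open>The least admissible \<open>A\<close>, attained at time \<open>t\<close>; the
    pointwise bound will be integrated at exactly this time.\<close>
  define A where "A = m t * exp (- 2 * L * (t - s))"
  have A0: "0 \<le> A" using m0 by (simp add: A_def)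
  have A: "m \<tau> \<le> A * exp (2 * L * (\<tau> - s))" if "\<tau> \<in> {s..T}" for \<tau>
  proof -
    have "m \<tau> = m \<tau> * exp (- 2 * L * (\<tau> - s)) * exp (2 * L * (\<tau> - s))"
      by (simp add: exp_minus mult.assoc flip: exp_add)
    also have "\<dots> \<le> A * exp (2 * L * (\<tau> - s))"
      using tmax[OF that] by (intro mult_right_mono) (auto simp: A_def)
    finally show ?thesis .
  qed
  let ?e = "exp (L * (t - s))" and ?f = "exp (2 * L * (t - s))"
  have "m t \<le> (\<integral>z. ?e * \<bar>D z s\<bar> + A * (?f - ?e) \<partial>unif)"
    unfolding m_def using t A0 A int[of t] int[of s]
    by (intro integral_mono_AE AE_unifI pointwise) auto
  also have "\<dots> = ?e * m s + A * (?f - ?e)"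
    using int[of s] t by (simp add: m_def)
  also have "m t = A * ?f"
    by (simp add: A_def mult.assoc flip: exp_add)
  \<comment> \<open>The contributions \<open>A * ?f\<close> on the two sides cancel.\<close>
  finally have "A * ?e \<le> m s * ?e" by (simp add: algebra_simps)
  then have "A \<le> m s" by simp
  have "\<bar>D z T\<bar> \<le> exp (L * (T - s)) * \<bar>D z s\<bar> + m s * (exp (2 * L * (T - s)) - exp (L * (T - s)))"
  proof (rule pointwise)
    fix \<tau> assume "s \<le> \<tau>" "\<tau> \<le> T"
    then show "m \<tau> \<le> m s * exp (2 * L * (\<tau> - s))"
      using A[of \<tau>] \<open>A \<le> m s\<close> by (intro order_trans[OF _ mult_right_mono[of A "m s"]]) auto
  qed (use z m0 \<open>s \<le> T\<close> in auto)
  then show ?thesis by (simp add: algebra_simps)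
qed

section \<open>The nonlocal velocity\<close>

locale nonlocal_kernel =
  fixes V v :: "real \<Rightarrow> real" and lam b :: real
  assumes supp_V: "closure {x. V x \<noteq> 0} \<subseteq> {..0}"
    and V_left_lim: "(V \<longlongrightarrow> lam) (at_left 0)"
    and lam_pos: "lam > 0"
    and V_lip: "\<exists>L. L-lipschitz_on {..0} V"
    and v_lip: "\<exists>L. L-lipschitz_on UNIV v"
    and b_pos: "b > 0"
    and v_decr: "\<And>r1 r2. 0 \<le> r1 \<Longrightarrow> r1 \<le> r2 \<Longrightarrow> v r2 - v r1 \<le> - b * (r2 - r1)"
    and v_decr_neg: "\<And>x r1 r2. V x < 0 \<Longrightarrow> V x \<le> r1 \<Longrightarrow> r1 \<le> r2 \<Longrightarrow> v r2 - v r1 \<le> - b * (r2 - r1)"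
begin

abbreviation "U \<equiv> extended_kernel V lam"
abbreviation "LV \<equiv> lip_seminorm {..0} V"
abbreviation "LU \<equiv> lip_seminorm UNIV U"
abbreviation "Lv \<equiv> lip_seminorm UNIV v"

lemma V_pos: "x > 0 \<Longrightarrow> V x = 0"
  using supp_V closure_subset[of "{x. V x \<noteq> 0}"] by force

lemma V_0: "V 0 = lam"
proof -
  obtain L where "L-lipschitz_on {..0} V" using V_lip by auto
  then have "continuous_on {..0} V" by (rule lipschitz_on_continuous_on)
  then have "(V \<longlongrightarrow> V 0) (at 0 within {..0})" by (auto simp: continuous_on_def)
  then have "(V \<longlongrightarrow> V 0) (at_left 0)" by (rule tendsto_within_subset) auto
  then show ?thesis using V_left_lim by (intro tendsto_unique[of "at_left (0::real)"]) auto
qed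

lemma LV_nonneg: "0 \<le> LV"
  by (rule lip_seminorm_nonneg[OF V_lip, of 0 "-1"]) auto

lemma Lv_nonneg: "0 \<le> Lv"
  by (rule lip_seminorm_nonneg[OF v_lip, of 0 1]) auto

lemma v_diff: "\<bar>v x - v y\<bar> \<le> Lv * \<bar>x - y\<bar>"
  by (rule lip_seminorm_bound[OF v_lip]) auto

lemma U_diff: "\<bar>U x - U y\<bar> \<le> LV * \<bar>x - y\<bar>"
proof -
  \<comment> \<open>\<open>U\<close> is \<open>V\<close> composed with the projection onto the
    nonpositive half-line, which does not increase distances.\<close>
  have "U x = V (min x 0)" for x by (auto simp: extended_kernel_def V_0 min_def)
  then have "\<bar>U x - U y\<bar> \<le> LV * \<bar>min x 0 - min y 0\<bar>"
    by (simp add: lip_seminorm_bound[OF V_lip])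
  also have "\<dots> \<le> LV * \<bar>x - y\<bar>"
    by (intro mult_left_mono LV_nonneg) auto
  finally show ?thesis .
qed

lemma U_lip: "\<exists>L. L-lipschitz_on UNIV U"
  using U_diff LV_nonneg by (intro exI[of _ LV] lipschitz_onI) (auto simp: dist_real_def)

lemma LU_nonneg: "0 \<le> LU"
  by (rule lip_seminorm_nonneg[OF U_lip, of 0 1]) auto

lemma U_diff': "\<bar>U x - U y\<bar> \<le> LU * \<bar>x - y\<bar>"
  by (rule lip_seminorm_bound[OF U_lip]) auto

lemma U_0: "U 0 = lam"
  by (simp add: extended_kernel_def V_0)

lemma U_bound: "\<bar>U x\<bar> \<le> lam + LU * \<bar>x\<bar>"
  using U_diff'[of x 0] lam_pos by (simp add: U_0)

lemma V_eq_U: "V x = U x - lam * indicator {0<..} x"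
  by (auto simp: extended_kernel_def V_pos indicator_def)

lemma continuous_on_U: "continuous_on S U"
proof -
  obtain L where "L-lipschitz_on UNIV U" using U_lip by auto
  then show ?thesis by (metis lipschitz_on_continuous_on continuous_on_subset subset_UNIV)
qed

lemma continuous_on_v: "continuous_on S v"
proof -
  obtain L where "L-lipschitz_on UNIV v" using v_lip by auto
  then show ?thesis by (metis lipschitz_on_continuous_on continuous_on_subset subset_UNIV)
qed

lemma borel_measurable_U [measurable]: "U \<in> borel_measurable borel"
  by (intro borel_measurable_continuous_onI continuous_on_U)

lemma borel_measurable_V [measurable]: "V \<in> borel_measurable borel"
proof -
  have "(\<lambda>x. U x - lam * indicator {0<..} x) \<in> borel_measurable borel" by measurable
  then show ?thesis by (simp add: V_eq_U cong: measurable_cong)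
qed

lemma borel_measurable_v [measurable]: "v \<in> borel_measurable borel"
  by (intro borel_measurable_continuous_onI continuous_on_v)

definition ubar :: "(real \<Rightarrow> real) \<Rightarrow> real \<Rightarrow> real" where
  "ubar Y x = (\<integral>\<zeta>. U (x - Y \<zeta>) \<partial>unif)"

lemma integrable_U:
  assumes "integrable unif Y"
  shows "integrable unif (\<lambda>\<zeta>. U (x - Y \<zeta>))"
proof (rule Bochner_Integration.integrable_bound)
  have [measurable]: "Y \<in> borel_measurable borel" using borel_measurable_integrable[OF assms] by simp
  show "integrable unif (\<lambda>\<zeta>. lam + LU * (\<bar>x\<bar> + \<bar>Y \<zeta>\<bar>))" using assms by auto
  show "(\<lambda>\<zeta>. U (x - Y \<zeta>)) \<in> borel_measurable unif" by simp
  show "AE \<zeta> in unif. norm (U (x - Y \<zeta>)) \<le> norm (lam + LU * (\<bar>x\<bar> + \<bar>Y \<zeta>\<bar>))"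
  proof (rule AE_I2)
    fix \<zeta>
    have "\<bar>U (x - Y \<zeta>)\<bar> \<le> lam + LU * \<bar>x - Y \<zeta>\<bar>" by (rule U_bound)
    also have "\<dots> \<le> lam + LU * (\<bar>x\<bar> + \<bar>Y \<zeta>\<bar>)"
      by (intro add_left_mono mult_left_mono LU_nonneg) auto
    finally show "norm (U (x - Y \<zeta>)) \<le> norm (lam + LU * (\<bar>x\<bar> + \<bar>Y \<zeta>\<bar>))" by auto
  qed
qed

text \<open>The Lipschitz constant is a parameter because the stability estimate is expressed with
  \<open>LV\<close> and the smoothing estimate with \<open>LU\<close>.\<close>

lemma ubar_diff:
  assumes L: "\<And>x y. \<bar>U x - U y\<bar> \<le> L * \<bar>x - y\<bar>" and Y: "integrable unif Y" "integrable unif Y'"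
  shows "\<bar>ubar Y x - ubar Y' x'\<bar> \<le> L * (\<bar>x - x'\<bar> + (\<integral>\<zeta>. \<bar>Y \<zeta> - Y' \<zeta>\<bar> \<partial>unif))"
proof -
  have "0 \<le> L" using L[of 0 1] by auto
  have int: "integrable unif (\<lambda>\<zeta>. U (x - Y \<zeta>) - U (x' - Y' \<zeta>))"
    using Y by (intro Bochner_Integration.integrable_diff integrable_U)
  have "\<bar>ubar Y x - ubar Y' x'\<bar> = \<bar>\<integral>\<zeta>. U (x - Y \<zeta>) - U (x' - Y' \<zeta>) \<partial>unif\<bar>"
    unfolding ubar_def using Y by (subst Bochner_Integration.integral_diff) (auto intro: integrable_U)
  also have "\<dots> \<le> (\<integral>\<zeta>. \<bar>U (x - Y \<zeta>) - U (x' - Y' \<zeta>)\<bar> \<partial>unif)"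
    by (rule integral_abs_bound)
  also have "\<dots> \<le> (\<integral>\<zeta>. L * (\<bar>x - x'\<bar> + \<bar>Y \<zeta> - Y' \<zeta>\<bar>) \<partial>unif)"
  proof (rule integral_mono)
    show "\<bar>U (x - Y \<zeta>) - U (x' - Y' \<zeta>)\<bar> \<le> L * (\<bar>x - x'\<bar> + \<bar>Y \<zeta> - Y' \<zeta>\<bar>)" for \<zeta>
      using \<open>0 \<le> L\<close> by (intro order_trans[OF L] mult_left_mono) auto
  qed (use int Y in auto)
  also have "\<dots> = L * (\<bar>x - x'\<bar> + (\<integral>\<zeta>. \<bar>Y \<zeta> - Y' \<zeta>\<bar> \<partial>unif))" using Y by simp
  finally show ?thesis .
qed

text \<open>The splitting of \<open>V\<close> into \<open>U\<close> and a step, integrated over the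
  labels. As \<open>V 0 = lam\<close>, mass sitting exactly at \<open>x\<close> is not subtracted,
  whence the strict inequality.\<close>

lemma conv_measure_distr:
  assumes X: "integrable unif X"
  shows "conv_measure V (distr unif borel X) x = ubar X x - lam * measure unif {\<zeta>. X \<zeta> < x}"
    and integrable_V: "integrable (distr unif borel X) (\<lambda>y. V (x - y))"
proof -
  have [measurable]: "X \<in> borel_measurable borel" using borel_measurable_integrable[OF X] by simp
  have pt: "V (x - X \<zeta>) = U (x - X \<zeta>) - lam * indicator {\<zeta>. X \<zeta> < x} \<zeta>" for \<zeta>
    using V_eq_U[of "x - X \<zeta>"] by (auto simp: indicator_def)
  have int: "integrable unif (\<lambda>\<zeta>. lam * indicator {\<zeta>. X \<zeta> < x} \<zeta> :: real)"
    by (intro integrable_mult_right integrable_real_indicator)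
      (auto simp: unif.emeasure_eq_measure)
  have "conv_measure V (distr unif borel X) x = (\<integral>\<zeta>. V (x - X \<zeta>) \<partial>unif)"
    unfolding conv_measure_def by (subst integral_distr) auto
  also have "\<dots> = ubar X x - lam * measure unif {\<zeta>. X \<zeta> < x}"
  proof -
    have "(\<integral>\<zeta>. V (x - X \<zeta>) \<partial>unif) = (\<integral>\<zeta>. U (x - X \<zeta>) - lam * indicator {\<zeta>. X \<zeta> < x} \<zeta> \<partial>unif)"
      by (rule Bochner_Integration.integral_cong[OF refl pt])
    also have "\<dots> = ubar X x - (\<integral>\<zeta>. lam * indicator {\<zeta>. X \<zeta> < x} \<zeta> \<partial>unif)"
      unfolding ubar_def by (rule Bochner_Integration.integral_diff[OF integrable_U[OF X] int])
    also have "\<dots> = ubar X x - lam * measure unif {\<zeta>. X \<zeta> < x}"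
      by simp
    finally show ?thesis .
  qed
  finally show "conv_measure V (distr unif borel X) x = ubar X x - lam * measure unif {\<zeta>. X \<zeta> < x}" .
  have "integrable unif (\<lambda>\<zeta>. V (x - X \<zeta>))"
    using Bochner_Integration.integrable_diff[OF integrable_U[OF X, of x] int]
    by (rule Bochner_Integration.integrable_cong[OF refl pt, THEN iffD2])
  then show "integrable (distr unif borel X) (\<lambda>y. V (x - y))"
    by (subst integrable_distr_eq) auto
qed

text \<open>The arguments from which the hypotheses make \<open>v\<close> decrease at rate
  \<open>b\<close>. It is an up-closed set, equal to the nonnegative half-line when
  \<open>V \<ge> 0\<close>.\<close>

definition decr_range :: "real set" where
  "decr_range = {r. 0 \<le> r \<or> (\<exists>x. V x < 0 \<and> V x \<le> r)}"

lemma decr_range_up: "r \<in> decr_range \<Longrightarrow> r \<le> r' \<Longrightarrow> r' \<in> decr_range"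
  by (auto simp: decr_range_def intro: order_trans)

lemma v_decr_range: "r \<in> decr_range \<Longrightarrow> r \<le> r' \<Longrightarrow> v r' - v r \<le> - b * (r' - r)"
  using v_decr v_decr_neg by (auto simp: decr_range_def)

text \<open>An average cannot be smaller than every value averaged. So a negative convolution value
  lies above some \<open>V y\<close>, which is then negative too.\<close>

lemma conv_in_decr_range:
  assumes X: "integrable unif X"
  shows "conv_measure V (distr unif borel X) x \<in> decr_range"
proof (cases "0 \<le> conv_measure V (distr unif borel X) x")
  case False
  let ?c = "conv_measure V (distr unif borel X) x"
  have [measurable]: "X \<in> borel_measurable borel" using borel_measurable_integrable[OF X] by simp
  interpret real_distribution "distr unif borel X" by (rule real_distribution_distr_unif) simp
  have "\<exists>y. V y \<le> ?c"
  proof (rule ccontr)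
    assume "\<not> ?thesis"
    then have "?c < expectation (\<lambda>y. V (x - y))"
      by (intro expectation_greater integrable_V X) (auto simp: not_le)
    then show False by (simp add: conv_measure_def)
  qed
  then obtain y where y: "V y \<le> ?c" by blast
  moreover have "V y < 0" using y False by simp
  ultimately show ?thesis unfolding decr_range_def by blast
qed (simp add: decr_range_def)

lemmas v_decr_conv = v_decr_range[OF conv_in_decr_range]

end

section \<open>Smooth steps and the fundamental lemma of the calculus of variations\<close>

text \<open>The cubic \<open>3 * u^2 - 2 * u^3\<close> clamped to the unit interval. Its derivative
  vanishes at both ends, so it is continuously differentiable, which is the regularity asked of test
  functions.\<close>

definition smoothstep :: "real \<Rightarrow> real" where
  "smoothstep u = (max 0 (min 1 u))\<^sup>2 * (3 - 2 * max 0 (min 1 u))"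

definition smoothstep' :: "real \<Rightarrow> real" where
  "smoothstep' u = 6 * max 0 (u * (1 - u))"

lemma smoothstep_mid:
  assumes "0 \<le> u" "u \<le> 1"
  shows "smoothstep u = u\<^sup>2 * (3 - 2 * u)"
proof -
  have "max 0 (min 1 u) = u" using assms by (simp add: min_def max_def)
  then show ?thesis by (simp only: smoothstep_def)
qed

lemma smoothstep_0:
  assumes "u \<le> 0"
  shows "smoothstep u = 0"
proof -
  have "max 0 (min 1 u) = 0" using assms by (simp add: min_def max_def)
  then show ?thesis by (simp only: smoothstep_def) simp
qed

lemma smoothstep_1:
  assumes "1 \<le> u"
  shows "smoothstep u = 1"
proof -
  have "max 0 (min 1 u) = 1" using assms by (simp add: min_def max_def)
  then show ?thesis by (simp only: smoothstep_def) simp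
qed

lemma smoothstep_nonneg: "0 \<le> smoothstep u"
  by (auto simp: smoothstep_def)

lemma one_minus_smoothstep: "0 \<le> u \<Longrightarrow> u \<le> 1 \<Longrightarrow> 1 - smoothstep u = (1 - u)\<^sup>2 * (1 + 2 * u)"
  by (simp add: smoothstep_mid power2_eq_square algebra_simps)

lemma smoothstep_le_1: "smoothstep u \<le> 1"
proof (cases "0 \<le> u \<and> u \<le> 1")
  case True
  then have "0 \<le> 1 - smoothstep u" by (simp add: one_minus_smoothstep)
  then show ?thesis by simp
qed (use smoothstep_0[of u] smoothstep_1[of u] in auto)

lemma smoothstep'_nonneg: "0 \<le> smoothstep' u"
  by (simp add: smoothstep'_def)

lemma smoothstep'_le: "smoothstep' u \<le> 3 / 2"
proof -
  have "0 \<le> (2 * u - 1)\<^sup>2" by simp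
  then show ?thesis by (simp add: smoothstep'_def max_def power2_eq_square algebra_simps)
qed

lemma smoothstep'_0: "u \<le> 0 \<or> 1 \<le> u \<Longrightarrow> smoothstep' u = 0"
proof -
  assume "u \<le> 0 \<or> 1 \<le> u"
  then have "u * (1 - u) \<le> 0"
    by (auto intro: mult_nonpos_nonneg mult_nonneg_nonpos)
  then show ?thesis by (simp add: smoothstep'_def)
qed

text \<open>Applied at the gluing points 0 and 1 of \<open>smoothstep\<close>, where no single
  polynomial formula holds on a neighbourhood.\<close>

lemma DERIV_zero_quadratic:
  fixes f :: "real \<Rightarrow> real"
  assumes "\<And>h. \<bar>f h - f a\<bar> \<le> C * (h - a)\<^sup>2"
  shows "(f has_real_derivative 0) (at a)"
proof -
  have "((\<lambda>h. (f (a + h) - f a) / h) \<longlongrightarrow> 0) (at 0)"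
  proof (rule Lim_null_comparison)
    have "\<bar>(f (a + h) - f a) / h\<bar> \<le> C * \<bar>h\<bar>" if "h \<noteq> 0" for h
      using assms[of "a + h"] that by (simp add: abs_divide divide_le_eq power2_eq_square mult.assoc)
    then show "\<forall>\<^sub>F h in at 0. norm ((f (a + h) - f a) / h) \<le> C * \<bar>h\<bar>"
      by (auto simp: eventually_at_filter)
    show "((\<lambda>h. C * \<bar>h\<bar>) \<longlongrightarrow> 0) (at 0)" by (auto intro!: tendsto_eq_intros)
  qed
  then show ?thesis by (simp add: DERIV_def)
qed

lemma smoothstep_deriv: "(smoothstep has_real_derivative smoothstep' u) (at u)"
proof -
  consider "u < 0" | "u = 0" | "0 < u" "u < 1" | "u = 1" | "1 < u" by linarith
  then show ?thesis
  proof cases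
    case 1
    then have "smoothstep' u = 0" by (simp add: smoothstep'_0)
    then have "((\<lambda>_. 0) has_real_derivative smoothstep' u) (at u)" by simp
    then show ?thesis
      by (rule has_field_derivative_transform_within_open[where S = "{..<0}"])
        (use \<open>u < 0\<close> in \<open>simp_all add: smoothstep_0\<close>)
  next
    case 2
    have "\<bar>smoothstep h - smoothstep 0\<bar> \<le> 3 * (h - 0)\<^sup>2" for h
    proof -
      consider "h < 0" | "0 \<le> h" "h \<le> 1" | "1 < h" by linarith
      then show ?thesis
      proof cases
        case 1
        then show ?thesis by (simp add: smoothstep_0)
      next
        case 2
        have "h\<^sup>2 * (3 - 2 * h) \<le> h\<^sup>2 * 3" using 2 by (intro mult_left_mono) auto
        then show ?thesis using 2 smoothstep_nonneg[of h]
          by (simp add: smoothstep_0 smoothstep_mid mult.commute)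
      next
        case 3
        then have "1 \<le> h\<^sup>2" by (simp add: power2_eq_square mult_ge1_I)
        moreover have "smoothstep h = 1" "smoothstep 0 = 0" using 3 by (simp_all add: smoothstep_0 smoothstep_1)
        ultimately show ?thesis by simp
      qed
    qed
    from DERIV_zero_quadratic[OF this] show ?thesis using 2 by (simp add: smoothstep'_0)
  next
    case 3
    have "0 \<le> u * (1 - u)" using 3 by simp
    then have "smoothstep' u = 2 * u * (3 - 2 * u) + u\<^sup>2 * - 2"
      by (simp add: smoothstep'_def power2_eq_square algebra_simps)
    moreover have "((\<lambda>u. u\<^sup>2 * (3 - 2 * u)) has_real_derivative 2 * u * (3 - 2 * u) + u\<^sup>2 * - 2) (at u)"
      by (rule derivative_eq_intros refl | simp)+
    ultimately have "((\<lambda>u. u\<^sup>2 * (3 - 2 * u)) has_real_derivative smoothstep' u) (at u)" by simp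
    then show ?thesis
      by (rule has_field_derivative_transform_within_open[where S = "{0<..<1}"])
        (use \<open>0 < u\<close> \<open>u < 1\<close> in \<open>simp_all add: smoothstep_mid\<close>)
  next
    case 4
    have "\<bar>smoothstep h - smoothstep 1\<bar> \<le> 3 * (h - 1)\<^sup>2" for h
    proof -
      consider "h < 0" | "0 \<le> h" "h \<le> 1" | "1 < h" by linarith
      then show ?thesis
      proof cases
        case 1
        then have "1 \<le> (1 - h)\<^sup>2" by (simp add: power2_eq_square mult_ge1_I)
        then have "1 \<le> (h - 1)\<^sup>2" by (simp add: power2_commute)
        moreover have "smoothstep h = 0" "smoothstep 1 = 1" using 1 by (simp_all add: smoothstep_0 smoothstep_1)
        ultimately show ?thesis by simp
      next
        case 2
        have "(1 - h)\<^sup>2 * (1 + 2 * h) \<le> (1 - h)\<^sup>2 * 3" using 2 by (intro mult_left_mono) auto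
        then show ?thesis using one_minus_smoothstep[of h] 2 smoothstep_le_1[of h]
          by (simp add: smoothstep_1 power2_commute)
      qed (simp add: smoothstep_1)
    qed
    from DERIV_zero_quadratic[OF this] show ?thesis using 4 by (simp add: smoothstep'_0)
  next
    case 5
    then have "smoothstep' u = 0" by (simp add: smoothstep'_0)
    then have "((\<lambda>_. 1) has_real_derivative smoothstep' u) (at u)" by simp
    then show ?thesis
      by (rule has_field_derivative_transform_within_open[where S = "{1<..}"])
        (use \<open>1 < u\<close> in \<open>simp_all add: smoothstep_1\<close>)
  qed
qed

lemma continuous_on_smoothstep' [continuous_intros]:
  "continuous_on S f \<Longrightarrow> continuous_on S (\<lambda>x. smoothstep' (f x))"
  unfolding smoothstep'_def by (intro continuous_intros)

lemma continuous_on_smoothstep [continuous_intros]: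
  "continuous_on S f \<Longrightarrow> continuous_on S (\<lambda>x. smoothstep (f x))"
  unfolding smoothstep_def by (intro continuous_intros)

lemma smoothstep_deriv_chain [derivative_intros]:
  assumes "(f has_real_derivative f') (at x)"
  shows "((\<lambda>x. smoothstep (f x)) has_real_derivative (smoothstep' (f x) * f')) (at x)"
  by (rule DERIV_chain2[OF smoothstep_deriv assms])

text \<open>A plateau: it climbs from 0 to 1 on \<open>[a, a + h]\<close> and returns on
  \<open>[b - h, b]\<close>. Its derivative is an averaging kernel just after \<open>a\<close> minus
  one just before \<open>b\<close>.\<close>

definition time_bump :: "real \<Rightarrow> real \<Rightarrow> real \<Rightarrow> real \<Rightarrow> real" where
  "time_bump a b h t = smoothstep ((t - a) / h) - smoothstep ((t - (b - h)) / h)"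

definition time_bump' :: "real \<Rightarrow> real \<Rightarrow> real \<Rightarrow> real \<Rightarrow> real" where
  "time_bump' a b h t = smoothstep' ((t - a) / h) / h - smoothstep' ((t - (b - h)) / h) / h"

lemma time_bump_deriv:
  "h > 0 \<Longrightarrow> (time_bump a b h has_real_derivative time_bump' a b h t) (at t)"
  unfolding time_bump_def[abs_def] time_bump'_def by (auto intro!: derivative_eq_intros)

lemma time_bump_outside:
  assumes "h > 0" "a + 2 * h \<le> b" "t \<le> a \<or> b \<le> t"
  shows "time_bump a b h t = 0" "time_bump' a b h t = 0"
proof -
  have *: "(t - a) / h \<le> 0 \<and> (t - (b - h)) / h \<le> 0 \<or> 1 \<le> (t - a) / h \<and> 1 \<le> (t - (b - h)) / h"
    using assms by (auto simp: divide_simps)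
  show "time_bump a b h t = 0" "time_bump' a b h t = 0"
    using * by (auto simp: time_bump_def time_bump'_def smoothstep_0 smoothstep_1 smoothstep'_0)
qed

lemma continuous_on_time_bump: "h > 0 \<Longrightarrow> continuous_on S (time_bump a b h)" "h > 0 \<Longrightarrow> continuous_on S (time_bump' a b h)"
  unfolding time_bump_def[abs_def] time_bump'_def[abs_def] by (auto intro!: continuous_intros)

text \<open>The weak formulation uses Lebesgue integrals over all positive times, while integration
  by parts is done with the gauge integral on a compact interval.\<close>

lemma set_integral_supported:
  fixes f :: "real \<Rightarrow> real"
  assumes "0 < a" "continuous_on {a..b} f" and z: "\<And>t. 0 < t \<Longrightarrow> t < a \<or> b < t \<Longrightarrow> f t = 0"
  shows "set_integrable lborel {0<..} f" "(LBINT t:{0<..}. f t) = integral {a..b} f"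
proof -
  have eq: "indicator {0<..} t *\<^sub>R f t = indicator {a..b} t *\<^sub>R f t" for t
    using z[of t] \<open>0 < a\<close> by (cases "0 < t"; cases "t \<in> {a..b}") auto
  have int: "set_integrable lborel {a..b} f"
    using assms by (intro borel_integrable_atLeastAtMost') auto
  show "set_integrable lborel {0<..} f"
    using int unfolding set_integrable_def eq .
  have "(LBINT t:{0<..}. f t) = (LBINT t:{a..b}. f t)"
    unfolding set_lebesgue_integral_def eq ..
  then show "(LBINT t:{0<..}. f t) = integral {a..b} f"
    using set_borel_integral_eq_integral(2)[OF int] by simp
qed

text \<open>The weight is nonnegative and has integral 1 over \<open>[a, a + h]\<close>, being the
  derivative of a step from 0 to 1.\<close>

lemma smoothstep_average:
  assumes h: "h > 0" and H: "continuous_on {a..a + h} H" and le: "\<And>t. a \<le> t \<Longrightarrow> t \<le> a + h \<Longrightarrow> H t \<le> c"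
  shows "integral {a..a + h} (\<lambda>t. smoothstep' ((t - a) / h) / h * H t) \<le> c"
proof -
  have "((\<lambda>t. smoothstep' ((t - a) / h) / h * c) has_integral (smoothstep ((a + h - a) / h) * c - smoothstep ((a - a) / h) * c)) {a..a + h}"
  proof (rule fundamental_theorem_of_calculus)
    fix t
    have "((\<lambda>t. smoothstep ((t - a) / h) * c) has_real_derivative smoothstep' ((t - a) / h) / h * c) (at t)"
      using h by (auto intro!: derivative_eq_intros)
    then show "((\<lambda>t. smoothstep ((t - a) / h) * c) has_vector_derivative smoothstep' ((t - a) / h) / h * c) (at t within {a..a + h})"
      by (simp add: has_real_derivative_iff_has_vector_derivative has_vector_derivative_at_within)
  qed (use h in simp)
  then have c: "((\<lambda>t. smoothstep' ((t - a) / h) / h * c) has_integral c) {a..a + h}"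
    using h by (simp add: smoothstep_0 smoothstep_1)
  have "integral {a..a + h} (\<lambda>t. smoothstep' ((t - a) / h) / h * H t) \<le> integral {a..a + h} (\<lambda>t. smoothstep' ((t - a) / h) / h * c)"
    using h by (intro integral_le integrable_continuous_real continuous_intros H mult_left_mono le)
      (auto simp: smoothstep'_nonneg)
  then show ?thesis using c by (simp add: has_integral_iff)
qed

text \<open>If \<open>B\<close> is the distributional derivative of \<open>A\<close>, then \<open>A\<close> minus a primitive of \<open>B\<close> has equal
  weighted averages near the two endpoints.\<close>

lemma weak_derivative_increment:
  fixes A B :: "real \<Rightarrow> real"
  assumes "0 < a" "a < b" and A: "continuous_on {a..b} A" and B: "continuous_on {a..b} B"
    and weak: "\<And>h. 0 < h \<Longrightarrow> a + 2 * h \<le> b \<Longrightarrow>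
      integral {a..b} (\<lambda>t. time_bump' a b h t * A t) + integral {a..b} (\<lambda>t. time_bump a b h t * B t) = 0"
  shows "A b - A a = integral {a..b} B"
proof -
  define G where "G t = integral {a..t} B" for t
  have G': "(G has_vector_derivative B t) (at t within {a..b})" if "t \<in> {a..b}" for t
    unfolding G_def by (rule integral_has_vector_derivative[OF B that])
  have G: "continuous_on {a..b} G"
    unfolding continuous_on_eq_continuous_within
    by (intro ballI has_vector_derivative_continuous[OF G'])
  define H where "H t = A t - G t" for t
  have H: "continuous_on {a..b} H"
    unfolding H_def by (intro continuous_intros A G)
  \<comment> \<open>Integration by parts gives the primitive \<open>G\<close> the same balance with
    \<open>B\<close> as is assumed of \<open>A\<close>; subtracting removes
    \<open>B\<close>.\<close>
  have bal: "integral {a..b} (\<lambda>t. time_bump' a b h t * H t) = 0" if h: "0 < h" "a + 2 * h \<le> b" for h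
  proof -
    note c = continuous_on_time_bump[OF h(1)]
    have "((\<lambda>t. time_bump' a b h t * G t + time_bump a b h t * B t) has_integral
        (time_bump a b h b * G b - time_bump a b h a * G a)) {a..b}"
    proof (rule fundamental_theorem_of_calculus)
      fix t assume t: "t \<in> {a..b}"
      show "((\<lambda>t. time_bump a b h t * G t) has_vector_derivative
          time_bump' a b h t * G t + time_bump a b h t * B t) (at t within {a..b})"
        using has_vector_derivative_mult[OF has_vector_derivative_at_within[OF
            time_bump_deriv[OF h(1), unfolded has_real_derivative_iff_has_vector_derivative]] G'[OF t]]
        by (simp add: add.commute)
    qed (use \<open>a < b\<close> in simp)
    then have "integral {a..b} (\<lambda>t. time_bump' a b h t * G t + time_bump a b h t * B t) = 0"
      using time_bump_outside[OF h] by (simp add: has_integral_iff)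
    then have "integral {a..b} (\<lambda>t. time_bump' a b h t * G t) + integral {a..b} (\<lambda>t. time_bump a b h t * B t) = 0"
      by (subst (asm) integral_add) (intro integrable_continuous_real continuous_intros c G B)+
    moreover have "integral {a..b} (\<lambda>t. time_bump' a b h t * H t)
      = integral {a..b} (\<lambda>t. time_bump' a b h t * A t) - integral {a..b} (\<lambda>t. time_bump' a b h t * G t)"
      unfolding H_def right_diff_distrib
      by (rule integral_diff) (intro integrable_continuous_real continuous_intros c G A)+
    ultimately show ?thesis using weak[OF h] by simp
  qed
  have no_gap: "False"
    if K: "continuous_on {a..b} K" and gap: "K a < K b"
      and balK: "\<And>h. 0 < h \<Longrightarrow> a + 2 * h \<le> b \<Longrightarrow> integral {a..b} (\<lambda>t. time_bump' a b h t * K t) = 0" for K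
  proof -
    \<comment> \<open>A third of the gap, so that \<open>K a + e < K b - e\<close> and the two
      averages stay separated.\<close>
    define e where "e = (K b - K a) / 3"
    have e: "e > 0" using gap by (simp add: e_def)
    obtain d1 where d1: "d1 > 0" "\<And>t. t \<in> {a..b} \<Longrightarrow> \<bar>t - a\<bar> < d1 \<Longrightarrow> \<bar>K t - K a\<bar> < e"
      using K[unfolded continuous_on_iff, rule_format, of a e] e \<open>a < b\<close> by (auto simp: dist_real_def)
    obtain d2 where d2: "d2 > 0" "\<And>t. t \<in> {a..b} \<Longrightarrow> \<bar>t - b\<bar> < d2 \<Longrightarrow> \<bar>K t - K b\<bar> < e"
      using K[unfolded continuous_on_iff, rule_format, of b e] e \<open>a < b\<close> by (auto simp: dist_real_def)
    define h where "h = min (min (d1 / 2) (d2 / 2)) ((b - a) / 2)"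
    have h: "0 < h" "a + 2 * h \<le> b" "h < d1" "h < d2"
      using d1 d2 \<open>a < b\<close> by (auto simp: h_def min_def field_simps)
    have Ka: "continuous_on {a..a + h} K" and Kb: "continuous_on {b - h..b} K"
      using h by (auto intro: continuous_on_subset[OF K])
    have i1: "(\<lambda>t. smoothstep' ((t - a) / h) / h * K t) integrable_on {a..b}"
      and i2: "(\<lambda>t. smoothstep' ((t - (b - h)) / h) / h * K t) integrable_on {a..b}"
      using h by (auto intro!: integrable_continuous_real continuous_intros K)
    have "integral {a..b} (\<lambda>t. smoothstep' ((t - a) / h) / h * K t)
      = integral {a..a + h} (\<lambda>t. smoothstep' ((t - a) / h) / h * K t)"
    proof -
      have "integral {a + h..b} (\<lambda>t. smoothstep' ((t - a) / h) / h * K t) = integral {a + h..b} (\<lambda>t. 0)"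
        using h by (intro integral_cong) (auto simp: smoothstep'_0 divide_simps)
      then show ?thesis
        using Henstock_Kurzweil_Integration.integral_combine[of a "a + h" b, OF _ _ i1] h by simp
    qed
    also have "\<dots> \<le> K a + e"
      by (intro smoothstep_average h(1) Ka) (use d1(2) h in \<open>fastforce simp: abs_less_iff\<close>)
    finally have u: "integral {a..b} (\<lambda>t. smoothstep' ((t - a) / h) / h * K t) \<le> K a + e" .
    have "integral {a..b} (\<lambda>t. smoothstep' ((t - (b - h)) / h) / h * K t)
      = integral {b - h..b} (\<lambda>t. smoothstep' ((t - (b - h)) / h) / h * K t)"
    proof -
      have "integral {a..b - h} (\<lambda>t. smoothstep' ((t - (b - h)) / h) / h * K t) = integral {a..b - h} (\<lambda>t. 0)"
        using h by (intro integral_cong) (auto simp: smoothstep'_0 divide_simps)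
      then show ?thesis
        using Henstock_Kurzweil_Integration.integral_combine[of a "b - h" b, OF _ _ i2] h by simp
    qed
    also have "\<dots> = - integral {b - h..b - h + h} (\<lambda>t. smoothstep' ((t - (b - h)) / h) / h * - K t)"
      by (simp add: integral_neg)
    also have "\<dots> \<ge> - (- (K b - e))"
    proof -
      have "- K t \<le> - (K b - e)" if "b - h \<le> t" "t \<le> b - h + h" for t
        using d2(2)[of t] that h by (auto simp: abs_less_iff)
      then have "integral {b - h..b - h + h} (\<lambda>t. smoothstep' ((t - (b - h)) / h) / h * - K t) \<le> - (K b - e)"
        using Kb by (intro smoothstep_average h(1)) (auto intro!: continuous_intros)
      then show ?thesis by simp
    qed
    finally have l: "K b - e \<le> integral {a..b} (\<lambda>t. smoothstep' ((t - (b - h)) / h) / h * K t)" by simp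
    have "integral {a..b} (\<lambda>t. time_bump' a b h t * K t)
      = integral {a..b} (\<lambda>t. smoothstep' ((t - a) / h) / h * K t) - integral {a..b} (\<lambda>t. smoothstep' ((t - (b - h)) / h) / h * K t)"
      unfolding time_bump'_def left_diff_distrib by (rule integral_diff[OF i1 i2])
    then have "K b - e \<le> K a + e" using balK[OF h(1,2)] u l by linarith
    then show False using e unfolding e_def by argo
  qed
  have "\<not> H a < H b" using no_gap[OF H] bal by blast
  moreover have "\<not> - H a < - H b"
  proof
    assume "- H a < - H b"
    then show False
      using no_gap[of "\<lambda>t. - H t"] H bal by (auto intro!: continuous_intros simp: integral_neg)
  qed
  ultimately have "H a = H b" by simp
  then show ?thesis by (simp add: H_def G_def)
qed

section \<open>Quantile functions of weak solutions\<close>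

text \<open>If \<open>X z \<le> x\<close>, then either \<open>Y z \<le> x + \<eta>\<close> or the
  two differ by at least \<open>\<eta>\<close>; Markov's inequality controls the second
  alternative.\<close>

lemma tail_comparison:
  assumes X: "integrable unif X" and Y: "integrable unif Y" and "0 < \<eta>"
  shows "measure unif {z. X z \<le> x} \<le> measure unif {z. Y z \<le> x + \<eta>} + (\<integral>z. \<bar>X z - Y z\<bar> \<partial>unif) / \<eta>"
proof -
  have [measurable]: "X \<in> borel_measurable borel" "Y \<in> borel_measurable borel"
    using X Y by (auto dest: borel_measurable_integrable)
  have "measure unif {z. X z \<le> x} \<le> measure unif ({z. Y z \<le> x + \<eta>} \<union> {z \<in> space unif. \<eta> \<le> \<bar>X z - Y z\<bar>})"
    by (intro unif.finite_measure_mono) auto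
  also have "\<dots> \<le> measure unif {z. Y z \<le> x + \<eta>} + measure unif {z \<in> space unif. \<eta> \<le> \<bar>X z - Y z\<bar>}"
    by (intro measure_Un_le) auto
  also have "measure unif {z \<in> space unif. \<eta> \<le> \<bar>X z - Y z\<bar>} \<le> (\<integral>z. \<bar>X z - Y z\<bar> \<partial>unif) / \<eta>"
    using X Y \<open>0 < \<eta>\<close> by (intro integral_Markov_inequality_measure[of _ _ "{}"]) auto
  finally show ?thesis by simp
qed

locale weak_solution = nonlocal_kernel +
  fixes p :: ennreal and rho0 :: "real measure" and rho :: "real \<Rightarrow> real measure"
  assumes p: "1 \<le> p" and sol: "dissipative_measure_solution V v p rho0 rho"
begin

abbreviation "X z t \<equiv> quantile (rho t) z"

lemma moment: "0 \<le> t \<Longrightarrow> rho t \<in> prob_moment p"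
  using sol by (simp add: dissipative_measure_solution_def)

lemma rho_distribution: "0 \<le> t \<Longrightarrow> real_distribution (rho t)"
  using moment by (rule prob_moment_real_distribution)

lemma X_Lp: "0 \<le> t \<Longrightarrow> in_Lp p (quantile (rho t))"
  using moment by (rule in_Lp_quantile)

lemma X_measurable: "0 \<le> t \<Longrightarrow> quantile (rho t) \<in> borel_measurable borel"
  using X_Lp in_Lp_measurable by blast

lemma X_int: "0 \<le> t \<Longrightarrow> integrable unif (quantile (rho t))"
  using X_Lp by (rule in_Lp_integrable[OF p])

lemma L1_le_wasserstein:
  assumes "0 \<le> s" "0 \<le> t"
  shows "(\<integral>z. \<bar>X z s - X z t\<bar> \<partial>unif) \<le> wasserstein p (rho s) (rho t)"
  using assms L1_le_Lp_norm[OF p in_Lp_diff[OF p X_Lp X_Lp]] by (simp add: wasserstein_eq_Lp_norm p rho_distribution)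

lemma L1_continuous:
  assumes "0 \<le> t" "0 < e"
  shows "\<exists>d>0. \<forall>s\<ge>0. \<bar>s - t\<bar> < d \<longrightarrow> (\<integral>z. \<bar>X z s - X z t\<bar> \<partial>unif) < e"
proof -
  have "((\<lambda>s. wasserstein p (rho s) (rho t)) \<longlongrightarrow> 0) (at t within {0..})"
    using sol \<open>0 \<le> t\<close> by (simp add: dissipative_measure_solution_def)
  then have "\<forall>\<^sub>F s in at t within {0..}. dist (wasserstein p (rho s) (rho t)) 0 < e"
    using \<open>0 < e\<close> by (rule tendstoD)
  then obtain d where d: "d > 0" "\<And>s. 0 \<le> s \<Longrightarrow> s \<noteq> t \<Longrightarrow> \<bar>s - t\<bar> < d \<Longrightarrow> \<bar>wasserstein p (rho s) (rho t)\<bar> < e"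
    unfolding eventually_at by (auto simp: dist_real_def)
  have "(\<integral>z. \<bar>X z s - X z t\<bar> \<partial>unif) < e" if "0 \<le> s" "\<bar>s - t\<bar> < d" for s
    using d(2)[OF that(1) _ that(2)] L1_le_wasserstein[OF that(1) \<open>0 \<le> t\<close>] \<open>0 < e\<close> by (cases "s = t") auto
  then show ?thesis using d(1) by blast
qed

lemma atomless:
  assumes "0 < t"
  shows "measure (rho t) {x} = 0"
proof -
  have "Linf_norm (rho t) < \<infinity>"
    using sol assms by (simp add: dissipative_measure_solution_def)
  then have "absolutely_continuous lborel (rho t)"
    by (auto simp: Linf_norm_def split: if_splits)
  moreover have "{x} \<in> null_sets lborel" by (rule countable_imp_null_set_lborel) simp
  ultimately have "{x} \<in> null_sets (rho t)" by (auto simp: absolutely_continuous_def)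
  then show ?thesis by (simp add: measure_def null_setsD1)
qed

lemma isCont_cdf_rho: "0 < t \<Longrightarrow> isCont (cdf (rho t)) x"
  using real_distribution.finite_borel_measure_M[OF rho_distribution[of t]]
  by (simp add: finite_borel_measure.isCont_cdf atomless)

lemma le_cdf_X: "0 \<le> t \<Longrightarrow> 0 < z \<Longrightarrow> z < 1 \<Longrightarrow> z \<le> cdf (rho t) x \<longleftrightarrow> X z t \<le> x"
  using quantile_le_iff[OF rho_distribution] by blast

text \<open>Without atoms the distribution function is continuous and cannot jump over
  \<open>z\<close>. This identity puts \<open>lam * z\<close> into the ODE in place of the
  distribution function.\<close>

lemma cdf_X:
  assumes "0 < t" "0 < z" "z < 1"
  shows "cdf (rho t) (X z t) = z"
proof (rule antisym)
  show "z \<le> cdf (rho t) (X z t)" using assms by (simp add: le_cdf_X)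
  show "cdf (rho t) (X z t) \<le> z"
  proof (rule ccontr)
    assume "\<not> ?thesis"
    moreover have "(cdf (rho t) \<longlongrightarrow> cdf (rho t) (X z t)) (at_left (X z t))"
      using isCont_cdf_rho[OF assms(1)] by (auto simp: isCont_def intro: filterlim_at_split[THEN iffD1, THEN conjunct1])
    ultimately have "\<forall>\<^sub>F x in at_left (X z t). z < cdf (rho t) x"
      by (intro order_tendstoD(1)) auto
    then have "\<forall>\<^sub>F x in at_left (X z t). z < cdf (rho t) x \<and> x < X z t"
      by (rule eventually_conj) (auto simp: eventually_at_filter)
    then obtain x where "z < cdf (rho t) x" "x < X z t"
      using eventually_happens[of _ "at_left (X z t)"] by auto
    then show False using assms le_cdf_X[of t z x] by auto
  qed
qed

section \<open>The velocity field and the first moment of a weak solution\<close>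

definition w :: "real \<Rightarrow> real \<Rightarrow> real" where
  "w x t = v (conv_measure V (rho t) x)"

definition m :: "real \<Rightarrow> real" where
  "m t = (\<integral>z. \<bar>X z t\<bar> \<partial>unif)"

text \<open>With no mass at \<open>x\<close>, the strict half-line in the convolution formula may be
  closed. The right-hand side is continuous in \<open>x\<close>, although \<open>V\<close>
  jumps.\<close>

lemma w_eq:
  assumes "0 < t"
  shows "w x t = v (ubar (quantile (rho t)) x - lam * cdf (rho t) x)"
proof -
  interpret real_distribution "rho t" using rho_distribution assms by simp
  note [measurable] = X_measurable[of t, simplified less_imp_le[OF assms]]
  have d: "distr unif borel (quantile (rho t)) = rho t" using assms by (simp add: distr_quantile rho_distribution)
  have "measure unif {z. X z t < x} = measure (distr unif borel (quantile (rho t))) {..<x}"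
    using X_measurable[of t] assms by (subst measure_distr) (auto simp: vimage_def)
  also have "\<dots> = measure (rho t) {..<x}" by (simp only: d)
  also have "\<dots> = measure (rho t) {..<x} + measure (rho t) {x}" using atomless[OF assms] by simp
  also have "\<dots> = measure (rho t) ({..<x} \<union> {x})" by (subst finite_measure_Union) auto
  also have "{..<x} \<union> {x} = {..x}" by auto
  finally have "measure unif {z. X z t < x} = cdf (rho t) x" by (simp add: cdf_def)
  then show ?thesis
    using conv_measure_distr[OF X_int, of t x] assms by (simp add: w_def d)
qed

text \<open>At most linear growth in \<open>x\<close>; this is what makes the flux through the
  far-left cutoff of a front negligible.\<close>

lemma abs_w_le:
  assumes "0 < t"
  shows "\<bar>w x t\<bar> \<le> (\<bar>v 0\<bar> + Lv * (2 * lam + LU)) * (1 + \<bar>x\<bar> + m t)"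
proof -
  interpret real_distribution "rho t" using rho_distribution assms by simp
  have "\<bar>ubar (quantile (rho t)) x - ubar (\<lambda>_. 0) 0\<bar> \<le> LU * (\<bar>x - 0\<bar> + (\<integral>\<zeta>. \<bar>X \<zeta> t - 0\<bar> \<partial>unif))"
    using assms by (intro ubar_diff U_diff' X_int) auto
  then have u: "\<bar>ubar (quantile (rho t)) x\<bar> \<le> lam + LU * (\<bar>x\<bar> + m t)"
    using lam_pos by (simp add: ubar_def U_0 m_def)
  have F: "\<bar>lam * cdf (rho t) x\<bar> \<le> lam"
    using lam_pos cdf_nonneg[of x] cdf_bounded_prob[of x] by (simp add: abs_mult mult_left_le)
  have m0: "0 \<le> m t" by (simp add: m_def)
  have "\<bar>w x t\<bar> \<le> \<bar>v 0\<bar> + Lv * \<bar>ubar (quantile (rho t)) x - lam * cdf (rho t) x\<bar>"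
    using v_diff[of "ubar (quantile (rho t)) x - lam * cdf (rho t) x" 0] by (simp add: w_eq[OF assms])
  also have "\<dots> \<le> \<bar>v 0\<bar> + Lv * (2 * lam + LU * (\<bar>x\<bar> + m t))"
    using u F by (intro add_left_mono mult_left_mono Lv_nonneg) auto
  also have "\<dots> \<le> \<bar>v 0\<bar> * (1 + \<bar>x\<bar> + m t) + Lv * ((2 * lam + LU) * (1 + \<bar>x\<bar> + m t))"
  proof (intro add_mono mult_left_mono Lv_nonneg)
    show "\<bar>v 0\<bar> \<le> \<bar>v 0\<bar> * (1 + \<bar>x\<bar> + m t)" using m0 by (simp add: mult_left_le_one_le mult_le_cancel_left1)
    have "2 * lam * 1 \<le> 2 * lam * (1 + \<bar>x\<bar> + m t)" "LU * (\<bar>x\<bar> + m t) \<le> LU * (1 + \<bar>x\<bar> + m t)"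
      using m0 lam_pos LU_nonneg by (intro mult_left_mono; simp)+
    then show "2 * lam + LU * (\<bar>x\<bar> + m t) \<le> (2 * lam + LU) * (1 + \<bar>x\<bar> + m t)"
      by (simp add: algebra_simps)
  qed
  finally show ?thesis by (simp add: algebra_simps)
qed

lemma m_diff: "0 \<le> s \<Longrightarrow> 0 \<le> t \<Longrightarrow> \<bar>m s - m t\<bar> \<le> (\<integral>z. \<bar>X z s - X z t\<bar> \<partial>unif)"
proof -
  assume st: "0 \<le> s" "0 \<le> t"
  have "\<bar>m s - m t\<bar> = \<bar>\<integral>z. \<bar>X z s\<bar> - \<bar>X z t\<bar> \<partial>unif\<bar>"
    unfolding m_def using st X_int by (subst Bochner_Integration.integral_diff) auto
  also have "\<dots> \<le> (\<integral>z. \<bar>\<bar>X z s\<bar> - \<bar>X z t\<bar>\<bar> \<partial>unif)" by (rule integral_abs_bound)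
  also have "\<dots> \<le> (\<integral>z. \<bar>X z s - X z t\<bar> \<partial>unif)"
    using st X_int by (intro integral_mono) auto
  finally show ?thesis .
qed

lemma continuous_on_m: "continuous_on {0..} m"
  unfolding continuous_on_iff
proof (intro ballI allI impI)
  fix t e :: real assume t: "t \<in> {0..}" "0 < e"
  then obtain d where d: "d > 0" "\<forall>s\<ge>0. \<bar>s - t\<bar> < d \<longrightarrow> (\<integral>z. \<bar>X z s - X z t\<bar> \<partial>unif) < e"
    using L1_continuous[of t e] by auto
  show "\<exists>d>0. \<forall>s\<in>{0..}. dist s t < d \<longrightarrow> dist (m s) (m t) < e"
    using d t m_diff[of _ t] by (intro exI[of _ d]) (auto simp: dist_real_def intro: le_less_trans)
qed

lemma m_bounded: obtains M where "0 \<le> M" "\<And>t. 0 \<le> t \<Longrightarrow> t \<le> T \<Longrightarrow> m t \<le> M"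
proof -
  have "bounded (m ` {0..T})"
    by (intro compact_imp_bounded compact_continuous_image continuous_on_subset[OF continuous_on_m]) auto
  then obtain M where "\<forall>x\<in>m ` {0..T}. norm x \<le> M" unfolding bounded_iff by blast
  then have M: "\<bar>m t\<bar> \<le> M" if "0 \<le> t" "t \<le> T" for t using that by simp
  have "m t \<le> max M 0" if "0 \<le> t" "t \<le> T" for t using M[OF that] by linarith
  then show ?thesis using that[of "max M 0"] by simp
qed

text \<open>A change of time is traded for a small horizontal shift plus an error controlled by the
  L1 distance of the quantiles; the shift is harmless because the distribution function at
  \<open>t0\<close> is continuous.\<close>

lemma continuous_on_cdf: "continuous_on (UNIV \<times> {0<..}) (\<lambda>(x, t). cdf (rho t) x)"
  unfolding continuous_on_iff
proof (intro ballI allI impI)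
  fix q :: "real \<times> real" and e :: real assume q: "q \<in> UNIV \<times> {0<..}" and e: "0 < e"
  obtain x0 t0 where q_def: "q = (x0, t0)" and t0: "0 < t0" using q by auto
  obtain \<eta> where \<eta>: "0 < \<eta>" "\<And>x. \<bar>x - x0\<bar> < \<eta> \<Longrightarrow> \<bar>cdf (rho t0) x - cdf (rho t0) x0\<bar> < e / 2"
    using isCont_cdf_rho[OF t0, of x0, unfolded continuous_at_eps_delta, rule_format, OF half_gt_zero[OF e]]
    by (auto simp: dist_real_def)
  \<comment> \<open>One third for the displacement of \<open>x\<close> and one third for the
    horizontal shift stay within \<open>\<eta>\<close>.\<close>
  let ?\<eta> = "\<eta> / 3"
  obtain d where d: "0 < d" "\<And>s. 0 \<le> s \<Longrightarrow> \<bar>s - t0\<bar> < d \<Longrightarrow> (\<integral>z. \<bar>X z s - X z t0\<bar> \<partial>unif) < ?\<eta> * (e / 2)"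
    using L1_continuous[of t0 "?\<eta> * (e / 2)"] e \<eta>(1) t0 by auto
  have "\<bar>cdf (rho t) x - cdf (rho t0) x0\<bar> < e" if t: "0 < t" and c: "\<bar>x - x0\<bar> < ?\<eta>" "\<bar>t - t0\<bar> < d" for x t
  proof -
    let ?I = "\<integral>z. \<bar>X z t - X z t0\<bar> \<partial>unif"
    have I: "?I / ?\<eta> < e / 2" using d(2)[of t] t c \<eta>(1) by (simp add: divide_less_eq mult.commute)
    have "cdf (rho t) x \<le> cdf (rho t0) (x + ?\<eta>) + ?I / ?\<eta>"
      using tail_comparison[OF X_int[of t] X_int[of t0], of ?\<eta> x] t t0 \<eta>(1) by (simp add: cdf_quantile rho_distribution)
    moreover have "cdf (rho t0) (x - ?\<eta>) \<le> cdf (rho t) x + ?I / ?\<eta>"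
      using tail_comparison[OF X_int[of t0] X_int[of t], of ?\<eta> "x - ?\<eta>"] t t0 \<eta>(1)
      by (simp add: cdf_quantile rho_distribution abs_minus_commute)
    moreover have "\<bar>cdf (rho t0) (x + ?\<eta>) - cdf (rho t0) x0\<bar> < e / 2" "\<bar>cdf (rho t0) (x - ?\<eta>) - cdf (rho t0) x0\<bar> < e / 2"
      using c \<eta>(1) by (intro \<eta>(2); linarith)+
    ultimately show ?thesis using I by linarith
  qed
  note * = this
  show "\<exists>d>0. \<forall>q'\<in>UNIV \<times> {0<..}. dist q' q < d \<longrightarrow> dist (case q' of (x, t) \<Rightarrow> cdf (rho t) x) (case q of (x, t) \<Rightarrow> cdf (rho t) x) < e"
  proof (intro exI[of _ "min ?\<eta> d"] conjI ballI impI)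
    fix q' :: "real \<times> real" assume q': "q' \<in> UNIV \<times> {0<..}" "dist q' q < min ?\<eta> d"
    have "dist (fst q') x0 < min ?\<eta> d" "dist (snd q') t0 < min ?\<eta> d"
      using dist_fst_le[of q' q] dist_snd_le[of q' q] q' by (auto simp: q_def)
    then show "dist (case q' of (x, t) \<Rightarrow> cdf (rho t) x) (case q of (x, t) \<Rightarrow> cdf (rho t) x) < e"
      using q' *[of "snd q'" "fst q'"] by (auto simp: q_def dist_real_def split_beta)
  qed (use \<eta>(1) d(1) in auto)
qed

lemma continuous_on_ubar: "continuous_on (UNIV \<times> {0<..}) (\<lambda>(x, t). ubar (quantile (rho t)) x)"
  unfolding continuous_on_iff
proof (intro ballI allI impI)
  fix q :: "real \<times> real" and e :: real assume q: "q \<in> UNIV \<times> {0<..}" and e: "0 < e"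
  obtain x0 t0 where q_def: "q = (x0, t0)" and t0: "0 < t0" using q by auto
  define k where "k = LU + 1"
  have k: "0 < k" "LU < k" using LU_nonneg by (auto simp: k_def)
  let ?e = "e / (2 * k)"
  have e': "0 < ?e" using e k by simp
  obtain d where d: "0 < d" "\<And>s. 0 \<le> s \<Longrightarrow> \<bar>s - t0\<bar> < d \<Longrightarrow> (\<integral>z. \<bar>X z s - X z t0\<bar> \<partial>unif) < ?e"
    using L1_continuous[of t0 ?e] e' t0 by auto
  show "\<exists>d>0. \<forall>q'\<in>UNIV \<times> {0<..}. dist q' q < d \<longrightarrow> dist (case q' of (x, t) \<Rightarrow> ubar (quantile (rho t)) x) (case q of (x, t) \<Rightarrow> ubar (quantile (rho t)) x) < e"
  proof (intro exI[of _ "min ?e d"] conjI ballI impI)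
    fix q' :: "real \<times> real" assume q': "q' \<in> UNIV \<times> {0<..}" "dist q' q < min ?e d"
    obtain x t where q'_def: "q' = (x, t)" by (cases q')
    have c: "\<bar>x - x0\<bar> < ?e" "\<bar>t - t0\<bar> < d" "0 < t"
      using dist_fst_le[of q' q] dist_snd_le[of q' q] q' by (auto simp: q_def q'_def dist_real_def)
    have "\<bar>ubar (quantile (rho t)) x - ubar (quantile (rho t0)) x0\<bar> \<le> LU * (\<bar>x - x0\<bar> + (\<integral>z. \<bar>X z t - X z t0\<bar> \<partial>unif))"
      using c t0 by (intro ubar_diff U_diff' X_int) auto
    also have "\<dots> \<le> LU * (?e + ?e)"
      using c d(2)[of t] by (intro mult_left_mono LU_nonneg) auto
    also have "\<dots> < k * (?e + ?e)" using e' k by (intro mult_strict_right_mono) auto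
    also have "\<dots> = e" using k by (simp add: field_simps)
    finally show "dist (case q' of (x, t) \<Rightarrow> ubar (quantile (rho t)) x) (case q of (x, t) \<Rightarrow> ubar (quantile (rho t)) x) < e"
      by (simp add: q_def q'_def dist_real_def)
  qed (use e' d(1) in auto)
qed

lemma continuous_on_w: "continuous_on (UNIV \<times> {0<..}) (\<lambda>(x, t). w x t)"
proof -
  have "continuous_on (UNIV \<times> {0<..}) (\<lambda>q. v ((case q of (x, t) \<Rightarrow> ubar (quantile (rho t)) x) - lam * (case q of (x, t) \<Rightarrow> cdf (rho t) x)))"
    by (rule continuous_on_compose2[OF continuous_on_v[of UNIV]])
      (intro continuous_intros continuous_on_ubar continuous_on_cdf, simp)
  then show ?thesis
    by (rule continuous_on_eq) (auto simp: w_eq)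
qed

text \<open>Take a label at which the monotone function \<open>quantile (rho t)\<close> is
  continuous. If \<open>X z s\<close> differed from \<open>X z t\<close> by \<open>e\<close>,
  monotonicity in the label would force a deviation of at least \<open>e / 2\<close> on a whole
  interval of labels, contradicting L1 continuity in time.\<close>

lemma AE_continuous_X:
  assumes "0 \<le> t"
  shows "AE z in unif. continuous (at t within {0..}) (\<lambda>t. X z t)"
proof -
  have "mono_on {0<..<1} (quantile (rho t))"
    using quantile_mono[OF rho_distribution[OF assms]] by (auto intro!: mono_onI)
  then have "countable {z \<in> {0<..<1}. \<not> isCont (quantile (rho t)) z}"
    by (intro mono_on_ctble_discont_open) auto
  then have "AE z in lborel. z \<notin> {z \<in> {0<..<1}. \<not> isCont (quantile (rho t)) z}"
    by (intro AE_not_in countable_imp_null_set_lborel)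
  then show ?thesis
    unfolding AE_unif
  proof eventually_elim
    case (elim z)
    show ?case
    proof (intro impI)
      assume z: "0 < z \<and> z < 1"
      then have "isCont (quantile (rho t)) z" using elim by auto
      show "continuous (at t within {0..}) (\<lambda>t. X z t)"
        unfolding continuous_within_eps_delta
      proof (intro allI impI)
        fix e :: real assume e: "0 < e"
        obtain d0 where d0: "0 < d0" "\<And>z'. \<bar>z' - z\<bar> < d0 \<Longrightarrow> \<bar>X z' t - X z t\<bar> < e / 2"
          using \<open>isCont (quantile (rho t)) z\<close>[unfolded continuous_at_eps_delta, rule_format, OF half_gt_zero[OF e]]
          by (auto simp: dist_real_def)
        define d where "d = min d0 (min z (1 - z))"
        have d: "0 < d" "d \<le> d0" "d \<le> z" "d \<le> 1 - z" using d0 z by (auto simp: d_def)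
        obtain r where r: "0 < r" "\<And>s. 0 \<le> s \<Longrightarrow> \<bar>s - t\<bar> < r \<Longrightarrow> (\<integral>z. \<bar>X z s - X z t\<bar> \<partial>unif) < d * (e / 2)"
          using L1_continuous[OF assms, of "d * (e / 2)"] d e by auto
        have "\<bar>X z s - X z t\<bar> < e" if s: "0 \<le> s" "\<bar>s - t\<bar> < r" for s
        proof (rule ccontr)
          assume "\<not> ?thesis"
          then consider "X z s \<ge> X z t + e" | "X z s \<le> X z t - e" by linarith
          then obtain a where a: "0 \<le> a" "a + d \<le> 1" "\<And>z'. z' \<in> {a<..<a + d} \<Longrightarrow> e / 2 \<le> \<bar>X z' s - X z' t\<bar>"
          proof cases
            case 1
            have "e / 2 \<le> \<bar>X z' s - X z' t\<bar>" if "z' \<in> {z<..<z + d}" for z'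
            proof -
              have "X z s \<le> X z' s" using that z d by (intro quantile_mono rho_distribution s) auto
              moreover have "\<bar>X z' t - X z t\<bar> < e / 2" using that d by (intro d0) auto
              ultimately show ?thesis using 1 by linarith
            qed
            then show ?thesis using that[of z] z d by auto
          next
            case 2
            have "e / 2 \<le> \<bar>X z' s - X z' t\<bar>" if "z' \<in> {z - d<..<z - d + d}" for z'
            proof -
              have "X z' s \<le> X z s" using that z d by (intro quantile_mono rho_distribution s) auto
              moreover have "\<bar>X z' t - X z t\<bar> < e / 2" using that d by (intro d0) auto
              ultimately show ?thesis using 2 by linarith
            qed
            then show ?thesis using that[of "z - d"] z d by auto
          qed
          have "d * (e / 2) \<le> measure unif {a<..<a + d} * (e / 2)"
            using measure_unif_ge[of "{a<..<a + d}" a "a + d"] a e by (intro mult_right_mono) auto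
          also have "\<dots> = (\<integral>z. (e / 2) * indicator {a<..<a + d} z \<partial>unif)" by simp
          also have "\<dots> \<le> (\<integral>z. \<bar>X z s - X z t\<bar> \<partial>unif)"
            using a(3) X_int[OF s(1)] X_int[OF assms]
            by (intro integral_mono integrable_mult_right integrable_real_indicator)
              (auto simp: indicator_def unif.emeasure_eq_measure)
          finally show False using r(2)[OF s] by simp
        qed
        then show "\<exists>r>0. \<forall>s\<in>{0..}. dist s t < r \<longrightarrow> dist (X z s) (X z t) < e"
          using r(1) by (intro exI[of _ r]) (auto simp: dist_real_def)
      qed
    qed
  qed
qed

text \<open>On compact time intervals away from 0 the integrand has bounded support in
  \<open>x\<close>, hence is bounded; continuity in time is then dominated convergence along almost
  every trajectory.\<close>

lemma
  assumes f: "continuous_on (UNIV \<times> {0<..}) (\<lambda>(x, t). f x t)"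
    and supp: "\<And>T. \<exists>r. \<forall>t\<in>{0<..T}. \<forall>x. r < \<bar>x\<bar> \<longrightarrow> f x t = (0::real)"
  shows integrable_along: "0 < t \<Longrightarrow> integrable unif (\<lambda>z. f (X z t) t)"
    and continuous_on_along: "continuous_on {0<..} (\<lambda>t. \<integral>z. f (X z t) t \<partial>unif)"
proof -
  have sect: "(\<lambda>x. f x t) \<in> borel_measurable borel" if "0 < t" for t
    using that by (intro borel_measurable_continuous_onI continuous_on_compose2[OF f, of UNIV "\<lambda>x. (x, t)", simplified])
      (auto intro!: continuous_intros)
  have meas: "(\<lambda>z. f (X z t) t) \<in> borel_measurable borel" if "0 < t" for t
    using measurable_compose[OF X_measurable sect[OF that], of t] that by simp
  have bdd: "\<exists>C. \<forall>t\<in>{a..T}. \<forall>x. \<bar>f x t\<bar> \<le> C" if "0 < a" for a T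
  proof -
    obtain r where r: "\<And>t x. t \<in> {0<..T} \<Longrightarrow> r < \<bar>x\<bar> \<Longrightarrow> f x t = 0" using supp by blast
    have "bounded ((\<lambda>(x, t). f x t) ` ({-r..r} \<times> {a..T}))"
      using \<open>0 < a\<close> by (intro compact_imp_bounded compact_continuous_image compact_Times continuous_on_subset[OF f]) auto
    then obtain C where C: "\<And>x t. x \<in> {-r..r} \<Longrightarrow> t \<in> {a..T} \<Longrightarrow> \<bar>f x t\<bar> \<le> C"
      by (force simp: bounded_iff)
    have "\<bar>f x t\<bar> \<le> max C 0" if "t \<in> {a..T}" for x t
      using C[of x t] r[of t x] that \<open>0 < a\<close>
      by (cases "r < \<bar>x\<bar>") (auto simp: not_less abs_le_iff le_max_iff_disj)
    then show ?thesis by blast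
  qed
  show "integrable unif (\<lambda>z. f (X z t) t)" if t: "0 < t"
  proof -
    obtain C where "\<forall>x. \<bar>f x t\<bar> \<le> C" using bdd[OF t, of t] by auto
    then show ?thesis using meas[OF t] by (intro unif.integrable_const_bound[of _ C]) auto
  qed
  show "continuous_on {0<..} (\<lambda>t. \<integral>z. f (X z t) t \<partial>unif)"
    unfolding continuous_on_sequentially
  proof (intro allI ballI impI)
    fix s :: "nat \<Rightarrow> real" and t assume t: "t \<in> {0<..}" and s: "(\<forall>n. s n \<in> {0<..}) \<and> s \<longlonglongrightarrow> t"
    have sp: "0 < s n" for n using s by auto
    have "\<forall>\<^sub>F n in sequentially. t / 2 < s n \<and> s n < 2 * t"
      using s t by (intro eventually_conj order_tendstoD[of s t]) auto
    \<comment> \<open>After dropping \<open>N\<close> terms all times lie in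
      \<open>[t / 2, 2 * t]\<close>, where one bound \<open>C\<close> serves for all of
      them.\<close>
    then obtain N where N: "\<And>n. N \<le> n \<Longrightarrow> t / 2 < s n" "\<And>n. N \<le> n \<Longrightarrow> s n < 2 * t"
      unfolding eventually_sequentially by blast
    obtain C where C: "\<forall>t\<in>{t/2..2*t}. \<forall>x. \<bar>f x t\<bar> \<le> C" using bdd[of "t/2" "2*t"] t by auto
    have "(\<lambda>n. \<integral>z. f (X z (s (n + N))) (s (n + N)) \<partial>unif) \<longlonglongrightarrow> (\<integral>z. f (X z t) t \<partial>unif)"
    proof (rule integral_dominated_convergence[where w = "\<lambda>_. C"])
      have "AE z in unif. continuous (at t within {0..}) (\<lambda>t. X z t)"
        using t by (intro AE_continuous_X) simp
      then show "AE z in unif. (\<lambda>n. f (X z (s (n + N))) (s (n + N))) \<longlonglongrightarrow> f (X z t) t"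
      proof eventually_elim
        case (elim z)
        have sN: "(\<lambda>n. s (n + N)) \<longlonglongrightarrow> t" using s by (auto intro: LIMSEQ_ignore_initial_segment)
        have "(\<lambda>n. X z (s (n + N))) \<longlonglongrightarrow> X z t"
          using sN sp t by (intro continuous_within_tendsto_compose'[OF elim])
            (auto intro: less_imp_le)
        then have "(\<lambda>n. (X z (s (n + N)), s (n + N))) \<longlonglongrightarrow> (X z t, t)"
          using sN by (intro tendsto_Pair)
        then have "((\<lambda>n. (\<lambda>(x, t). f x t) (X z (s (n + N)), s (n + N))) \<longlongrightarrow> (\<lambda>(x, t). f x t) (X z t, t)) sequentially"
          using sp t by (intro continuous_on_tendsto_compose[OF f]) auto
        then show ?case by simp
      qed
      show "AE z in unif. norm (f (X z (s (n + N))) (s (n + N))) \<le> C" for n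
        using C N[of "n + N"] by (intro AE_I2) (auto intro: less_imp_le)
    qed (use meas sp t in auto)
    then show "((\<lambda>t. \<integral>z. f (X z t) t \<partial>unif) \<circ> s) \<longlonglongrightarrow> (\<integral>z. f (X z t) t \<partial>unif)"
      unfolding comp_def by (rule LIMSEQ_offset)
  qed
qed

end

section \<open>Moving fronts\<close>

lemma le_of_le_add_inverse:
  fixes x y K :: real
  assumes "0 \<le> K" "\<And>R. 1 \<le> R \<Longrightarrow> x \<le> y + K / R"
  shows "x \<le> y"
proof (rule field_le_epsilon)
  fix e :: real assume "0 < e"
  have "K / max 1 (K / e) \<le> e"
    using \<open>0 < e\<close> \<open>0 \<le> K\<close> by (auto simp: divide_simps max_def mult.commute)
  then show "x \<le> y + e" using assms(2)[of "max 1 (K / e)"] by simp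
qed

text \<open>A smoothed indicator of \<open>- R \<le> x \<le> g + c * t\<close>: the left cutoff is
  at rest and climbs on \<open>[- 2 * R, - R]\<close>, the right edge has width \<open>d\<close> and
  moves with speed \<open>c\<close>. \<open>window_front\<close> and \<open>window_tail\<close> are
  the sizes of its slope at the two edges.\<close>

definition window :: "real \<Rightarrow> real \<Rightarrow> real \<Rightarrow> real \<Rightarrow> real \<Rightarrow> real \<Rightarrow> real" where
  "window R d g c x t = smoothstep (2 + x / R) * smoothstep ((g + c * t - x) / d)"

definition window_front :: "real \<Rightarrow> real \<Rightarrow> real \<Rightarrow> real \<Rightarrow> real \<Rightarrow> real \<Rightarrow> real" where
  "window_front R d g c x t = smoothstep (2 + x / R) * (smoothstep' ((g + c * t - x) / d) / d)"

definition window_tail :: "real \<Rightarrow> real \<Rightarrow> real \<Rightarrow> real \<Rightarrow> real \<Rightarrow> real \<Rightarrow> real" where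
  "window_tail R d g c x t = smoothstep' (2 + x / R) / R * smoothstep ((g + c * t - x) / d)"

lemmas window_defs = window_def window_front_def window_tail_def

lemma window_outside:
  assumes "0 < R" "0 < d" "x < - 2 * R \<or> g + c * t < x"
  shows "window R d g c x t = 0" "window_front R d g c x t = 0" "window_tail R d g c x t = 0"
proof -
  have "2 + x / R \<le> 0 \<or> (g + c * t - x) / d \<le> 0"
    using assms by (auto simp: divide_simps)
  then show "window R d g c x t = 0" "window_front R d g c x t = 0" "window_tail R d g c x t = 0"
    by (auto simp: window_defs smoothstep_0 smoothstep'_0)
qed

lemma window_support:
  assumes "0 < R" "0 < d" "0 \<le> t" "t \<le> T" "max (2 * R) (\<bar>g\<bar> + \<bar>c\<bar> * T) < \<bar>x\<bar>"
  shows "window R d g c x t = 0" "window_front R d g c x t = 0" "window_tail R d g c x t = 0"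
proof -
  have "c * t \<le> \<bar>c\<bar> * T"
    using assms(3,4) by (intro mult_mono) auto
  then have "x < - 2 * R \<or> g + c * t < x"
    using assms(5) by (cases "0 \<le> x") auto
  from window_outside[OF assms(1,2) this]
  show "window R d g c x t = 0" "window_front R d g c x t = 0" "window_tail R d g c x t = 0" .
qed

lemma window_deriv_x:
  "0 < R \<Longrightarrow> 0 < d \<Longrightarrow> ((\<lambda>x. window R d g c x t) has_real_derivative (window_tail R d g c x t - window_front R d g c x t)) (at x)"
  unfolding window_defs by (auto intro!: derivative_eq_intros simp: field_simps)

lemma window_deriv_t:
  "0 < d \<Longrightarrow> ((\<lambda>t. window R d g c x t) has_real_derivative (c * window_front R d g c x t)) (at t)"
  unfolding window_defs by (auto intro!: derivative_eq_intros simp: field_simps)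

lemma continuous_on_window:
  assumes "0 < R" "0 < d"
  shows "continuous_on S (\<lambda>(x, t). window R d g c x t)" "continuous_on S (\<lambda>(x, t). window_front R d g c x t)"
    "continuous_on S (\<lambda>(x, t). window_tail R d g c x t)"
  unfolding window_defs split_beta using assms by (intro continuous_intros; simp)+

lemma window_nonneg: "0 < R \<Longrightarrow> 0 < d \<Longrightarrow> 0 \<le> window_front R d g c x t" "0 < R \<Longrightarrow> 0 \<le> window_tail R d g c x t"
  by (auto simp: window_defs smoothstep_nonneg smoothstep'_nonneg)

lemma test_function_window:
  assumes "0 < R" "0 < d" "0 < a" "0 < h" "a + 2 * h \<le> b"
  shows "test_function (\<lambda>x t. time_bump a b h t * window R d g c x t)"
    and "deriv (\<lambda>y. time_bump a b h t * window R d g c y t) x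
      = time_bump a b h t * (window_tail R d g c x t - window_front R d g c x t)"
    and "deriv (\<lambda>s. time_bump a b h s * window R d g c x s) t
      = time_bump' a b h t * window R d g c x t + time_bump a b h t * (c * window_front R d g c x t)"
proof -
  let ?\<phi> = "\<lambda>x t. time_bump a b h t * window R d g c x t"
  have dx: "((\<lambda>y. ?\<phi> y t) has_real_derivative time_bump a b h t * (window_tail R d g c x t - window_front R d g c x t)) (at x)" for x t
    using assms by (auto intro!: derivative_eq_intros window_deriv_x)
  have dt: "((\<lambda>s. ?\<phi> x s) has_real_derivative time_bump' a b h t * window R d g c x t + time_bump a b h t * (c * window_front R d g c x t)) (at t)" for x t
    using DERIV_mult[OF time_bump_deriv[OF assms(4)] window_deriv_t[OF assms(2)]] by (simp add: ac_simps)
  show dx': "deriv (\<lambda>y. ?\<phi> y t) x = time_bump a b h t * (window_tail R d g c x t - window_front R d g c x t)" for x t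
    by (rule DERIV_imp_deriv[OF dx])
  show dt': "deriv (\<lambda>s. ?\<phi> x s) t = time_bump' a b h t * window R d g c x t + time_bump a b h t * (c * window_front R d g c x t)" for x t
    by (rule DERIV_imp_deriv[OF dt])
  define r where "r = max (2 * R) (\<bar>g\<bar> + \<bar>c\<bar> * b)"
  have cont: "continuous_on UNIV (\<lambda>(x, t). time_bump a b h t * (window_tail R d g c x t - window_front R d g c x t))"
    "continuous_on UNIV (\<lambda>(x, t). time_bump' a b h t * window R d g c x t + time_bump a b h t * (c * window_front R d g c x t))"
    using assms continuous_on_window[OF assms(1,2), unfolded split_beta]
      continuous_on_time_bump[OF assms(4), of UNIV, THEN continuous_on_compose2[of _ _ UNIV snd], OF continuous_on_snd[OF continuous_on_id]]
    unfolding split_beta by (auto intro!: continuous_intros)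
  have "?\<phi> x t = 0" if "(x, t) \<notin> {-r..r} \<times> {a..b}" for x t
  proof (cases "t \<in> {a..b}")
    case True
    then have "r < \<bar>x\<bar>" using that by auto
    then show ?thesis using True assms window_support(1)[of R d t b g c x] by (simp add: r_def)
  next
    case False
    then show ?thesis using time_bump_outside(1)[OF assms(4,5), of t] by auto
  qed
  then show "test_function ?\<phi>"
    unfolding test_function_def dx' dt' real_differentiable_def using cont dx dt \<open>0 < a\<close>
    by (intro conjI exI[of _ "{-r..r} \<times> {a..b}"] allI compact_Times compact_Icc) (auto, blast+)
qed

section \<open>Transport of mass across fronts and the ODE for quantiles\<close>

context weak_solution
begin

text \<open>Along the velocity field \<open>w\<close> the window changes at the rate
  \<open>(c - w) * window_front + w * window_tail\<close>. Testing the equation with the window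
  times a bump in time says that \<open>B\<close> is the distributional derivative of
  \<open>A\<close>.\<close>

lemma front_identity:
  fixes R d g c t1 t2 :: real
  assumes Rd: "0 < R" "0 < d" and ab: "0 < t1" "t1 < t2"
  defines "A \<equiv> \<lambda>t. \<integral>z. window R d g c (X z t) t \<partial>unif"
    and "B \<equiv> \<lambda>t. (\<integral>z. (c - w (X z t) t) * window_front R d g c (X z t) t + w (X z t) t * window_tail R d g c (X z t) t \<partial>unif)"
  shows "A t2 - A t1 = integral {t1..t2} B" "continuous_on {0<..} B"
    and "\<And>t. 0 < t \<Longrightarrow> integrable unif (\<lambda>z. window R d g c (X z t) t)"
proof -
  have sup: "\<exists>r. \<forall>t\<in>{0<..T}. \<forall>x. r < \<bar>x\<bar> \<longrightarrow> window R d g c x t = 0 \<and> window_front R d g c x t = 0 \<and> window_tail R d g c x t = 0" for T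
    using window_support[OF Rd, of _ T g c] by (intro exI[of _ "max (2 * R) (\<bar>g\<bar> + \<bar>c\<bar> * T)"]) auto
  note cw = continuous_on_window[OF Rd, of "UNIV \<times> {0<..}"]
  let ?ft = "\<lambda>x t. c * window_front R d g c x t"
  let ?fx = "\<lambda>x t. w x t * (window_tail R d g c x t - window_front R d g c x t)"
  have c0: "continuous_on (UNIV \<times> {0<..}) (\<lambda>(x, t). window R d g c x t)"
    and c1: "continuous_on (UNIV \<times> {0<..}) (\<lambda>(x, t). ?ft x t)"
    and c2: "continuous_on (UNIV \<times> {0<..}) (\<lambda>(x, t). ?fx x t)"
    using cw[of g c] continuous_on_w unfolding split_beta by (auto intro!: continuous_intros)
  have s0: "\<exists>r. \<forall>t\<in>{0<..T}. \<forall>x. r < \<bar>x\<bar> \<longrightarrow> window R d g c x t = 0"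
    and s1: "\<exists>r. \<forall>t\<in>{0<..T}. \<forall>x. r < \<bar>x\<bar> \<longrightarrow> ?ft x t = 0"
    and s2: "\<exists>r. \<forall>t\<in>{0<..T}. \<forall>x. r < \<bar>x\<bar> \<longrightarrow> ?fx x t = 0" for T
    using sup[of T] by (auto; metis)+
  show "\<And>t. 0 < t \<Longrightarrow> integrable unif (\<lambda>z. window R d g c (X z t) t)"
    by (rule integrable_along[OF c0 s0])
  note i0 = integrable_along[OF c0 s0] and i1 = integrable_along[OF c1 s1] and i2 = integrable_along[OF c2 s2]
  define A1 A2 where "A1 t = (\<integral>z. ?ft (X z t) t \<partial>unif)" and "A2 t = (\<integral>z. ?fx (X z t) t \<partial>unif)" for t
  have cA: "continuous_on {0<..} A" unfolding A_def by (rule continuous_on_along[OF c0 s0])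
  have cA1: "continuous_on {0<..} A1" unfolding A1_def by (rule continuous_on_along[OF c1 s1])
  have cA2: "continuous_on {0<..} A2" unfolding A2_def by (rule continuous_on_along[OF c2 s2])
  have B: "B t = A1 t + A2 t" if "0 < t" for t
    unfolding A1_def A2_def using i1[OF that] i2[OF that]
    by (subst Bochner_Integration.integral_add[symmetric]) (auto simp: B_def algebra_simps)
  show cB: "continuous_on {0<..} B"
    using continuous_on_add[OF cA1 cA2] by (rule continuous_on_eq) (simp add: B)
  have sub: "{t1..t2} \<subseteq> {0<..}" using ab by auto
  show "A t2 - A t1 = integral {t1..t2} B"
  proof (rule weak_derivative_increment[OF ab])
    show "continuous_on {t1..t2} A" "continuous_on {t1..t2} B"
      using cA cB sub by (auto intro: continuous_on_subset)
    fix h assume h: "0 < h" "t1 + 2 * h \<le> t2"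
    note T = test_function_window[OF Rd ab(1) h]
    let ?\<phi> = "\<lambda>x t. time_bump t1 t2 h t * window R d g c x t"
    have weak: "(LBINT t:{0<..}. (\<integral>x. deriv (\<lambda>s. ?\<phi> x s) t \<partial>rho t))
          + (LBINT t:{0<..}. (\<integral>x. v (conv_measure V (rho t) x) * deriv (\<lambda>y. ?\<phi> y t) x \<partial>rho t)) = 0"
      using sol T(1)[of g c] unfolding dissipative_measure_solution_def by blast
    have sect: "(\<lambda>x. f x t) \<in> borel_measurable borel"
      if "continuous_on (UNIV \<times> {0<..}) (\<lambda>(x, t). f x t)" "0 < t" for t and f :: "real \<Rightarrow> real \<Rightarrow> real"
      using that(2) by (intro borel_measurable_continuous_onI continuous_on_compose2[OF that(1), of UNIV "\<lambda>x. (x, t)", simplified])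
        (auto intro!: continuous_intros)
    have I1: "(\<integral>x. deriv (\<lambda>s. ?\<phi> x s) t \<partial>rho t) = time_bump' t1 t2 h t * A t + time_bump t1 t2 h t * A1 t" if "0 < t" for t
    proof -
      note [measurable] = sect[OF c0 that] sect[OF c1 that]
      have "(\<integral>x. deriv (\<lambda>s. ?\<phi> x s) t \<partial>rho t)
          = (\<integral>z. time_bump' t1 t2 h t * window R d g c (X z t) t + time_bump t1 t2 h t * ?ft (X z t) t \<partial>unif)"
        unfolding T(3) using that by (subst integral_quantile[OF rho_distribution]) auto
      also have "\<dots> = time_bump' t1 t2 h t * A t + time_bump t1 t2 h t * A1 t"
        unfolding A_def A1_def using i0[OF that] i1[OF that]
        by (subst Bochner_Integration.integral_add) (auto simp del: mult_eq_0_iff)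
      finally show ?thesis .
    qed
    have I2: "(\<integral>x. v (conv_measure V (rho t) x) * deriv (\<lambda>y. ?\<phi> y t) x \<partial>rho t) = time_bump t1 t2 h t * A2 t" if "0 < t" for t
    proof -
      note [measurable] = sect[OF c2 that]
      have "(\<integral>x. v (conv_measure V (rho t) x) * deriv (\<lambda>y. ?\<phi> y t) x \<partial>rho t)
          = (\<integral>x. time_bump t1 t2 h t * ?fx x t \<partial>rho t)"
        unfolding T(2) w_def by (intro Bochner_Integration.integral_cong) (auto simp: ac_simps)
      also have "\<dots> = (\<integral>z. time_bump t1 t2 h t * ?fx (X z t) t \<partial>unif)"
        using that by (subst integral_quantile[OF rho_distribution]) auto
      also have "\<dots> = time_bump t1 t2 h t * A2 t"
        unfolding A2_def by simp
      finally show ?thesis .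
    qed
    have "(LBINT t:{0<..}. (\<integral>x. deriv (\<lambda>s. ?\<phi> x s) t \<partial>rho t)) = (LBINT t:{0<..}. time_bump' t1 t2 h t * A t + time_bump t1 t2 h t * A1 t)"
      using I1 by (intro set_lebesgue_integral_cong) auto
    also have "\<dots> = integral {t1..t2} (\<lambda>t. time_bump' t1 t2 h t * A t + time_bump t1 t2 h t * A1 t)"
      using time_bump_outside[OF h] ab sub
      by (intro set_integral_supported continuous_intros continuous_on_time_bump h
          continuous_on_subset[OF cA] continuous_on_subset[OF cA1]) auto
    also have "\<dots> = integral {t1..t2} (\<lambda>t. time_bump' t1 t2 h t * A t) + integral {t1..t2} (\<lambda>t. time_bump t1 t2 h t * A1 t)"
      using sub by (intro integral_add integrable_continuous_real continuous_intros continuous_on_time_bump h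
          continuous_on_subset[OF cA] continuous_on_subset[OF cA1]) auto
    finally have L1: "(LBINT t:{0<..}. (\<integral>x. deriv (\<lambda>s. ?\<phi> x s) t \<partial>rho t))
      = integral {t1..t2} (\<lambda>t. time_bump' t1 t2 h t * A t) + integral {t1..t2} (\<lambda>t. time_bump t1 t2 h t * A1 t)" .
    have "(LBINT t:{0<..}. (\<integral>x. v (conv_measure V (rho t) x) * deriv (\<lambda>y. ?\<phi> y t) x \<partial>rho t)) = (LBINT t:{0<..}. time_bump t1 t2 h t * A2 t)"
      using I2 by (intro set_lebesgue_integral_cong) auto
    also have "\<dots> = integral {t1..t2} (\<lambda>t. time_bump t1 t2 h t * A2 t)"
      using time_bump_outside[OF h] ab sub
      by (intro set_integral_supported continuous_intros continuous_on_time_bump h continuous_on_subset[OF cA2]) auto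
    finally have L2: "(LBINT t:{0<..}. (\<integral>x. v (conv_measure V (rho t) x) * deriv (\<lambda>y. ?\<phi> y t) x \<partial>rho t))
      = integral {t1..t2} (\<lambda>t. time_bump t1 t2 h t * A2 t)" .
    have "integral {t1..t2} (\<lambda>t. time_bump t1 t2 h t * B t) = integral {t1..t2} (\<lambda>t. time_bump t1 t2 h t * A1 t + time_bump t1 t2 h t * A2 t)"
      using sub by (intro integral_cong) (auto simp: B distrib_left subset_eq)
    also have "\<dots> = integral {t1..t2} (\<lambda>t. time_bump t1 t2 h t * A1 t) + integral {t1..t2} (\<lambda>t. time_bump t1 t2 h t * A2 t)"
      using sub by (intro integral_add integrable_continuous_real continuous_intros continuous_on_time_bump h
          continuous_on_subset[OF cA1] continuous_on_subset[OF cA2]) auto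
    finally show "integral {t1..t2} (\<lambda>t. time_bump' t1 t2 h t * A t) + integral {t1..t2} (\<lambda>t. time_bump t1 t2 h t * B t) = 0"
      using weak L1 L2 by simp
  qed
qed

text \<open>On the support of the cutoff slope \<open>\<bar>x\<bar>\<close> is between
  \<open>R\<close> and \<open>2 * R\<close>, so the linear growth of \<open>w\<close> cancels the
  slope \<open>1 / R\<close>. The factor \<open>\<bar>x\<bar> / R \<ge> 1\<close> is inserted so
  that integration over labels produces \<open>m t / R\<close>.\<close>

lemma tail_estimate:
  assumes t: "0 < t" and R: "1 \<le> R" and d: "0 < d"
  defines "W \<equiv> \<bar>v 0\<bar> + Lv * (2 * lam + LU)"
  shows "\<bar>w x t * window_tail R d g c x t\<bar> \<le> 3 / 2 * W * (3 + m t) * (\<bar>x\<bar> / R)"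
proof (cases "- 2 * R \<le> x \<and> x \<le> - R")
  case True
  have W: "0 \<le> W" unfolding W_def using Lv_nonneg LU_nonneg lam_pos by simp
  have m0: "0 \<le> m t" by (simp add: m_def)
  have "\<bar>w x t\<bar> \<le> W * (1 + \<bar>x\<bar> + m t)" unfolding W_def by (rule abs_w_le[OF t])
  also have "\<dots> \<le> W * ((3 + m t) * R)"
  proof (rule mult_left_mono[OF _ W])
    have "m t * 1 \<le> m t * R" using R m0 by (intro mult_left_mono) auto
    moreover have "\<bar>x\<bar> \<le> 2 * R" using True R by auto
    ultimately show "1 + \<bar>x\<bar> + m t \<le> (3 + m t) * R" using R by (simp add: algebra_simps)
  qed
  finally have w: "\<bar>w x t\<bar> \<le> W * ((3 + m t) * R)" .
  have "window_tail R d g c x t \<le> (3 / 2) / R * 1"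
    unfolding window_tail_def using R
    by (intro mult_mono divide_right_mono smoothstep'_le smoothstep_le_1 smoothstep_nonneg) auto
  then have "\<bar>w x t * window_tail R d g c x t\<bar> \<le> (W * ((3 + m t) * R)) * ((3 / 2) / R * 1)"
    unfolding abs_mult using w window_nonneg(2)[of R d g c x t] R W m0
    by (intro mult_mono) auto
  also have "\<dots> = 3 / 2 * W * (3 + m t) * 1" using R by simp
  also have "\<dots> \<le> 3 / 2 * W * (3 + m t) * (\<bar>x\<bar> / R)"
    using True R W m0 by (intro mult_left_mono) (auto simp: divide_simps)
  finally show ?thesis .
next
  case False
  have "0 \<le> W" unfolding W_def using Lv_nonneg LU_nonneg lam_pos by simp
  moreover have "0 \<le> m t" by (simp add: m_def)
  moreover have "smoothstep' (2 + x / R) = 0"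
    using False R by (intro smoothstep'_0) (auto simp: field_simps)
  ultimately show ?thesis using R by (simp add: window_tail_def)
qed

text \<open>The window equals 1 between \<open>- R\<close> and \<open>g + c * t - d\<close> and is 0
  beyond the front. The mass to the left of \<open>- R\<close> is estimated by Markov's
  inequality.\<close>

lemma front_mass:
  assumes t: "0 < t" and R: "0 < R" and d: "0 < d"
    and int: "integrable unif (\<lambda>z. window R d g c (X z t) t)"
  shows "cdf (rho t) (g + c * t - d) - m t / R \<le> (\<integral>z. window R d g c (X z t) t \<partial>unif)"
    and "(\<integral>z. window R d g c (X z t) t \<partial>unif) \<le> cdf (rho t) (g + c * t)"
proof -
  have [measurable]: "quantile (rho t) \<in> borel_measurable borel" using t by (intro X_measurable) simp
  have ind: "integrable unif (indicator {z. X z t \<le> y} :: real \<Rightarrow> real)" for y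
    by (intro integrable_real_indicator) (auto simp: unif.emeasure_eq_measure)
  have F: "cdf (rho t) y = (\<integral>z. indicator {z. X z t \<le> y} z \<partial>unif)" for y
    using cdf_quantile[OF rho_distribution, of t y] t by simp
  have "measure unif {z \<in> space unif. R \<le> \<bar>X z t\<bar>} \<le> m t / R"
    unfolding m_def using X_int[of t] t R by (intro integral_Markov_inequality_measure[of _ _ "{}"]) auto
  moreover have "measure unif {z. X z t \<le> - R} \<le> measure unif {z \<in> space unif. R \<le> \<bar>X z t\<bar>}"
    by (intro unif.finite_measure_mono) auto
  ultimately have tail: "cdf (rho t) (- R) \<le> m t / R"
    using cdf_quantile[OF rho_distribution, of t "- R"] t by simp
  have "(\<integral>z. indicator {z. X z t \<le> g + c * t - d} z - indicator {z. X z t \<le> - R} z \<partial>unif)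
      \<le> (\<integral>z. window R d g c (X z t) t \<partial>unif)"
  proof (rule integral_mono[OF Bochner_Integration.integrable_diff[OF ind ind] int])
    fix z
    have "0 \<le> window R d g c (X z t) t" by (simp add: window_def smoothstep_nonneg)
    moreover have "window R d g c (X z t) t = 1" if "X z t \<le> g + c * t - d" "- R < X z t"
      using that R d by (auto simp: window_def smoothstep_1 field_simps)
    ultimately show "indicator {z. X z t \<le> g + c * t - d} z - indicator {z. X z t \<le> - R} z \<le> window R d g c (X z t) t"
      by (auto simp: indicator_def not_le)
  qed
  also have "(\<integral>z. indicator {z. X z t \<le> g + c * t - d} z - indicator {z. X z t \<le> - R} z \<partial>unif)
      = cdf (rho t) (g + c * t - d) - cdf (rho t) (- R)"
    unfolding F by (rule Bochner_Integration.integral_diff[OF ind ind])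
  finally show "cdf (rho t) (g + c * t - d) - m t / R \<le> (\<integral>z. window R d g c (X z t) t \<partial>unif)"
    using tail by simp
  show "(\<integral>z. window R d g c (X z t) t \<partial>unif) \<le> cdf (rho t) (g + c * t)"
    unfolding F
  proof (rule integral_mono[OF int ind])
    fix z
    have "window R d g c (X z t) t \<le> 1 * 1"
      unfolding window_def by (intro mult_mono smoothstep_le_1 smoothstep_nonneg) auto
    then show "window R d g c (X z t) t \<le> indicator {z. X z t \<le> g + c * t} z"
      using window_outside(1)[OF R d, of "X z t" g c t] by (auto simp: indicator_def not_le)
  qed
qed

lemma front_flux_sign:
  assumes t: "0 < t" and R: "1 \<le> R" and d: "0 < d" and s: "\<bar>s\<bar> = (1::real)"
    and w: "\<And>x. g + c * t - d \<le> x \<Longrightarrow> x \<le> g + c * t \<Longrightarrow> 0 \<le> s * (c - w x t)"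
  shows "- (3 / 2 * (\<bar>v 0\<bar> + Lv * (2 * lam + LU)) * (3 + m t) * m t / R)
    \<le> s * (\<integral>z. (c - w (X z t) t) * window_front R d g c (X z t) t + w (X z t) t * window_tail R d g c (X z t) t \<partial>unif)"
    (is "- (?C * m t / R) \<le> s * integral\<^sup>L unif ?f")
proof -
  have m0: "0 \<le> m t" by (simp add: m_def)
  have C: "0 \<le> ?C" using m0 Lv_nonneg LU_nonneg lam_pos by simp
  show ?thesis
  proof (cases "integrable unif ?f")
    case True
    have "(\<integral>z. - (?C * (\<bar>X z t\<bar> / R)) \<partial>unif) \<le> (\<integral>z. s * ?f z \<partial>unif)"
    proof (rule integral_mono)
      show "integrable unif (\<lambda>z. - (?C * (\<bar>X z t\<bar> / R)))" using X_int[of t] t by auto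
      show "integrable unif (\<lambda>z. s * ?f z)" using True by (rule integrable_mult_right)
      fix z
      let ?x = "X z t"
      have "0 \<le> s * ((c - w ?x t) * window_front R d g c ?x t)"
      proof (cases "g + c * t - d \<le> ?x \<and> ?x \<le> g + c * t")
        case True
        then show ?thesis using w[of ?x] window_nonneg(1)[of R d g c ?x t] R d by (simp flip: mult.assoc)
      next
        case False
        then have "smoothstep' ((g + c * t - ?x) / d) = 0"
          using d by (intro smoothstep'_0) (auto simp: field_simps)
        then show ?thesis by (simp add: window_front_def)
      qed
      moreover have "\<bar>s * (w ?x t * window_tail R d g c ?x t)\<bar> \<le> ?C * (\<bar>?x\<bar> / R)"
        using tail_estimate[OF t R d, of ?x g c] s by (simp add: abs_mult)
      ultimately show "- (?C * (\<bar>?x\<bar> / R)) \<le> s * ?f z" by (simp add: distrib_left)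
    qed
    moreover have "(\<integral>z. - (?C * (\<bar>X z t\<bar> / R)) \<partial>unif) = - (?C * ((\<integral>z. \<bar>X z t\<bar> \<partial>unif) / R))"
      by simp
    moreover have "(\<integral>z. s * ?f z \<partial>unif) = s * integral\<^sup>L unif ?f"
      by (rule integral_mult_right_zero)
    ultimately show ?thesis by (simp only: m_def[symmetric] times_divide_eq_right)
  next
    case False
    \<comment> \<open>The integral of a non-integrable function is 0 by convention, and the left
      side of the claim is nonpositive.\<close>
    then have "integral\<^sup>L unif ?f = 0" by (rule not_integrable_integral_eq)
    then show ?thesis using C m0 R by simp
  qed
qed

text \<open>The sign \<open>s\<close> selects between a field at most \<open>c\<close> on the front
  (mass to its left grows) and one at least \<open>c\<close> (it shrinks). The flux bound is
  integrated in time and \<open>R\<close> tends to infinity; only the front width \<open>d\<close>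
  remains as a loss.\<close>

lemma front_transport:
  assumes t: "0 < t1" "t1 < t2" and d: "0 < d" and s: "\<bar>s\<bar> = (1::real)"
    and w: "\<And>x t. t1 \<le> t \<Longrightarrow> t \<le> t2 \<Longrightarrow> g + c * t - d \<le> x \<Longrightarrow> x \<le> g + c * t \<Longrightarrow> 0 \<le> s * (c - w x t)"
  shows "s = 1 \<Longrightarrow> cdf (rho t1) (g + c * t1 - d) \<le> cdf (rho t2) (g + c * t2)"
    and "s = - 1 \<Longrightarrow> cdf (rho t2) (g + c * t2 - d) \<le> cdf (rho t1) (g + c * t1)"
proof -
  obtain M where M: "0 \<le> M" "\<And>t. 0 \<le> t \<Longrightarrow> t \<le> t2 \<Longrightarrow> m t \<le> M" using m_bounded by blast
  define C where "C = 3 / 2 * (\<bar>v 0\<bar> + Lv * (2 * lam + LU)) * (3 + M) * M"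
  have W0: "0 \<le> 3 / 2 * (\<bar>v 0\<bar> + Lv * (2 * lam + LU))"
    using Lv_nonneg LU_nonneg lam_pos by simp
  then have C0: "0 \<le> C" unfolding C_def using M by simp
  define A where "A R t = (\<integral>z. window R d g c (X z t) t \<partial>unif)" for R t
  have inc: "- (C / R * (t2 - t1)) \<le> s * (A R t2 - A R t1)" if R: "1 \<le> R" for R
  proof -
    have R0: "0 < R" using R by simp
    let ?B = "\<lambda>t. \<integral>z. (c - w (X z t) t) * window_front R d g c (X z t) t + w (X z t) t * window_tail R d g c (X z t) t \<partial>unif"
    note I = front_identity[OF R0 d t, where g = g and c = c]
    have cB: "continuous_on {t1..t2} ?B" using t by (intro continuous_on_subset[OF I(2)]) auto
    have "- (C / R) \<le> s * ?B t" if "t \<in> {t1..t2}" for t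
    proof -
      have mt: "0 \<le> m t" "m t \<le> M" using M(2)[of t] that t by (auto simp: m_def)
      have "3 / 2 * (\<bar>v 0\<bar> + Lv * (2 * lam + LU)) * (3 + m t) * m t / R \<le> C / R"
        unfolding C_def using mt W0 M(1) R by (intro divide_right_mono mult_mono mult_nonneg_nonneg) auto
      then show ?thesis
        using front_flux_sign[OF _ R d s, of t g c] w[of t] that t by fastforce
    qed
    then have "integral {t1..t2} (\<lambda>t. - (C / R)) \<le> integral {t1..t2} (\<lambda>t. s * ?B t)"
      by (intro integral_le integrable_continuous_real continuous_intros cB) auto
    also have "\<dots> = s * (A R t2 - A R t1)" using I(1) by (simp add: A_def)
    finally show ?thesis using t by (simp add: mult.commute)
  qed
  have mass: "cdf (rho t) (g + c * t - d) - M / R \<le> A R t" "A R t \<le> cdf (rho t) (g + c * t)"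
    if "1 \<le> R" "t1 \<le> t" "t \<le> t2" for R t
  proof -
    have pos: "0 < R" "0 < t" using that t by auto
    have "m t / R \<le> M / R" using M(2)[of t] pos that by (intro divide_right_mono) auto
    then show "cdf (rho t) (g + c * t - d) - M / R \<le> A R t" "A R t \<le> cdf (rho t) (g + c * t)"
      using front_mass[OF pos(2,1) d front_identity(3)[OF pos(1) d t pos(2), where g = g and c = c]] by (auto simp: A_def)
  qed
  let ?K = "M + C * (t2 - t1)"
  have K: "0 \<le> ?K" using M C0 t by simp
  show "cdf (rho t1) (g + c * t1 - d) \<le> cdf (rho t2) (g + c * t2)" if "s = 1"
  proof (rule le_of_le_add_inverse[OF K])
    fix R :: real assume R: "1 \<le> R"
    show "cdf (rho t1) (g + c * t1 - d) \<le> cdf (rho t2) (g + c * t2) + ?K / R"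
      using inc[OF R] mass[OF R, of t1] mass[OF R, of t2] t that by (simp add: add_divide_distrib)
  qed
  show "cdf (rho t2) (g + c * t2 - d) \<le> cdf (rho t1) (g + c * t1)" if "s = - 1"
  proof (rule le_of_le_add_inverse[OF K])
    fix R :: real assume R: "1 \<le> R"
    show "cdf (rho t2) (g + c * t2 - d) \<le> cdf (rho t1) (g + c * t1) + ?K / R"
      using inc[OF R] mass[OF R, of t1] mass[OF R, of t2] t that by (simp add: add_divide_distrib)
  qed
qed

text \<open>Near \<open>(x0, t0)\<close> the velocity is within \<open>e\<close> of
  \<open>w0\<close>. Fronts of speed \<open>w0 + e\<close> and \<open>w0 - e\<close> passing within
  a distance \<open>y\<close> of \<open>x0\<close> trap the quantile, and \<open>y\<close> tends to
  0.\<close>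

lemma X_increment:
  assumes z: "0 < z" "z < 1" and t0: "0 < t0" and e: "0 < e"
  shows "\<exists>r>0. \<forall>t. \<bar>t - t0\<bar> < r \<longrightarrow> \<bar>X z t - X z t0 - w (X z t0) t0 * (t - t0)\<bar> \<le> e * \<bar>t - t0\<bar>"
proof -
  define x0 w0 where "x0 = X z t0" and "w0 = w (X z t0) t0"
  obtain q where q: "0 < q" "\<And>x t. 0 < t \<Longrightarrow> dist (x, t) (x0, t0) < q \<Longrightarrow> dist (w x t) w0 < e"
    using continuous_on_w[unfolded continuous_on_iff, rule_format, of "(x0, t0)" e] t0 e
    by (auto simp: x0_def w0_def)
  \<comment> \<open>\<open>k\<close> bounds both front speeds, so within time \<open>r\<close> a
    front moves by at most \<open>q / 8\<close> and its strip stays where the velocity is close to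
    \<open>w0\<close>.\<close>
  define k where "k = 1 + \<bar>w0\<bar> + e"
  have k: "1 \<le> k" using e by (simp add: k_def)
  define r where "r = min t0 (q / (8 * k))"
  have r: "0 < r" "r \<le> t0" "k * r \<le> q / 8" using t0 q k by (auto simp: r_def min_def field_simps)
  have wq: "w0 - e \<le> w x t \<and> w x t \<le> w0 + e"
    if "\<bar>x - x0\<bar> < q / 2" "\<bar>t - t0\<bar> < q / 2" "0 < t" for x t
  proof -
    have "dist (x, t) (x0, t0) \<le> \<bar>x - x0\<bar> + \<bar>t - t0\<bar>"
      using sqrt_sum_squares_le_sum_abs[of "x - x0" "t - t0"] by (simp add: dist_Pair_Pair dist_real_def)
    then have "dist (x, t) (x0, t0) < q" using that by linarith
    then have "\<bar>w x t - w0\<bar> < e" using q(2)[OF that(3)] by (simp add: dist_real_def)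
    then show ?thesis by linarith
  qed
  have "1 * r \<le> k * r" using k r(1) by (intro mult_right_mono) auto
  then have rq: "r \<le> q / 8" using r(3) by linarith
  have line: "w0 - e \<le> w x s \<and> w x s \<le> w0 + e"
    if "\<bar>c\<bar> \<le> k" "\<bar>s - t0\<bar> < r" "\<bar>y - x0\<bar> \<le> q / 8" "y + c * (s - t0) - q / 8 \<le> x" "x \<le> y + c * (s - t0)" for c s x y
  proof -
    have "\<bar>c * (s - t0)\<bar> \<le> k * r" unfolding abs_mult using that k by (intro mult_mono) auto
    then have "\<bar>c * (s - t0)\<bar> \<le> q / 8" using r by simp
    then have "\<bar>x - x0\<bar> < q / 2" using that q(1) by linarith
    moreover have "\<bar>s - t0\<bar> < q / 2" using that rq q(1) by linarith
    moreover have "0 < s" using that r by linarith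
    ultimately show ?thesis by (rule wq)
  qed
  have ck: "\<bar>w0 + e\<bar> \<le> k" "\<bar>w0 - e\<bar> \<le> k" using e by (auto simp: k_def)
  have zF: "z \<le> cdf (rho t0) x0" using z t0 by (simp add: le_cdf_X x0_def)
  have zF': "cdf (rho t0) (x0 - y) < z" if "0 < y" for y
    using le_cdf_X[of t0 z "x0 - y"] z t0 that by (simp add: x0_def not_le[symmetric])
  have "\<bar>X z t - x0 - w0 * (t - t0)\<bar> \<le> e * \<bar>t - t0\<bar>" if t: "\<bar>t - t0\<bar> < r" for t
  proof -
    have tpos: "0 < t" using t r by linarith
    have up: "X z t \<le> x0 + w0 * (t - t0) + e * \<bar>t - t0\<bar> + 2 * y"
      and lo: "x0 + w0 * (t - t0) - e * \<bar>t - t0\<bar> - 2 * y \<le> X z t" if y: "0 < y" "y < q / 8" for y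
    proof -
      consider "t = t0" | "t0 < t" | "t < t0" by linarith
      then show "X z t \<le> x0 + w0 * (t - t0) + e * \<bar>t - t0\<bar> + 2 * y"
      proof cases
        case 2
        have "cdf (rho t0) ((x0 + y - (w0 + e) * t0) + (w0 + e) * t0 - y) \<le> cdf (rho t) ((x0 + y - (w0 + e) * t0) + (w0 + e) * t)"
        proof (rule front_transport(1)[OF t0 2 y(1), of 1])
          fix x s assume s: "t0 \<le> s" "s \<le> t" "x0 + y - (w0 + e) * t0 + (w0 + e) * s - y \<le> x"
            "x \<le> x0 + y - (w0 + e) * t0 + (w0 + e) * s"
          then show "0 \<le> 1 * (w0 + e - w x s)"
            using line[OF ck(1), of s "x0 + y" x] t y by (simp add: algebra_simps)
        qed simp_all
        then have "z \<le> cdf (rho t) (x0 + y + (w0 + e) * (t - t0))" using zF by (simp add: algebra_simps)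
        then have "X z t \<le> x0 + y + (w0 + e) * (t - t0)" using tpos z by (simp add: le_cdf_X)
        then show ?thesis using 2 y by (simp add: algebra_simps)
      next
        \<comment> \<open>For \<open>t < t0\<close> the transport runs forward from \<open>t\<close>
          to \<open>t0\<close>, so the upper bound on the earlier quantile comes from the slower
          front.\<close>
        case 3
        have "cdf (rho t0) ((x0 + y - (w0 - e) * t0) + (w0 - e) * t0 - y) \<le> cdf (rho t) ((x0 + y - (w0 - e) * t0) + (w0 - e) * t)"
        proof (rule front_transport(2)[OF tpos 3 y(1), of "- 1"])
          fix x s assume s: "t \<le> s" "s \<le> t0" "x0 + y - (w0 - e) * t0 + (w0 - e) * s - y \<le> x"
            "x \<le> x0 + y - (w0 - e) * t0 + (w0 - e) * s"
          then show "0 \<le> - 1 * (w0 - e - w x s)"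
            using line[OF ck(2), of s "x0 + y" x] t y by (simp add: algebra_simps)
        qed simp_all
        then have "z \<le> cdf (rho t) (x0 + y + (w0 - e) * (t - t0))" using zF by (simp add: algebra_simps)
        then have "X z t \<le> x0 + y + (w0 - e) * (t - t0)" using tpos z by (simp add: le_cdf_X)
        then show ?thesis using 3 y by (simp add: algebra_simps)
      qed (use y in \<open>simp add: x0_def\<close>)
      consider "t = t0" | "t0 < t" | "t < t0" by linarith
      then show "x0 + w0 * (t - t0) - e * \<bar>t - t0\<bar> - 2 * y \<le> X z t"
      proof cases
        case 2
        have "cdf (rho t) ((x0 - y - (w0 - e) * t0) + (w0 - e) * t - y) \<le> cdf (rho t0) ((x0 - y - (w0 - e) * t0) + (w0 - e) * t0)"
        proof (rule front_transport(2)[OF t0 2 y(1), of "- 1"])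
          fix x s assume s: "t0 \<le> s" "s \<le> t" "x0 - y - (w0 - e) * t0 + (w0 - e) * s - y \<le> x"
            "x \<le> x0 - y - (w0 - e) * t0 + (w0 - e) * s"
          then show "0 \<le> - 1 * (w0 - e - w x s)"
            using line[OF ck(2), of s "x0 - y" x] t y by (simp add: algebra_simps)
        qed simp_all
        then have "cdf (rho t) (x0 + (w0 - e) * (t - t0) - 2 * y) < z" using zF'[OF y(1)] by (simp add: algebra_simps)
        then have "x0 + (w0 - e) * (t - t0) - 2 * y < X z t"
          using le_cdf_X[of t z] tpos z by (meson less_imp_le not_le)
        then show ?thesis using 2 by (simp add: algebra_simps)
      next
        case 3
        have "cdf (rho t) ((x0 - y - (w0 + e) * t0) + (w0 + e) * t - y) \<le> cdf (rho t0) ((x0 - y - (w0 + e) * t0) + (w0 + e) * t0)"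
        proof (rule front_transport(1)[OF tpos 3 y(1), of 1])
          fix x s assume s: "t \<le> s" "s \<le> t0" "x0 - y - (w0 + e) * t0 + (w0 + e) * s - y \<le> x"
            "x \<le> x0 - y - (w0 + e) * t0 + (w0 + e) * s"
          then show "0 \<le> 1 * (w0 + e - w x s)"
            using line[OF ck(1), of s "x0 - y" x] t y by (simp add: algebra_simps)
        qed simp_all
        then have "cdf (rho t) (x0 + (w0 + e) * (t - t0) - 2 * y) < z" using zF'[OF y(1)] by (simp add: algebra_simps)
        then have "x0 + (w0 + e) * (t - t0) - 2 * y < X z t"
          using le_cdf_X[of t z] tpos z by (meson less_imp_le not_le)
        then show ?thesis using 3 by (simp add: algebra_simps)
      qed (use y in \<open>simp add: x0_def\<close>)
    qed
    have "\<bar>X z t - x0 - w0 * (t - t0)\<bar> \<le> e * \<bar>t - t0\<bar> + y" if "0 < y" for y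
    proof -
      define y' where "y' = min (y / 2) (q / 16)"
      have "0 < y'" "y' < q / 8" "2 * y' \<le> y" using that q(1) by (auto simp: y'_def)
      then show ?thesis using up[of y'] lo[of y'] by linarith
    qed
    then show ?thesis by (rule field_le_epsilon)
  qed
  then show ?thesis using r(1) by (auto simp: x0_def w0_def)
qed

lemma X_deriv_w:
  assumes "0 < z" "z < 1" "0 < t"
  shows "((\<lambda>s. X z s) has_real_derivative w (X z t) t) (at t)"
  unfolding has_field_derivative_iff LIM_eq
proof (intro allI impI)
  fix e :: real assume e: "0 < e"
  obtain r where r: "0 < r" "\<And>s. \<bar>s - t\<bar> < r \<Longrightarrow> \<bar>X z s - X z t - w (X z t) t * (s - t)\<bar> \<le> e / 2 * \<bar>s - t\<bar>"
    using X_increment[OF assms, of "e / 2"] e by auto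
  show "\<exists>r>0. \<forall>s. s \<noteq> t \<and> norm (s - t) < r \<longrightarrow> norm ((X z s - X z t) / (s - t) - w (X z t) t) < e"
  proof (intro exI[of _ r] conjI allI impI)
    fix s assume s: "s \<noteq> t \<and> norm (s - t) < r"
    have "(X z s - X z t) / (s - t) - w (X z t) t = (X z s - X z t - w (X z t) t * (s - t)) / (s - t)"
      using s by (simp add: diff_divide_distrib)
    then have "\<bar>(X z s - X z t) / (s - t) - w (X z t) t\<bar> = \<bar>X z s - X z t - w (X z t) t * (s - t)\<bar> / \<bar>s - t\<bar>"
      by (simp add: abs_divide)
    also have "\<dots> \<le> e / 2" using r(2)[of s] s by (simp add: divide_le_eq)
    finally show "norm ((X z s - X z t) / (s - t) - w (X z t) t) < e" using e by simp
  qed (use r in simp)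
qed

lemma X_deriv:
  assumes "0 < z" "z < 1" "0 < t"
  shows "((\<lambda>s. X z s) has_real_derivative v (ubar (quantile (rho t)) (X z t) - lam * z)) (at t)"
  using X_deriv_w[OF assms] w_eq[OF assms(3)] cdf_X[OF assms(3,1,2)] by simp

end

section \<open>Smoothing\<close>

lemma (in nonlocal_kernel) drift_expansion:
  assumes Y: "integrable unif Y" and z: "z1 \<le> z2"
    and conv: "conv_measure V (distr unif borel Y) (Y z2) = ubar Y (Y z2) - lam * z2"
  shows "b * lam * (z2 - z1) - Lv * LU * \<bar>Y z2 - Y z1\<bar>
    \<le> v (ubar Y (Y z2) - lam * z2) - v (ubar Y (Y z1) - lam * z1)"
proof -
  have "v (ubar Y (Y z2) - lam * z1) - v (ubar Y (Y z2) - lam * z2) \<le> - b * (lam * (z2 - z1))"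
    using v_decr_conv[OF Y, of "Y z2" "ubar Y (Y z2) - lam * z1"] lam_pos z
    by (simp add: conv algebra_simps)
  moreover have "\<bar>v (ubar Y (Y z2) - lam * z1) - v (ubar Y (Y z1) - lam * z1)\<bar> \<le> Lv * LU * \<bar>Y z2 - Y z1\<bar>"
  proof -
    have "\<bar>ubar Y (Y z2) - ubar Y (Y z1)\<bar> \<le> LU * \<bar>Y z2 - Y z1\<bar>"
      using ubar_diff[OF U_diff' Y Y, of "Y z2" "Y z1"] by simp
    then have "Lv * \<bar>(ubar Y (Y z2) - lam * z1) - (ubar Y (Y z1) - lam * z1)\<bar> \<le> Lv * (LU * \<bar>Y z2 - Y z1\<bar>)"
      by (intro mult_left_mono Lv_nonneg) simp
    then show ?thesis using v_diff[of "ubar Y (Y z2) - lam * z1" "ubar Y (Y z1) - lam * z1"] by (simp only: mult.assoc)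
  qed
  ultimately show ?thesis by (simp add: algebra_simps)
qed

lemma smoothing_bound_growth:
  assumes "0 < b" "0 < lam" "0 \<le> K" "0 < t"
  shows "smoothing_bound K b lam t = 1 / (b * lam * growth K t)"
  using assms by (auto simp: smoothing_bound_def growth_def divide_simps)

lemma smoothing_bound_antimono:
  assumes "0 < b" "0 < lam" "0 \<le> K" "0 < s" "s \<le> t"
  shows "smoothing_bound K b lam t \<le> smoothing_bound K b lam s"
  using assms growth_pos[of K s] growth_mono[of K s t]
  by (auto simp: smoothing_bound_growth intro!: divide_left_mono mult_left_mono mult_pos_pos)

lemma smoothing_bound_nonneg:
  assumes "0 < b" "0 < lam" "0 \<le> K" "0 < t"
  shows "0 \<le> smoothing_bound K b lam t"
  using assms growth_pos[of K t] by (simp add: smoothing_bound_growth)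

context weak_solution
begin

text \<open>The distance of two quantiles satisfies the expansion inequality on every
  \<open>[s, t]\<close> with \<open>0 < s\<close>; at time \<open>s\<close> it only has to be
  nonnegative.\<close>

lemma X_expand:
  assumes z: "0 < z1" "z1 < z2" "z2 < 1" and t: "0 < t"
  shows "b * lam * (z2 - z1) * growth (Lv * LU) t \<le> X z2 t - X z1 t"
proof -
  have K: "0 \<le> Lv * LU" using Lv_nonneg LU_nonneg by simp
  have ge: "b * lam * (z2 - z1) * growth (Lv * LU) (t - s) \<le> X z2 t - X z1 t" if s: "0 < s" "s < t" for s
  proof (rule expansion_lower_bound[where d = "\<lambda>t. X z2 t - X z1 t" and s = s])
    show "0 \<le> b * lam * (z2 - z1)" using b_pos lam_pos z by simp
    show "0 \<le> X z2 s - X z1 s" using quantile_mono[OF rho_distribution] s z by simp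
    have d: "((\<lambda>t. X z2 t - X z1 t) has_real_derivative
        v (ubar (quantile (rho \<tau>)) (X z2 \<tau>) - lam * z2) - v (ubar (quantile (rho \<tau>)) (X z1 \<tau>) - lam * z1)) (at \<tau>)" if "0 < \<tau>" for \<tau>
      using X_deriv[of z1 \<tau>] X_deriv[of z2 \<tau>] z that by (intro derivative_intros) auto
    show "continuous_on {s..t} (\<lambda>t. X z2 t - X z1 t)"
      using s by (intro continuous_at_imp_continuous_on ballI) (auto intro!: DERIV_isCont[OF d])
    fix \<tau> assume \<tau>: "s < \<tau>" "\<tau> < t"
    have \<tau>0: "0 < \<tau>" using \<tau> s by simp
    have conv: "conv_measure V (distr unif borel (quantile (rho \<tau>))) (X z2 \<tau>) = ubar (quantile (rho \<tau>)) (X z2 \<tau>) - lam * z2"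
    proof -
      \<comment> \<open>Equal positions would give equal labels through \<open>cdf_X\<close>, so the
        quantile is strictly increasing in the label at positive times.\<close>
      have F: "measure unif {\<zeta>. X \<zeta> \<tau> < X z2 \<tau>} = z2"
      proof (rule antisym)
        have [measurable]: "quantile (rho \<tau>) \<in> borel_measurable borel" using \<tau>0 by (intro X_measurable) simp
        have "measure unif {\<zeta>. X \<zeta> \<tau> < X z2 \<tau>} \<le> measure unif {\<zeta>. X \<zeta> \<tau> \<le> X z2 \<tau>}"
          by (intro unif.finite_measure_mono) auto
        then show "measure unif {\<zeta>. X \<zeta> \<tau> < X z2 \<tau>} \<le> z2"
          using cdf_quantile[OF rho_distribution, of \<tau> "X z2 \<tau>"] cdf_X[OF \<tau>0, of z2] z \<tau>0 by simp
        have "X \<zeta> \<tau> < X z2 \<tau>" if "0 < \<zeta>" "\<zeta> < z2" for \<zeta>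
        proof (rule ccontr)
          assume "\<not> ?thesis"
          then have "X \<zeta> \<tau> = X z2 \<tau>" using quantile_mono[OF rho_distribution, of \<tau> \<zeta> z2] that z \<tau>0 by simp
          then show False using cdf_X[OF \<tau>0, of z2] cdf_X[OF \<tau>0, of \<zeta>] that z by simp
        qed
        then have "z2 - 0 \<le> measure unif {\<zeta>. X \<zeta> \<tau> < X z2 \<tau>}"
          using z by (intro measure_unif_ge) auto
        then show "z2 \<le> measure unif {\<zeta>. X \<zeta> \<tau> < X z2 \<tau>}" by simp
      qed
      show ?thesis using conv_measure_distr[OF X_int, of \<tau> "X z2 \<tau>"] \<tau>0 by (simp add: F)
    qed
    show "\<exists>D. ((\<lambda>t. X z2 t - X z1 t) has_real_derivative D) (at \<tau>) \<and> b * lam * (z2 - z1) - Lv * LU * \<bar>X z2 \<tau> - X z1 \<tau>\<bar> \<le> D"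
      using d[OF \<tau>0] drift_expansion[OF X_int _ conv, of z1] \<tau>0 z by auto
  qed (use s K in auto)
  \<comment> \<open>The starting time is sent to 0 in the explicit bound alone, so no regularity of
    the trajectories at time 0 enters.\<close>
  have "((\<lambda>s. b * lam * (z2 - z1) * growth (Lv * LU) (t - s)) \<longlongrightarrow> b * lam * (z2 - z1) * growth (Lv * LU) (t - 0)) (at_right 0)"
    by (intro tendsto_intros continuous_on_tendsto_compose[OF continuous_on_growth[of UNIV]]) auto
  moreover have "\<forall>\<^sub>F s in at_right 0. b * lam * (z2 - z1) * growth (Lv * LU) (t - s) \<le> X z2 t - X z1 t"
    using eventually_at_right_less[of 0] eventually_at_right_field[of _ 0] t ge
    by (auto simp: eventually_at_right_field)
  ultimately show ?thesis
    using tendsto_upperbound[of "\<lambda>s. b * lam * (z2 - z1) * growth (Lv * LU) (t - s)" _ "at_right (0::real)"] by simp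
qed

lemma Linf_norm_le:
  assumes t: "0 < t"
  shows "Linf_norm (rho t) \<le> ennreal (smoothing_bound (Lv * LU) b lam t)"
proof (subst distr_quantile[symmetric, OF rho_distribution], use t in simp, rule expanding_distr_density)
  have K: "0 \<le> Lv * LU" using Lv_nonneg LU_nonneg by simp
  show "quantile (rho t) \<in> borel_measurable borel" using t by (intro X_measurable) simp
  show "0 \<le> smoothing_bound (Lv * LU) b lam t"
    by (rule smoothing_bound_nonneg[OF b_pos lam_pos K t])
  fix z1 z2 :: real assume "0 < z1" "z1 < z2" "z2 < 1"
  from X_expand[OF this t]
  have "(z2 - z1) * (b * lam * growth (Lv * LU) t) \<le> X z2 t - X z1 t" by (simp only: ac_simps)
  moreover have "0 < b * lam * growth (Lv * LU) t" using growth_pos[OF K t] b_pos lam_pos by simp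
  ultimately show "z2 - z1 \<le> smoothing_bound (Lv * LU) b lam t * (X z2 t - X z1 t)"
    unfolding smoothing_bound_growth[OF b_pos lam_pos K t] by (simp add: pos_le_divide_eq)
qed

section \<open>Joint measurability of the densities\<close>

text \<open>A jointly measurable density is the Radon--Nikodym derivative of the space-time measure
  \<open>rho t \<otimes> dt\<close>; it disintegrates correctly because it does so on a countable family of half-lines.\<close>

lemma joint_density:
  obtains r :: "real \<times> real \<Rightarrow> ennreal"
  where "r \<in> borel_measurable (borel \<Otimes>\<^sub>M borel)"
    and "AE t in lborel. t > 0 \<longrightarrow> rho t = density lborel (\<lambda>x. r (x, t))"
proof -
  define F where "F a t = (if 0 < t then cdf (rho t) a else 0)" for a t
  have F_meas [measurable]: "F a \<in> borel_measurable borel" for a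
  proof -
    have "continuous_on {0<..} (\<lambda>t. (\<lambda>(x, t). cdf (rho t) x) (a, t))"
      by (rule continuous_on_compose2[OF continuous_on_cdf
          continuous_on_Pair[OF continuous_on_const continuous_on_id]]) auto
    then have "continuous_on {0<..} (\<lambda>t. cdf (rho t) a)" by simp
    then have "(\<lambda>t. if t \<in> {0<..} then cdf (rho t) a else 0) \<in> borel_measurable borel"
      by (intro borel_measurable_continuous_on_if) auto
    then show ?thesis by (simp add: F_def[abs_def])
  qed
  \<comment> \<open>A jointly measurable copy of the quantiles, with time as first coordinate. Its
    sublevel sets become \<open>snd w \<le> F a (fst w)\<close>, and \<open>F a\<close> is
    measurable because it is continuous in time.\<close>
  define Y where "Y w = (if 0 < snd w \<and> snd w < 1 \<and> 0 < fst w then X (snd w) (fst w) else 0)" for w :: "real \<times> real"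
  have Y_meas [measurable]: "Y \<in> borel_measurable (borel \<Otimes>\<^sub>M borel)"
    unfolding borel_measurable_iff_le
  proof
    fix a
    have "{w \<in> space (borel \<Otimes>\<^sub>M borel). Y w \<le> a}
      = {w \<in> space (borel \<Otimes>\<^sub>M borel). if 0 < snd w \<and> snd w < 1 \<and> 0 < fst w then snd w \<le> F a (fst w) else 0 \<le> a}"
      by (auto simp: Y_def F_def le_cdf_X)
    also have "\<dots> \<in> sets (borel \<Otimes>\<^sub>M borel)" by measurable
    finally show "{w \<in> space (borel \<Otimes>\<^sub>M borel). Y w \<le> a} \<in> sets (borel \<Otimes>\<^sub>M borel)" .
  qed
  define T :: "real measure" where "T = density lborel (indicator {0<..})"
  have T_sets [measurable_cong]: "sets T = sets borel" by (simp add: T_def)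
  have T_nn: "(\<integral>\<^sup>+t. f t \<partial>T) = (\<integral>\<^sup>+t. indicator {0<..} t * f t \<partial>lborel)" if [measurable]: "f \<in> borel_measurable borel" for f
    unfolding T_def by (subst nn_integral_density) auto
  define N where "N = distr (T \<Otimes>\<^sub>M unif) (borel \<Otimes>\<^sub>M borel) (\<lambda>w. (Y w, fst w))"
  have map_meas [measurable]: "(\<lambda>w. (Y w, fst w)) \<in> (T \<Otimes>\<^sub>M unif) \<rightarrow>\<^sub>M (borel \<Otimes>\<^sub>M borel)"
    by measurable
  have N_sets: "sets N = sets (borel \<Otimes>\<^sub>M borel)" by (simp add: N_def)
  have N: "emeasure N A = (\<integral>\<^sup>+t. indicator {0<..} t * emeasure (rho t) {x. (x, t) \<in> A} \<partial>lborel)"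
    if A[measurable]: "A \<in> sets (borel \<Otimes>\<^sub>M borel)" for A
  proof -
    have "emeasure N A = (\<integral>\<^sup>+q. indicator A q \<partial>N)" using A by (simp add: N_sets)
    also have "\<dots> = (\<integral>\<^sup>+w. indicator A (Y w, fst w) \<partial>(T \<Otimes>\<^sub>M unif))"
      unfolding N_def by (subst nn_integral_distr) auto
    also have "\<dots> = (\<integral>\<^sup>+t. \<integral>\<^sup>+z. indicator A (Y (t, z), t) \<partial>unif \<partial>T)"
      by (subst unif.nn_integral_fst[symmetric]) auto
    also have "\<dots> = (\<integral>\<^sup>+t. indicator {0<..} t * (\<integral>\<^sup>+z. indicator A (Y (t, z), t) \<partial>unif) \<partial>lborel)"
      by (rule T_nn) measurable
    also have "\<dots> = (\<integral>\<^sup>+t. indicator {0<..} t * emeasure (rho t) {x. (x, t) \<in> A} \<partial>lborel)"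
    proof (intro nn_integral_cong)
      fix t :: real
      show "indicator {0<..} t * (\<integral>\<^sup>+z. indicator A (Y (t, z), t) \<partial>unif) = indicator {0<..} t * emeasure (rho t) {x. (x, t) \<in> A}"
      proof (cases "0 < t")
        case True
        have [measurable]: "quantile (rho t) \<in> borel_measurable borel" using True by (intro X_measurable) simp
        have sec [measurable]: "{x. (x, t) \<in> A} \<in> sets borel"
          using measurable_sets[of "\<lambda>x. (x, t)" borel "borel \<Otimes>\<^sub>M borel" A] A by (simp add: vimage_def)
        have "(\<integral>\<^sup>+z. indicator A (Y (t, z), t) \<partial>unif) = (\<integral>\<^sup>+z. indicator {x. (x, t) \<in> A} (X z t) \<partial>unif)"
          using True by (intro nn_integral_cong_AE AE_unifI) (auto simp: Y_def indicator_def)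
        also have "\<dots> = (\<integral>\<^sup>+x. indicator {x. (x, t) \<in> A} x \<partial>distr unif borel (quantile (rho t)))"
          by (subst nn_integral_distr) auto
        also have "\<dots> = emeasure (rho t) {x. (x, t) \<in> A}"
          using True by (simp add: distr_quantile rho_distribution real_distribution.events_eq_borel[OF rho_distribution])
        finally show ?thesis by simp
      qed simp
    qed
    finally show ?thesis .
  qed
  have ac: "absolutely_continuous (lborel \<Otimes>\<^sub>M lborel) N"
    unfolding absolutely_continuous_def
  proof
    fix A :: "(real \<times> real) set" assume A: "A \<in> null_sets (lborel \<Otimes>\<^sub>M lborel)"
    then have A_m [measurable]: "A \<in> sets (borel \<Otimes>\<^sub>M borel)" by (simp add: null_sets_def)
    have "(\<integral>\<^sup>+t. \<integral>\<^sup>+x. indicator A (x, t) \<partial>lborel \<partial>lborel) = (\<integral>\<^sup>+q. indicator A q \<partial>(lborel \<Otimes>\<^sub>M lborel))"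
      by (rule lborel_pair.nn_integral_snd) simp
    also have "\<dots> = 0" using A by (simp add: null_sets_def)
    finally have "AE t in lborel. (\<integral>\<^sup>+x. indicator A (x, t) \<partial>lborel) = (0 :: ennreal)"
      by (subst (asm) nn_integral_0_iff_AE) auto
    then have "AE t in lborel. indicator {0<..} t * emeasure (rho t) {x. (x, t) \<in> A} = (0 :: ennreal)"
    proof eventually_elim
      case (elim t)
      show ?case
      proof (cases "0 < t")
        case True
        have sec: "{x. (x, t) \<in> A} \<in> sets borel"
          using measurable_sets[of "\<lambda>x. (x, t)" borel "borel \<Otimes>\<^sub>M borel" A] A_m by (simp add: vimage_def)
        have "(\<integral>\<^sup>+x. indicator A (x, t) \<partial>lborel) = (\<integral>\<^sup>+x. indicator {x. (x, t) \<in> A} x \<partial>lborel)"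
          by (intro nn_integral_cong) (auto simp: indicator_def)
        then have "{x. (x, t) \<in> A} \<in> null_sets lborel" using elim sec by (simp add: null_sets_def)
        moreover have "absolutely_continuous lborel (rho t)"
          using sol True by (auto simp: dissipative_measure_solution_def Linf_norm_def split: if_splits)
        ultimately have "{x. (x, t) \<in> A} \<in> null_sets (rho t)" by (auto simp: absolutely_continuous_def)
        then show ?thesis by (simp add: null_setsD1)
      qed simp
    qed
    then have "emeasure N A = (\<integral>\<^sup>+(t::real). 0 \<partial>lborel)" unfolding N[OF A_m] by (rule nn_integral_cong_AE)
    then show "A \<in> null_sets N" using A_m by (simp add: null_sets_def N_sets)
  qed
  have sf: "sigma_finite_measure (lborel \<Otimes>\<^sub>M lborel :: (real \<times> real) measure)"
    by (rule lborel_pair.sigma_finite_measure_axioms)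
  define r where "r = RN_deriv (lborel \<Otimes>\<^sub>M lborel) N"
  have r_meas [measurable]: "r \<in> borel_measurable (borel \<Otimes>\<^sub>M borel)"
    using borel_measurable_RN_deriv[of "lborel \<Otimes>\<^sub>M lborel" N]
    by (simp add: r_def measurable_cong_sets[OF sets_pair_measure_cong[OF sets_lborel sets_lborel] refl])
  have dens: "density (lborel \<Otimes>\<^sub>M lborel) r = N"
    unfolding r_def
    by (rule sigma_finite_measure.density_RN_deriv[OF sf ac])
      (simp add: N_sets sets_pair_measure_cong[OF sets_lborel sets_lborel])
  let ?h = "\<lambda>a t. \<integral>\<^sup>+x. indicator {..a} x * r (x, t) \<partial>lborel"
  \<comment> \<open>Both sides are densities in time of the same measure, the space-time measure
    \<open>N\<close> restricted to \<open>{..a} \<times> J\<close> as a function of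
    \<open>J\<close>. The exceptional null set depends on \<open>a\<close>, so \<open>a\<close> is
    afterwards restricted to the rationals.\<close>
  have half: "AE t in lborel. ?h a t = indicator {0<..} t * ennreal (F a t)" for a
  proof (rule sigma_finite_measure.density_unique[OF sigma_finite_lborel])
    show "density lborel (?h a) = density lborel (\<lambda>t. indicator {0<..} t * ennreal (F a t))"
    proof (rule measure_eqI)
      fix J assume "J \<in> sets (density lborel (?h a))"
      then have J [measurable]: "J \<in> sets borel" by simp
      have AJ: "{..a} \<times> J \<in> sets (borel \<Otimes>\<^sub>M borel)" by (intro pair_measureI) auto
      have "emeasure (density lborel (?h a)) J = (\<integral>\<^sup>+t. \<integral>\<^sup>+x. indicator ({..a} \<times> J) (x, t) * r (x, t) \<partial>lborel \<partial>lborel)"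
      proof -
        have "emeasure (density lborel (?h a)) J = (\<integral>\<^sup>+t. ?h a t * indicator J t \<partial>lborel)"
          by (subst emeasure_density) auto
        also have "\<dots> = (\<integral>\<^sup>+t. \<integral>\<^sup>+x. indicator ({..a} \<times> J) (x, t) * r (x, t) \<partial>lborel \<partial>lborel)"
          by (intro nn_integral_cong, subst nn_integral_multc[symmetric])
            (auto intro!: nn_integral_cong simp: indicator_def)
        finally show ?thesis .
      qed
      also have "\<dots> = (\<integral>\<^sup>+q. indicator ({..a} \<times> J) q * r q \<partial>(lborel \<Otimes>\<^sub>M lborel))"
        by (rule lborel_pair.nn_integral_snd) (use AJ in measurable)
      also have "\<dots> = emeasure N ({..a} \<times> J)"
        unfolding dens[symmetric] using AJ
        by (subst emeasure_density)
          (auto simp: sets_pair_measure_cong[OF sets_lborel sets_lborel] mult.commute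
            measurable_cong_sets[OF sets_pair_measure_cong[OF sets_lborel sets_lborel] refl])
      also have "\<dots> = (\<integral>\<^sup>+t. (indicator {0<..} t * ennreal (F a t)) * indicator J t \<partial>lborel)"
        unfolding N[OF AJ]
      proof (intro nn_integral_cong)
        fix t :: real
        have "{x. (x, t) \<in> {..a} \<times> J} = (if t \<in> J then {..a} else {})" by auto
        then show "indicator {0<..} t * emeasure (rho t) {x. (x, t) \<in> {..a} \<times> J} = indicator {0<..} t * ennreal (F a t) * indicator J t"
          by (auto simp: indicator_def F_def cdf_def finite_measure.emeasure_eq_measure
              prob_space.finite_measure real_distribution.axioms(1)[OF rho_distribution[of t]])
      qed
      also have "\<dots> = emeasure (density lborel (\<lambda>t. indicator {0<..} t * ennreal (F a t))) J"
        by (subst emeasure_density) auto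
      finally show "emeasure (density lborel (?h a)) J = emeasure (density lborel (\<lambda>t. indicator {0<..} t * ennreal (F a t))) J" .
    qed simp
  qed measurable
  have "AE t in lborel. \<forall>a\<in>\<rat>. ?h a t = indicator {0<..} t * ennreal (F a t)"
    using half countable_rat by (subst AE_ball_countable) auto
  then have "AE t in lborel. t > 0 \<longrightarrow> rho t = density lborel (\<lambda>x. r (x, t))"
  proof eventually_elim
    case (elim t)
    show ?case
    proof
      assume t: "0 < t"
      interpret R: real_distribution "rho t" using t by (intro rho_distribution) simp
      let ?D = "density lborel (\<lambda>x. r (x, t))"
      have D: "emeasure ?D {..a} = ennreal (cdf (rho t) a)" if "a \<in> \<rat>" for a
        using elim that t by (subst emeasure_density) (auto simp: F_def mult.commute)
      \<comment> \<open>Only with finite total mass is a measure determined by its distribution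
        function.\<close>
      have "emeasure ?D UNIV \<le> 1"
      proof -
        have "(\<Union>n::nat. {..real n}) = UNIV" by (auto intro: real_arch_simple)
        then have "emeasure ?D UNIV = (SUP n::nat. emeasure ?D {..real n})"
          by (subst SUP_emeasure_incseq) (auto simp: incseq_def)
        also have "\<dots> \<le> 1" using R.cdf_bounded_prob by (intro SUP_least) (simp add: D)
        finally show ?thesis .
      qed
      then have fin: "finite_measure ?D" by (intro finite_measureI) (auto simp: top_unique)
      interpret D: finite_borel_measure ?D
        using fin by (simp add: finite_borel_measure_def finite_borel_measure_axioms_def)
      have cdf_rat: "cdf ?D a = cdf (rho t) a" if "a \<in> \<rat>" for a
        using D[OF that] R.cdf_nonneg[of a] by (simp add: cdf_def measure_def)
      \<comment> \<open>Agreement at rational points extends to all points since both distribution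
        functions are monotone and right-continuous.\<close>
      have "cdf ?D x = cdf (rho t) x" for x
      proof (rule antisym)
        show "cdf ?D x \<le> cdf (rho t) x"
        proof (rule field_le_epsilon)
          fix e :: real assume "0 < e"
          then have "\<forall>\<^sub>F y in at_right x. cdf (rho t) y < cdf (rho t) x + e"
            using R.cdf_is_right_cont[of x] by (intro order_tendstoD(2)) (auto simp: continuous_within)
          then obtain y where y: "x < y" "\<And>q. x < q \<Longrightarrow> q < y \<Longrightarrow> cdf (rho t) q < cdf (rho t) x + e"
            unfolding eventually_at_right_field by blast
          obtain q where q: "q \<in> \<rat>" "x < q" "q < y" using Rats_dense_in_real[OF y(1)] by blast
          have "cdf ?D x \<le> cdf ?D q" using q by (intro D.cdf_nondecreasing) simp
          then show "cdf ?D x \<le> cdf (rho t) x + e" using cdf_rat[OF q(1)] y(2)[OF q(2,3)] by simp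
        qed
        show "cdf (rho t) x \<le> cdf ?D x"
        proof (rule field_le_epsilon)
          fix e :: real assume "0 < e"
          then have "\<forall>\<^sub>F y in at_right x. cdf ?D y < cdf ?D x + e"
            using D.cdf_is_right_cont[of x] by (intro order_tendstoD(2)) (auto simp: continuous_within)
          then obtain y where y: "x < y" "\<And>q. x < q \<Longrightarrow> q < y \<Longrightarrow> cdf ?D q < cdf ?D x + e"
            unfolding eventually_at_right_field by blast
          obtain q where q: "q \<in> \<rat>" "x < q" "q < y" using Rats_dense_in_real[OF y(1)] by blast
          have "cdf (rho t) x \<le> cdf (rho t) q" using q by (intro R.cdf_nondecreasing) simp
          then show "cdf (rho t) x \<le> cdf ?D x + e" using cdf_rat[OF q(1)] y(2)[OF q(2,3)] by simp
        qed
      qed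
      then show "rho t = ?D"
        by (intro cdf_unique'[symmetric]) (auto simp: D.finite_borel_measure_axioms R.finite_borel_measure_M)
    qed
  qed
  with r_meas show ?thesis by (rule that)
qed

text \<open>The smoothing bound decreases in time, so its value at the earliest time of a compact
  set of positive times serves for the whole set.\<close>

lemma Linf_loc_Linf_rho: "Linf_loc_Linf rho"
  unfolding Linf_loc_Linf_def
proof (intro conjI allI impI)
  show "\<exists>r. r \<in> borel_measurable (borel \<Otimes>\<^sub>M borel) \<and> (AE t in lborel. t > 0 \<longrightarrow> rho t = density lborel (\<lambda>x. r (x, t)))"
    using joint_density by metis
  fix K :: "real set" assume K: "compact K \<and> K \<subseteq> {0<..}"
  have LL: "0 \<le> Lv * LU" using Lv_nonneg LU_nonneg by simp
  show "\<exists>C<\<infinity>. AE t in lborel. t \<in> K \<longrightarrow> Linf_norm (rho t) \<le> C"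
  proof (cases "K = {}")
    case True
    then show ?thesis by (intro exI[of _ 0]) auto
  next
    case False
    then obtain a where a: "a \<in> K" "\<And>t. t \<in> K \<Longrightarrow> a \<le> t" using K compact_attains_inf[of K] by auto
    then have "0 < a" using K by auto
    have "Linf_norm (rho t) \<le> ennreal (smoothing_bound (Lv * LU) b lam a)" if "t \<in> K" for t
      using Linf_norm_le[of t] smoothing_bound_antimono[OF b_pos lam_pos LL \<open>0 < a\<close> a(2)[OF that]] a(2)[OF that] \<open>0 < a\<close>
      by (meson ennreal_leI order_less_le_trans order_trans)
    then show ?thesis by (intro exI[of _ "ennreal (smoothing_bound (Lv * LU) b lam a)"]) auto
  qed
qed

end

section \<open>Stability and uniqueness\<close>

text \<open>Both solutions see the same \<open>v\<close> and \<open>U\<close>, so the difference of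
  quantiles satisfies the mean-field inequality with \<open>L = [v] [V]\<close> and vanishing
  inhomogeneity from \<open>lam * z\<close>, which is the same for both.\<close>

lemma weak_solution_stability:
  assumes W1: "weak_solution V v lam b p rho01 rho1" and W2: "weak_solution V v lam b p rho02 rho2" and t: "0 \<le> t"
  shows "wasserstein p (rho1 t) (rho2 t)
    \<le> exp (2 * (lip_seminorm UNIV v * lip_seminorm {..0} V) * t) * wasserstein p (rho1 0) (rho2 0)"
proof (cases "t = 0")
  case False
  interpret A: weak_solution V v lam b p rho01 rho1 by fact
  interpret B: weak_solution V v lam b p rho02 rho2 by fact
  have t: "0 < t" using t False by simp
  define L where "L = A.Lv * A.LV"
  have L: "0 \<le> L" unfolding L_def using A.Lv_nonneg A.LV_nonneg by simp
  define D where "D z s = A.X z s - B.X z s" for z s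
  define mD where "mD s = (\<integral>z. \<bar>D z s\<bar> \<partial>unif)" for s
  have D_int: "integrable unif (\<lambda>z. D z s)" if "0 \<le> s" for s
    unfolding D_def using A.X_int[OF that] B.X_int[OF that] by (rule Bochner_Integration.integrable_diff)
  have mD_diff: "\<bar>mD s - mD s'\<bar> \<le> (\<integral>z. \<bar>A.X z s - A.X z s'\<bar> \<partial>unif) + (\<integral>z. \<bar>B.X z s - B.X z s'\<bar> \<partial>unif)"
    if s: "0 \<le> s" "0 \<le> s'" for s s'
  proof -
    note i = A.X_int[OF s(1)] A.X_int[OF s(2)] B.X_int[OF s(1)] B.X_int[OF s(2)] D_int[OF s(1)] D_int[OF s(2)]
    have "\<bar>mD s - mD s'\<bar> = \<bar>\<integral>z. \<bar>D z s\<bar> - \<bar>D z s'\<bar> \<partial>unif\<bar>"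
      unfolding mD_def using i by (subst Bochner_Integration.integral_diff) auto
    also have "\<dots> \<le> (\<integral>z. \<bar>\<bar>D z s\<bar> - \<bar>D z s'\<bar>\<bar> \<partial>unif)" by (rule integral_abs_bound)
    also have "\<dots> \<le> (\<integral>z. \<bar>A.X z s - A.X z s'\<bar> + \<bar>B.X z s - B.X z s'\<bar> \<partial>unif)"
      using i by (intro integral_mono) (auto simp: D_def)
    also have "\<dots> = (\<integral>z. \<bar>A.X z s - A.X z s'\<bar> \<partial>unif) + (\<integral>z. \<bar>B.X z s - B.X z s'\<bar> \<partial>unif)"
      using i by (intro Bochner_Integration.integral_add) auto
    finally show ?thesis .
  qed
  have mD_cont: "continuous_on {0..} mD"
    unfolding continuous_on_iff
  proof (intro ballI allI impI)
    fix s e :: real assume s: "s \<in> {0..}" and e: "0 < e"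
    obtain d1 where d1: "0 < d1" "\<forall>s'\<ge>0. \<bar>s' - s\<bar> < d1 \<longrightarrow> (\<integral>z. \<bar>A.X z s' - A.X z s\<bar> \<partial>unif) < e / 2"
      using A.L1_continuous[of s "e / 2"] s e by auto
    obtain d2 where d2: "0 < d2" "\<forall>s'\<ge>0. \<bar>s' - s\<bar> < d2 \<longrightarrow> (\<integral>z. \<bar>B.X z s' - B.X z s\<bar> \<partial>unif) < e / 2"
      using B.L1_continuous[of s "e / 2"] s e by auto
    show "\<exists>d>0. \<forall>s'\<in>{0..}. dist s' s < d \<longrightarrow> dist (mD s') (mD s) < e"
    proof (intro exI[of _ "min d1 d2"] conjI ballI impI)
      fix s' assume s': "s' \<in> {0..}" "dist s' s < min d1 d2"
      have "(\<integral>z. \<bar>A.X z s' - A.X z s\<bar> \<partial>unif) < e / 2" "(\<integral>z. \<bar>B.X z s' - B.X z s\<bar> \<partial>unif) < e / 2"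
        using s' d1 d2 by (auto simp: dist_real_def)
      then show "dist (mD s') (mD s) < e"
        using mD_diff[of s' s] s s' by (auto simp: dist_real_def)
    qed (use d1 d2 in auto)
  qed
  have step: "\<bar>D z t\<bar> \<le> exp (L * (t - s)) * \<bar>D z s\<bar> + (exp (2 * L * (t - s)) - exp (L * (t - s))) * mD s"
    if s: "0 < s" "s \<le> t" and z: "0 < z" "z < 1" for s z
    unfolding mD_def
  proof (rule mean_field_gronwall[OF s(2) L _ _ _ _ z])
    have d: "(D z has_real_derivative v (A.ubar (quantile (rho1 \<tau>)) (A.X z \<tau>) - lam * z) - v (A.ubar (quantile (rho2 \<tau>)) (B.X z \<tau>) - lam * z)) (at \<tau>)"
      if "0 < z" "z < 1" "0 < \<tau>" for z \<tau>
      unfolding D_def[abs_def] using A.X_deriv[OF that] B.X_deriv[OF that] by (rule derivative_intros)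
    show "continuous_on {s..t} (D z)" if "0 < z" "z < 1" for z
      using s by (intro continuous_at_imp_continuous_on ballI DERIV_isCont[OF d[OF that]]) auto
    show "integrable unif (\<lambda>z. D z \<tau>)" if "s \<le> \<tau>" for \<tau> using that s by (intro D_int) auto
    show "continuous_on {s..t} (\<lambda>\<tau>. \<integral>z. \<bar>D z \<tau>\<bar> \<partial>unif)"
      using continuous_on_subset[OF mD_cont, of "{s..t}"] s unfolding mD_def by auto
    fix z \<tau> :: real assume z: "0 < z" "z < 1" and \<tau>: "s < \<tau>" "\<tau> < t"
    have \<tau>0: "0 < \<tau>" using \<tau> s by simp
    let ?u1 = "A.ubar (quantile (rho1 \<tau>)) (A.X z \<tau>)" and ?u2 = "A.ubar (quantile (rho2 \<tau>)) (B.X z \<tau>)"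
    have "\<bar>v (?u1 - lam * z) - v (?u2 - lam * z)\<bar> \<le> A.Lv * \<bar>?u1 - ?u2\<bar>"
      using A.v_diff[of "?u1 - lam * z" "?u2 - lam * z"] by simp
    also have "\<dots> \<le> A.Lv * (A.LV * (\<bar>A.X z \<tau> - B.X z \<tau>\<bar> + (\<integral>\<zeta>. \<bar>A.X \<zeta> \<tau> - B.X \<zeta> \<tau>\<bar> \<partial>unif)))"
      using \<tau>0 by (intro mult_left_mono A.Lv_nonneg A.ubar_diff A.U_diff A.X_int B.X_int) auto
    finally show "\<exists>d. (D z has_real_derivative d) (at \<tau>) \<and> \<bar>d\<bar> \<le> L * (\<bar>D z \<tau>\<bar> + (\<integral>z. \<bar>D z \<tau>\<bar> \<partial>unif))"
      using d[OF z \<tau>0] by (intro exI conjI) (auto simp: D_def L_def mult.assoc)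
  qed
  have inner: "AE z in unif. 0 < z \<and> z < 1" by (rule AE_unifI) simp
  \<comment> \<open>The starting time tends to 0 here: for almost every label both quantiles are
    continuous at time 0, and so is the mean \<open>mD\<close>.\<close>
  have bound: "AE z in unif. \<bar>D z t\<bar> \<le> exp (L * t) * \<bar>D z 0\<bar> + (exp (2 * L * t) - exp (L * t)) * mD 0"
    using A.AE_continuous_X[OF order_refl] B.AE_continuous_X[OF order_refl] inner
  proof eventually_elim
    case (elim z)
    have "continuous (at 0 within {0..}) (D z)"
      unfolding D_def[abs_def] using elim by (intro continuous_intros) auto
    then have D0: "(D z \<longlongrightarrow> D z 0) (at_right 0)"
      unfolding continuous_within by (rule tendsto_within_subset) auto
    have "(mD \<longlongrightarrow> mD 0) (at 0 within {0..})" using mD_cont by (auto simp: continuous_on_def)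
    then have m0: "(mD \<longlongrightarrow> mD 0) (at_right 0)" by (rule tendsto_within_subset) auto
    have lim: "((\<lambda>s. exp (L * (t - s)) * \<bar>D z s\<bar> + (exp (2 * L * (t - s)) - exp (L * (t - s))) * mD s)
      \<longlongrightarrow> exp (L * (t - 0)) * \<bar>D z 0\<bar> + (exp (2 * L * (t - 0)) - exp (L * (t - 0))) * mD 0) (at_right 0)"
      by (intro tendsto_intros D0 m0)
    have "\<forall>\<^sub>F s in at_right 0. \<bar>D z t\<bar> \<le> exp (L * (t - s)) * \<bar>D z s\<bar> + (exp (2 * L * (t - s)) - exp (L * (t - s))) * mD s"
      unfolding eventually_at_right_field using t elim step by (intro exI[of _ t]) auto
    from tendsto_lowerbound[OF lim this] show ?case by simp
  qed
  let ?E = "exp (2 * L * t)"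
  have p: "1 \<le> p" by (rule A.p)
  have D_Lp: "in_Lp p (\<lambda>z. D z s)" if "0 \<le> s" for s
    unfolding D_def using A.X_Lp[OF that] B.X_Lp[OF that] by (rule in_Lp_diff[OF p])
  \<comment> \<open>Divided by \<open>exp (2 * L * t)\<close>, the two coefficients in
    \<open>bound\<close> become \<open>exp (- (L * t))\<close> and its complement to 1.\<close>
  have "Lp_norm p (\<lambda>z. inverse ?E * D z t) \<le> Lp_norm p (\<lambda>z. D z 0)"
  proof (rule Lp_norm_avg[OF p D_Lp, of _ "exp (- (L * t))"])
    show "exp (- (L * t)) \<le> 1" using L t by simp
    show "(\<lambda>z. inverse ?E * D z t) \<in> borel_measurable borel"
      using in_Lp_measurable[OF D_Lp[of t]] t by simp
    have e1: "inverse ?E * exp (L * t) = exp (- (L * t))"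
      by (simp add: exp_minus[symmetric] mult_exp_exp)
    have e2: "inverse ?E * (exp (2 * L * t) - exp (L * t)) = 1 - exp (- (L * t))"
      using e1 by (simp add: right_diff_distrib)
    show "AE z in unif. \<bar>inverse ?E * D z t\<bar> \<le> exp (- (L * t)) * \<bar>D z 0\<bar> + (1 - exp (- (L * t))) * (\<integral>z. \<bar>D z 0\<bar> \<partial>unif)"
      using bound
    proof eventually_elim
      case (elim z)
      have "\<bar>inverse ?E * D z t\<bar> \<le> inverse ?E * (exp (L * t) * \<bar>D z 0\<bar> + (exp (2 * L * t) - exp (L * t)) * mD 0)"
        using elim by (simp add: abs_mult)
      also have "\<dots> = (inverse ?E * exp (L * t)) * \<bar>D z 0\<bar> + (inverse ?E * (exp (2 * L * t) - exp (L * t))) * mD 0"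
        by (simp only: distrib_left mult.assoc)
      finally show ?case unfolding e1 e2 mD_def .
    qed
  qed auto
  then have "?E * Lp_norm p (\<lambda>z. inverse ?E * D z t) \<le> ?E * Lp_norm p (\<lambda>z. D z 0)"
    by (intro mult_left_mono) auto
  moreover have "Lp_norm p (\<lambda>z. ?E * (inverse ?E * D z t)) \<le> ?E * Lp_norm p (\<lambda>z. inverse ?E * D z t)"
    using t by (intro Lp_norm_cmult in_Lp_cmult p D_Lp) auto
  moreover have eq: "(\<lambda>z. ?E * (inverse ?E * D z t)) = (\<lambda>z. D z t)"
    by (simp add: field_simps)
  ultimately have "Lp_norm p (\<lambda>z. D z t) \<le> ?E * Lp_norm p (\<lambda>z. D z 0)"
    unfolding eq by linarith
  then show ?thesis
    using t by (simp add: wasserstein_eq_Lp_norm p A.rho_distribution B.rho_distribution D_def L_def)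
qed simp

lemma weak_solution_unique:
  assumes W1: "weak_solution V v lam b p rho0 rho1" and W2: "weak_solution V v lam b p rho0 rho2" and t: "0 \<le> t"
  shows "rho1 t = rho2 t"
proof -
  interpret A: weak_solution V v lam b p rho0 rho1 by fact
  interpret B: weak_solution V v lam b p rho0 rho2 by fact
  note [measurable] = A.X_measurable[OF t] B.X_measurable[OF t]
  have p: "1 \<le> p" by (rule A.p)
  have "rho1 0 = rho0" "rho2 0 = rho0"
    using A.sol B.sol by (auto simp: dissipative_measure_solution_def)
  then have "wasserstein p (rho1 0) (rho2 0) = Lp_norm p (\<lambda>z. 0)"
    using wasserstein_eq_Lp_norm[OF p A.rho_distribution[of 0] B.rho_distribution[of 0]] by simp
  also have "Lp_norm p (\<lambda>z. 0) \<le> 0"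
    using Lp_norm_cmult[OF p in_Lp_const[of p 0], of 0] by simp
  finally have "exp (2 * (A.Lv * A.LV) * t) * wasserstein p (rho1 0) (rho2 0) \<le> 0"
    by (simp add: mult_le_0_iff)
  then have "wasserstein p (rho1 t) (rho2 t) \<le> 0"
    using weak_solution_stability[OF W1 W2 t] by linarith
  then have "(\<integral>z. \<bar>A.X z t - B.X z t\<bar> \<partial>unif) \<le> 0"
    using L1_le_Lp_norm[OF p in_Lp_diff[OF p A.X_Lp[OF t] B.X_Lp[OF t]]]
    by (simp add: wasserstein_eq_Lp_norm[OF p A.rho_distribution[OF t] B.rho_distribution[OF t]])
  moreover have int: "integrable unif (\<lambda>z. \<bar>A.X z t - B.X z t\<bar>)"
    using A.X_int[OF t] B.X_int[OF t] by auto
  ultimately have "(\<integral>z. \<bar>A.X z t - B.X z t\<bar> \<partial>unif) = 0" by (simp add: antisym)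
  then have "AE z in unif. A.X z t = B.X z t"
    using integral_nonneg_eq_0_iff_AE[OF int] by simp
  then have "distr unif borel (quantile (rho1 t)) = distr unif borel (quantile (rho2 t))"
    by (intro distr_cong_AE) auto
  then show ?thesis using t by (simp add: distr_quantile A.rho_distribution B.rho_distribution)
qed

section \<open>Existence of a Lagrangian flow\<close>

text \<open>If \<open>f\<close> is not integrable its integral is 0 by convention, and the bound
  still holds because \<open>g\<close> is nonnegative on the interval.\<close>

lemma set_integral_antiderivative_bound:
  fixes f g G :: "real \<Rightarrow> real"
  assumes t: "0 \<le> t" and f: "\<And>s. 0 \<le> s \<Longrightarrow> s \<le> t \<Longrightarrow> \<bar>f s\<bar> \<le> g s"
    and G: "\<And>s. (G has_real_derivative g s) (at s)" and g: "continuous_on UNIV g"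
  shows "\<bar>LBINT s:{0..t}. f s\<bar> \<le> G t - G 0"
proof -
  have gi: "set_integrable lborel {0..t} g"
    by (intro borel_integrable_atLeastAtMost' continuous_on_subset[OF g]) auto
  have "(g has_integral G t - G 0) {0..t}"
    using t G by (intro fundamental_theorem_of_calculus)
      (auto simp flip: has_real_derivative_iff_has_vector_derivative intro: has_field_derivative_at_within)
  then have val: "(LBINT s:{0..t}. g s) = G t - G 0"
    using set_borel_integral_eq_integral(2)[OF gi] by (simp add: has_integral_iff)
  show ?thesis
  proof (cases "set_integrable lborel {0..t} f")
    case True
    have "\<bar>LBINT s:{0..t}. f s\<bar> \<le> (LBINT s:{0..t}. \<bar>f s\<bar>)"
      using set_integral_norm_bound[OF True] by simp
    also have "\<dots> \<le> (LBINT s:{0..t}. g s)"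
      using f by (intro set_integral_mono set_integrable_abs True gi) auto
    finally show ?thesis using val by simp
  next
    case False
    then have "(LBINT s:{0..t}. f s) = 0"
      unfolding set_integrable_def set_lebesgue_integral_def by (rule not_integrable_integral_eq)
    moreover have "0 \<le> (LBINT s:{0..t}. g s)"
      unfolding set_lebesgue_integral_def
      by (intro integral_nonneg_AE AE_I2) (auto simp: indicator_def intro: order_trans[OF abs_ge_zero f])
    ultimately show ?thesis using val by simp
  qed
qed

locale lagrangian_flow = nonlocal_kernel +
  fixes vt :: "real \<Rightarrow> real" and Lt :: real and x0 :: "real \<Rightarrow> real"
  assumes vt_diff: "\<And>x y. \<bar>vt x - vt y\<bar> \<le> Lt * \<bar>x - y\<bar>"
    and vt_decr: "\<And>r1 r2. r1 \<le> r2 \<Longrightarrow> vt r2 - vt r1 \<le> - b * (r2 - r1)"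
    and x0_int: "integrable unif x0"
    and x0_mono: "\<And>z1 z2. 0 < z1 \<Longrightarrow> z1 \<le> z2 \<Longrightarrow> z2 < 1 \<Longrightarrow> x0 z1 \<le> x0 z2"
begin

definition vel :: "(real \<Rightarrow> real) \<Rightarrow> real \<Rightarrow> real" where
  "vel Y z = vt (ubar Y (Y z) - lam * z)"

primrec picard :: "nat \<Rightarrow> real \<Rightarrow> real \<Rightarrow> real" where
  "picard 0 z t = x0 z"
| "picard (Suc n) z t = x0 z + (LBINT s:{0..t}. vel (\<lambda>\<zeta>. picard n \<zeta> s) z)"

text \<open>The weight relative to which all iterates are measured: a quantile function is in
  general unbounded near the ends of the unit interval.\<close>

definition \<omega> :: "real \<Rightarrow> real" where
  "\<omega> z = 1 + \<bar>x0 z\<bar>"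

definition \<kappa> :: real where
  "\<kappa> = (\<integral>z. \<omega> z \<partial>unif)"

definition L :: real where "L = Lt * LU"

text \<open>Chosen so that \<open>\<bar>Y\<bar> \<le> c * \<omega>\<close> with
  \<open>1 \<le> c\<close> implies \<open>\<bar>vel Y z\<bar> \<le> B * c * \<omega> z\<close>; it
  also dominates \<open>L * (1 + \<kappa>)\<close>, the Lipschitz constant of \<open>vel\<close> in
  the weighted norm.\<close>

definition B :: real where
  "B = \<bar>vt 0\<bar> + 2 * Lt * lam + L * (1 + \<kappa>)"

definition flow :: "real \<Rightarrow> real \<Rightarrow> real" where
  "flow z t = lim (\<lambda>n. picard n z t)"

lemma x0_measurable [measurable]: "x0 \<in> borel_measurable borel"
  using borel_measurable_integrable[OF x0_int] by simp

lemma Lt_nonneg: "0 \<le> Lt"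
  using vt_diff[of 0 1] by simp

lemma L_nonneg: "0 \<le> L"
  unfolding L_def using Lt_nonneg LU_nonneg by simp

lemma \<omega>_ge_1: "1 \<le> \<omega> z" and x0_le_\<omega>: "\<bar>x0 z\<bar> \<le> \<omega> z"
  by (auto simp: \<omega>_def)

lemma le_mult_\<omega>: "0 \<le> a \<Longrightarrow> a \<le> a * \<omega> z"
  using mult_left_mono[OF \<omega>_ge_1[of z], of a] by simp

lemma \<omega>_int: "integrable unif \<omega>"
  unfolding \<omega>_def[abs_def] using x0_int by auto

lemma \<kappa>_nonneg: "0 \<le> \<kappa>"
  unfolding \<kappa>_def using \<omega>_ge_1 by (intro integral_nonneg_AE AE_I2) (meson order_trans zero_le_one)

lemma B_nonneg: "0 \<le> B"
  unfolding B_def using Lt_nonneg lam_pos L_nonneg \<kappa>_nonneg by simp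

lemma vt_measurable [measurable]: "vt \<in> borel_measurable borel"
proof -
  have "Lt-lipschitz_on UNIV vt"
    using vt_diff Lt_nonneg by (intro lipschitz_onI) (auto simp: dist_real_def)
  then show ?thesis by (intro borel_measurable_continuous_onI lipschitz_on_continuous_on)
qed

lemma vel_bound:
  assumes Y: "integrable unif Y" and z: "0 < z" "z < 1"
  shows "\<bar>vel Y z\<bar> \<le> \<bar>vt 0\<bar> + 2 * Lt * lam + L * (\<bar>Y z\<bar> + (\<integral>\<zeta>. \<bar>Y \<zeta>\<bar> \<partial>unif))"
proof -
  have "\<bar>ubar Y (Y z) - ubar (\<lambda>_. 0) 0\<bar> \<le> LU * (\<bar>Y z - 0\<bar> + (\<integral>\<zeta>. \<bar>Y \<zeta> - 0\<bar> \<partial>unif))"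
    by (intro ubar_diff U_diff' Y) simp
  then have u: "\<bar>ubar Y (Y z)\<bar> \<le> lam + LU * (\<bar>Y z\<bar> + (\<integral>\<zeta>. \<bar>Y \<zeta>\<bar> \<partial>unif))"
    using lam_pos by (simp add: ubar_def U_0)
  have "\<bar>lam * z\<bar> \<le> lam" using z lam_pos by (simp add: abs_mult mult_left_le)
  then have "\<bar>ubar Y (Y z) - lam * z\<bar> \<le> 2 * lam + LU * (\<bar>Y z\<bar> + (\<integral>\<zeta>. \<bar>Y \<zeta>\<bar> \<partial>unif))"
    using u by linarith
  then have "Lt * \<bar>ubar Y (Y z) - lam * z\<bar> \<le> Lt * (2 * lam + LU * (\<bar>Y z\<bar> + (\<integral>\<zeta>. \<bar>Y \<zeta>\<bar> \<partial>unif)))"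
    by (rule mult_left_mono[OF _ Lt_nonneg])
  then show ?thesis
    using vt_diff[of "ubar Y (Y z) - lam * z" 0] by (simp add: vel_def L_def algebra_simps)
qed

lemma vel_diff:
  assumes "integrable unif Y" "integrable unif Y'"
  shows "\<bar>vel Y z - vel Y' z\<bar> \<le> L * (\<bar>Y z - Y' z\<bar> + (\<integral>\<zeta>. \<bar>Y \<zeta> - Y' \<zeta>\<bar> \<partial>unif))"
proof -
  have "\<bar>vel Y z - vel Y' z\<bar> \<le> Lt * \<bar>ubar Y (Y z) - ubar Y' (Y' z)\<bar>"
    using vt_diff[of "ubar Y (Y z) - lam * z" "ubar Y' (Y' z) - lam * z"] by (simp add: vel_def)
  also have "\<dots> \<le> Lt * (LU * (\<bar>Y z - Y' z\<bar> + (\<integral>\<zeta>. \<bar>Y \<zeta> - Y' \<zeta>\<bar> \<partial>unif)))"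
    by (intro mult_left_mono Lt_nonneg ubar_diff U_diff' assms)
  finally show ?thesis by (simp add: L_def mult.assoc)
qed

lemma vel_measurable:
  assumes G: "(\<lambda>w. G (fst w) (snd w)) \<in> borel_measurable (borel \<Otimes>\<^sub>M borel)"
  shows "(\<lambda>w. vel (\<lambda>\<zeta>. G \<zeta> (snd w)) (fst w)) \<in> borel_measurable (borel \<Otimes>\<^sub>M borel)"
proof -
  have [measurable]: "(\<lambda>q. G (snd q) (snd (fst q))) \<in> borel_measurable ((borel \<Otimes>\<^sub>M borel) \<Otimes>\<^sub>M unif)"
    by (rule measurable_compose[OF _ G, of "\<lambda>q. (snd q, snd (fst q))", simplified]) measurable
  have [measurable]: "(\<lambda>q. G (fst (fst q)) (snd (fst q))) \<in> borel_measurable ((borel \<Otimes>\<^sub>M borel) \<Otimes>\<^sub>M unif)"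
    by (rule measurable_compose[OF _ G, of "\<lambda>q. fst q", simplified]) measurable
  have "(\<lambda>w. ubar (\<lambda>\<zeta>. G \<zeta> (snd w)) (G (fst w) (snd w))) \<in> borel_measurable (borel \<Otimes>\<^sub>M borel)"
    unfolding ubar_def
    by (rule unif.borel_measurable_lebesgue_integral) (simp add: split_beta)
  then show ?thesis unfolding vel_def by measurable
qed

lemma joint_section:
  assumes "(\<lambda>w. G (fst w) (snd w)) \<in> borel_measurable (borel \<Otimes>\<^sub>M borel)"
  shows "(\<lambda>z. G z (t::real)) \<in> borel_measurable borel" "(\<lambda>t. G (z::real) t) \<in> borel_measurable borel"
  using measurable_compose[OF _ assms, of "\<lambda>z. (z, t)" borel] measurable_compose[OF _ assms, of "\<lambda>t. (z, t)" borel]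
  by simp_all

lemma primitive_measurable:
  fixes f :: "real \<Rightarrow> real \<Rightarrow> real"
  assumes f: "(\<lambda>w. f (fst w) (snd w)) \<in> borel_measurable (borel \<Otimes>\<^sub>M borel)"
  shows "(\<lambda>w. LBINT s:{0..snd w}. f (fst w) s) \<in> borel_measurable (borel \<Otimes>\<^sub>M (borel :: real measure))"
proof -
  have [measurable]: "(\<lambda>q. f (fst (fst q)) (snd q)) \<in> borel_measurable ((borel \<Otimes>\<^sub>M borel) \<Otimes>\<^sub>M lborel)"
    by (rule measurable_compose[OF _ f, of "\<lambda>q. (fst (fst q), snd q)", simplified]) measurable
  have ind: "indicator {0..snd w} s = (if 0 \<le> s \<and> s \<le> snd w then 1 else 0 :: real)" for w :: "real \<times> real" and s
    by (simp add: indicator_def)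
  show ?thesis
    unfolding set_lebesgue_integral_def ind
    by (rule lborel.borel_measurable_lebesgue_integral) (simp add: split_beta)
qed

section \<open>Weighted estimates for the Picard iterates\<close>

lemma picard_measurable: "(\<lambda>w. picard n (fst w) (snd w)) \<in> borel_measurable (borel \<Otimes>\<^sub>M borel)"
proof (induction n)
  case (Suc n)
  have "(\<lambda>w. LBINT s:{0..snd w}. vel (\<lambda>\<zeta>. picard n \<zeta> s) (fst w)) \<in> borel_measurable (borel \<Otimes>\<^sub>M borel)"
    by (rule primitive_measurable[of "\<lambda>z s. vel (\<lambda>\<zeta>. picard n \<zeta> s) z"]) (rule vel_measurable[OF Suc])
  then show ?case by simp
qed simp

lemma weighted_integrable:
  assumes [measurable]: "Y \<in> borel_measurable borel" and b: "\<And>z. 0 < z \<Longrightarrow> z < 1 \<Longrightarrow> \<bar>Y z\<bar> \<le> c * \<omega> z"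
  shows "integrable unif Y" "(\<integral>z. \<bar>Y z\<bar> \<partial>unif) \<le> c * \<kappa>"
proof -
  have ci: "integrable unif (\<lambda>z. c * \<omega> z)" using \<omega>_int by simp
  show int: "integrable unif Y"
    by (rule Bochner_Integration.integrable_bound[OF ci])
      (use b in \<open>auto intro!: AE_unifI intro: order_trans[OF _ abs_ge_self]\<close>)
  have "(\<integral>z. \<bar>Y z\<bar> \<partial>unif) \<le> (\<integral>z. c * \<omega> z \<partial>unif)"
    by (intro integral_mono_AE ci integrable_abs int AE_unifI b)
  then show "(\<integral>z. \<bar>Y z\<bar> \<partial>unif) \<le> c * \<kappa>" by (simp add: \<kappa>_def)
qed

lemma vel_weighted:
  assumes Y: "Y \<in> borel_measurable borel" and b: "\<And>z. 0 < z \<Longrightarrow> z < 1 \<Longrightarrow> \<bar>Y z\<bar> \<le> c * \<omega> z" and c: "1 \<le> c"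
    and z: "0 < z" "z < 1"
  shows "\<bar>vel Y z\<bar> \<le> B * c * \<omega> z"
proof -
  have w: "integrable unif Y" "(\<integral>z. \<bar>Y z\<bar> \<partial>unif) \<le> c * \<kappa>"
    using weighted_integrable[OF Y, of c] b by blast+
  have "\<bar>Y z\<bar> + (\<integral>\<zeta>. \<bar>Y \<zeta>\<bar> \<partial>unif) \<le> c * \<omega> z + c * \<kappa> * \<omega> z"
  proof (intro add_mono b z order_trans[OF w(2)])
    show "c * \<kappa> \<le> c * \<kappa> * \<omega> z"
      using c \<kappa>_nonneg by (intro le_mult_\<omega>) simp
  qed
  then have "L * (\<bar>Y z\<bar> + (\<integral>\<zeta>. \<bar>Y \<zeta>\<bar> \<partial>unif)) \<le> L * (c * \<omega> z + c * \<kappa> * \<omega> z)"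
    by (rule mult_left_mono[OF _ L_nonneg])
  moreover have "\<bar>vt 0\<bar> + 2 * Lt * lam \<le> (\<bar>vt 0\<bar> + 2 * Lt * lam) * (c * \<omega> z)"
    using c \<omega>_ge_1[of z] Lt_nonneg lam_pos mult_mono[of 1 c 1 "\<omega> z"]
      mult_left_mono[of 1 "c * \<omega> z" "\<bar>vt 0\<bar> + 2 * Lt * lam"] by simp
  ultimately have "\<bar>vel Y z\<bar> \<le> (\<bar>vt 0\<bar> + 2 * Lt * lam) * (c * \<omega> z) + L * (c * \<omega> z + c * \<kappa> * \<omega> z)"
    by (intro order_trans[OF vel_bound[OF w(1) z]] add_mono)
  then show ?thesis by (simp add: B_def algebra_simps)
qed

text \<open>\<open>exp (B * t) * \<omega> z\<close> reproduces itself under the iteration: its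
  velocity bound integrates to \<open>exp (B * t) * \<omega> z - \<omega> z\<close>, and the initial
  value is at most \<open>\<omega> z\<close>.\<close>

lemma picard_bound:
  assumes "0 \<le> t" "0 < z" "z < 1"
  shows "\<bar>picard n z t\<bar> \<le> exp (B * t) * \<omega> z"
  using assms
proof (induction n arbitrary: z t)
  case 0
  have "1 * \<bar>x0 z\<bar> \<le> exp (B * t) * \<omega> z"
    using 0 B_nonneg x0_le_\<omega>[of z] by (intro mult_mono) auto
  then show ?case by simp
next
  case (Suc n)
  have "\<bar>LBINT s:{0..t}. vel (\<lambda>\<zeta>. picard n \<zeta> s) z\<bar> \<le> exp (B * t) * \<omega> z - exp (B * 0) * \<omega> z"
  proof (rule set_integral_antiderivative_bound[where g = "\<lambda>s. B * exp (B * s) * \<omega> z"])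
    show "\<bar>vel (\<lambda>\<zeta>. picard n \<zeta> s) z\<bar> \<le> B * exp (B * s) * \<omega> z" if "0 \<le> s" for s
      using that Suc B_nonneg by (intro vel_weighted joint_section[OF picard_measurable]) auto
    show "((\<lambda>s. exp (B * s) * \<omega> z) has_real_derivative B * exp (B * s) * \<omega> z) (at s)" for s
      by (auto intro!: derivative_eq_intros)
  qed (use Suc in \<open>auto intro!: continuous_intros\<close>)
  then have "\<bar>LBINT s:{0..t}. vel (\<lambda>\<zeta>. picard n \<zeta> s) z\<bar> \<le> exp (B * t) * \<omega> z - \<omega> z"
    by simp
  then show ?case using x0_le_\<omega>[of z] unfolding picard.simps by linarith
qed

lemma picard_int: "0 \<le> t \<Longrightarrow> integrable unif (\<lambda>z. picard n z t)"
  by (rule weighted_integrable[OF joint_section(1)[OF picard_measurable] picard_bound]) auto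

lemma vel_set_integrable:
  assumes G: "(\<lambda>w. G (fst w) (snd w)) \<in> borel_measurable (borel \<Otimes>\<^sub>M borel)"
    and b: "\<And>z t. 0 \<le> t \<Longrightarrow> 0 < z \<Longrightarrow> z < 1 \<Longrightarrow> \<bar>G z t\<bar> \<le> exp (B * t) * \<omega> z"
    and z: "0 < z" "z < 1"
  shows "set_integrable lborel {0..t} (\<lambda>s. vel (\<lambda>\<zeta>. G \<zeta> s) z)"
  unfolding set_integrable_def
proof (rule Bochner_Integration.integrable_bound)
  show "integrable lborel (\<lambda>s. indicator {0..t} s *\<^sub>R (B * exp (B * t) * \<omega> z))"
    using borel_integrable_atLeastAtMost'[of 0 t "\<lambda>s. B * exp (B * t) * \<omega> z"]
    by (auto simp: set_integrable_def)
  show "(\<lambda>s. indicator {0..t} s *\<^sub>R vel (\<lambda>\<zeta>. G \<zeta> s) z) \<in> borel_measurable lborel"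
    using joint_section(2)[OF vel_measurable[OF G], of z] by simp
  have "\<bar>vel (\<lambda>\<zeta>. G \<zeta> s) z\<bar> \<le> B * exp (B * t) * \<omega> z" if s: "0 \<le> s" "s \<le> t" for s
  proof -
    have "\<bar>vel (\<lambda>\<zeta>. G \<zeta> s) z\<bar> \<le> B * exp (B * s) * \<omega> z"
      using s b z B_nonneg by (intro vel_weighted joint_section[OF G]) auto
    also have "\<dots> \<le> B * exp (B * t) * \<omega> z"
      using s B_nonneg \<omega>_ge_1[of z] by (intro mult_right_mono mult_left_mono) (auto intro: mult_left_mono)
    finally show ?thesis .
  qed
  then show "AE s in lborel. norm (indicator {0..t} s *\<^sub>R vel (\<lambda>\<zeta>. G \<zeta> s) z) \<le> norm (indicator {0..t} s *\<^sub>R (B * exp (B * t) * \<omega> z))"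
    by (auto intro!: AE_I2 simp: indicator_def intro: order_trans[OF _ abs_ge_self])
qed

text \<open>The factorial estimate of Picard iteration. The mean of the previous difference costs a
  factor \<open>\<kappa>\<close>, which is absorbed through
  \<open>L * (1 + \<kappa>) \<le> B\<close> because \<open>\<omega> z \<ge> 1\<close>.\<close>

lemma picard_diff:
  assumes "0 \<le> t" "0 < z" "z < 1"
  shows "\<bar>picard (Suc n) z t - picard n z t\<bar> \<le> (B * t) ^ Suc n / fact (Suc n) * \<omega> z"
  using assms
proof (induction n arbitrary: z t)
  case 0
  have "\<bar>LBINT s:{0..t}. vel x0 z\<bar> \<le> B * \<omega> z * t - B * \<omega> z * 0"
  proof (rule set_integral_antiderivative_bound[where g = "\<lambda>s. B * \<omega> z"])
    show "\<bar>vel x0 z\<bar> \<le> B * \<omega> z" using vel_weighted[of x0 1 z] x0_le_\<omega> 0 by simp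
  qed (use 0 in \<open>auto intro!: derivative_eq_intros continuous_intros\<close>)
  then show ?case by (simp add: mult.commute mult.left_commute)
next
  case (Suc n)
  let ?f = "\<lambda>n s. vel (\<lambda>\<zeta>. picard n \<zeta> s) z"
  have int: "set_integrable lborel {0..t} (?f n)" for n
    by (rule vel_set_integrable[OF picard_measurable picard_bound Suc.prems(2,3)])
  let ?c = "\<lambda>s. (B * s) ^ Suc n / fact (Suc n)"
  let ?G = "\<lambda>s. (B * s) ^ Suc (Suc n) / fact (Suc (Suc n)) * \<omega> z"
  have "\<bar>LBINT s:{0..t}. ?f (Suc n) s - ?f n s\<bar> \<le> ?G t - ?G 0"
  proof (rule set_integral_antiderivative_bound[where g = "\<lambda>s. B * ?c s * \<omega> z"])
    fix s assume s: "0 \<le> s" "s \<le> t"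
    have c0: "0 \<le> ?c s" using B_nonneg s by simp
    have m: "(\<lambda>z. picard (Suc n) z s - picard n z s) \<in> borel_measurable borel"
      by (intro borel_measurable_diff joint_section[OF picard_measurable])
    have w: "(\<integral>\<zeta>. \<bar>picard (Suc n) \<zeta> s - picard n \<zeta> s\<bar> \<partial>unif) \<le> ?c s * \<kappa>"
      by (rule weighted_integrable(2)[OF m Suc.IH[OF s(1)]])
    have alg: "L * (c * \<omega> z + c * \<kappa> * \<omega> z) = L * (1 + \<kappa>) * (c * \<omega> z)" for c
      by (simp add: algebra_simps)
    have "\<bar>?f (Suc n) s - ?f n s\<bar> \<le> L * (\<bar>picard (Suc n) z s - picard n z s\<bar> + (\<integral>\<zeta>. \<bar>picard (Suc n) \<zeta> s - picard n \<zeta> s\<bar> \<partial>unif))"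
      by (intro vel_diff picard_int s)
    also have "\<dots> \<le> L * (?c s * \<omega> z + ?c s * \<kappa> * \<omega> z)"
    proof (intro mult_left_mono L_nonneg add_mono Suc.IH Suc.prems s order_trans[OF w])
      show "?c s * \<kappa> \<le> ?c s * \<kappa> * \<omega> z"
        by (intro le_mult_\<omega> mult_nonneg_nonneg c0 \<kappa>_nonneg)
    qed
    also have "\<dots> = L * (1 + \<kappa>) * (?c s * \<omega> z)" by (rule alg)
    also have "\<dots> \<le> B * (?c s * \<omega> z)"
    proof (rule mult_right_mono)
      show "L * (1 + \<kappa>) \<le> B" using Lt_nonneg lam_pos by (simp add: B_def)
      show "0 \<le> ?c s * \<omega> z" using c0 \<omega>_ge_1[of z] by (intro mult_nonneg_nonneg) auto
    qed
    finally show "\<bar>?f (Suc n) s - ?f n s\<bar> \<le> B * ?c s * \<omega> z" by (simp add: mult.assoc)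
  next
    fix s
    show "(?G has_real_derivative B * ?c s * \<omega> z) (at s)"
    proof -
      have "(?G has_real_derivative (real (Suc (Suc n)) * ((B * 1) * (B * s) ^ (Suc (Suc n) - Suc 0))) / fact (Suc (Suc n)) * \<omega> z) (at s)"
        by (rule derivative_eq_intros refl | simp)+
      moreover have "(real (Suc (Suc n)) * ((B * 1) * (B * s) ^ (Suc (Suc n) - Suc 0))) / fact (Suc (Suc n)) = B * ?c s"
        by (simp add: fact_Suc[of "Suc n"] del: power_Suc fact_Suc)
      ultimately show ?thesis by simp
    qed
    show "continuous_on UNIV (\<lambda>s. B * ?c s * \<omega> z)" by (intro continuous_intros) simp
  qed (use Suc in auto)
  moreover have "(LBINT s:{0..t}. ?f (Suc n) s - ?f n s) = (LBINT s:{0..t}. ?f (Suc n) s) - (LBINT s:{0..t}. ?f n s)"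
    by (rule set_integral_diff(2)[OF int int])
  ultimately show ?case by (simp only: picard.simps(2)[of "Suc n"] picard.simps(2)[of n]) simp
qed

lemma picard_tendsto:
  assumes "0 \<le> t" "0 < z" "z < 1"
  shows "(\<lambda>n. picard n z t) \<longlonglongrightarrow> flow z t"
proof -
  have "summable (\<lambda>n. (B * t) ^ n / fact n)"
    using summable_exp[of "B * t"] by (simp add: divide_inverse mult.commute)
  then have "summable (\<lambda>n. (B * t) ^ Suc n / fact (Suc n))" by (rule summable_Suc_iff[THEN iffD2])
  then have "summable (\<lambda>n. (B * t) ^ Suc n / fact (Suc n) * \<omega> z)" by (rule summable_mult2)
  then have "summable (\<lambda>n. picard (Suc n) z t - picard n z t)"
    by (rule summable_comparison_test'[where N = 0]) (simp only: real_norm_def picard_diff[OF assms])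
  then have "convergent (\<lambda>n. picard n z t - picard 0 z t)"
    unfolding summable_iff_convergent sum_lessThan_telescope[of "\<lambda>n. picard n z t"] .
  then obtain l where "(\<lambda>n. picard n z t - picard 0 z t) \<longlonglongrightarrow> l"
    by (auto simp only: convergent_def)
  from tendsto_add[OF this tendsto_const[of "picard 0 z t"]]
  have "convergent (\<lambda>n. picard n z t)"
    unfolding convergent_def by (auto simp only: diff_add_cancel)
  then show ?thesis unfolding flow_def convergent_LIMSEQ_iff .
qed

section \<open>The limiting flow and its differential equation\<close>

lemma flow_measurable: "(\<lambda>w. flow (fst w) (snd w)) \<in> borel_measurable (borel \<Otimes>\<^sub>M borel)"
  unfolding flow_def by (intro borel_measurable_lim_metric picard_measurable)

lemma flow_bound:
  assumes "0 \<le> t" "0 < z" "z < 1"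
  shows "\<bar>flow z t\<bar> \<le> exp (B * t) * \<omega> z"
  by (rule LIMSEQ_le_const2[OF tendsto_rabs[OF picard_tendsto[OF assms]]])
    (intro exI[of _ 0] allI impI picard_bound[OF assms])

lemma flow_int: "0 \<le> t \<Longrightarrow> integrable unif (\<lambda>z. flow z t)"
  by (rule weighted_integrable[OF joint_section(1)[OF flow_measurable] flow_bound]) auto

text \<open>\<open>vel\<close> depends on the whole profile, so pointwise convergence is not enough.
  Convergence in mean comes from domination by a multiple of \<open>\<omega>\<close>.\<close>

lemma vel_picard_tendsto:
  assumes s: "0 \<le> s" and z: "0 < z" "z < 1"
  shows "(\<lambda>n. vel (\<lambda>\<zeta>. picard n \<zeta> s) z) \<longlonglongrightarrow> vel (\<lambda>\<zeta>. flow \<zeta> s) z"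
proof -
  note m [measurable] = joint_section(1)[OF picard_measurable, of _ s] joint_section(1)[OF flow_measurable, of s]
  have "(\<lambda>n. \<integral>\<zeta>. \<bar>picard n \<zeta> s - flow \<zeta> s\<bar> \<partial>unif) \<longlonglongrightarrow> (\<integral>\<zeta>. 0 \<partial>unif)"
  proof (rule integral_dominated_convergence[where w = "\<lambda>\<zeta>. 2 * exp (B * s) * \<omega> \<zeta>"])
    show "AE \<zeta> in unif. (\<lambda>n. \<bar>picard n \<zeta> s - flow \<zeta> s\<bar>) \<longlonglongrightarrow> 0"
    proof (rule AE_unifI)
      fix \<zeta> :: real assume "0 < \<zeta>" "\<zeta> < 1"
      from tendsto_rabs[OF tendsto_diff[OF picard_tendsto[OF s this] tendsto_const[of "flow \<zeta> s"]]]
      show "(\<lambda>n. \<bar>picard n \<zeta> s - flow \<zeta> s\<bar>) \<longlonglongrightarrow> 0" by simp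
    qed
    show "AE \<zeta> in unif. norm \<bar>picard n \<zeta> s - flow \<zeta> s\<bar> \<le> 2 * exp (B * s) * \<omega> \<zeta>" for n
    proof (rule AE_unifI)
      fix \<zeta> :: real assume "0 < \<zeta>" "\<zeta> < 1"
      from picard_bound[OF s this, of n] flow_bound[OF s this]
      show "norm \<bar>picard n \<zeta> s - flow \<zeta> s\<bar> \<le> 2 * exp (B * s) * \<omega> \<zeta>" by simp
    qed
  qed (use \<omega>_int in \<open>auto simp: m\<close>)
  moreover have "(\<lambda>n. \<bar>picard n z s - flow z s\<bar>) \<longlonglongrightarrow> 0"
    using tendsto_rabs[OF tendsto_diff[OF picard_tendsto[OF s z] tendsto_const[of "flow z s"]]] by simp
  ultimately have "(\<lambda>n. L * (\<bar>picard n z s - flow z s\<bar> + (\<integral>\<zeta>. \<bar>picard n \<zeta> s - flow \<zeta> s\<bar> \<partial>unif))) \<longlonglongrightarrow> L * (0 + 0)"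
    by (intro tendsto_intros) simp_all
  then have "(\<lambda>n. vel (\<lambda>\<zeta>. picard n \<zeta> s) z - vel (\<lambda>\<zeta>. flow \<zeta> s) z) \<longlonglongrightarrow> 0"
  proof (rule Lim_null_comparison[rotated, OF tendsto_eq_rhs])
    show "\<forall>\<^sub>F n in sequentially. norm (vel (\<lambda>\<zeta>. picard n \<zeta> s) z - vel (\<lambda>\<zeta>. flow \<zeta> s) z)
      \<le> L * (\<bar>picard n z s - flow z s\<bar> + (\<integral>\<zeta>. \<bar>picard n \<zeta> s - flow \<zeta> s\<bar> \<partial>unif))"
      unfolding real_norm_def by (intro always_eventually allI vel_diff picard_int flow_int s)
  qed simp
  then show ?thesis by (simp add: LIM_zero_iff)
qed

lemma flow_integral_eq:
  assumes t: "0 \<le> t" and z: "0 < z" "z < 1"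
  shows "flow z t = x0 z + (LBINT s:{0..t}. vel (\<lambda>\<zeta>. flow \<zeta> s) z)"
proof -
  have "(\<lambda>n. LBINT s:{0..t}. vel (\<lambda>\<zeta>. picard n \<zeta> s) z) \<longlonglongrightarrow> (LBINT s:{0..t}. vel (\<lambda>\<zeta>. flow \<zeta> s) z)"
    unfolding set_lebesgue_integral_def
  proof (rule integral_dominated_convergence[where w = "\<lambda>s. indicator {0..t} s *\<^sub>R (B * exp (B * s) * \<omega> z)"])
    show "(\<lambda>s. indicator {0..t} s *\<^sub>R vel (\<lambda>\<zeta>. picard n \<zeta> s) z) \<in> borel_measurable lborel" for n
      using joint_section(2)[OF vel_measurable[OF picard_measurable], where z = z] by simp
    show "(\<lambda>s. indicator {0..t} s *\<^sub>R vel (\<lambda>\<zeta>. flow \<zeta> s) z) \<in> borel_measurable lborel"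
      using joint_section(2)[OF vel_measurable[OF flow_measurable], where z = z] by simp
    show "integrable lborel (\<lambda>s. indicator {0..t} s *\<^sub>R (B * exp (B * s) * \<omega> z))"
    proof -
      have "continuous_on {0..t} (\<lambda>s. B * exp (B * s) * \<omega> z)" by (intro continuous_intros)
      from borel_integrable_atLeastAtMost'[OF this] show ?thesis by (simp add: set_integrable_def)
    qed
    show "AE s in lborel. (\<lambda>n. indicator {0..t} s *\<^sub>R vel (\<lambda>\<zeta>. picard n \<zeta> s) z) \<longlonglongrightarrow> indicator {0..t} s *\<^sub>R vel (\<lambda>\<zeta>. flow \<zeta> s) z"
      using vel_picard_tendsto[OF _ z] by (intro AE_I2) (auto simp: indicator_def)
    show "AE s in lborel. norm (indicator {0..t} s *\<^sub>R vel (\<lambda>\<zeta>. picard n \<zeta> s) z) \<le> indicator {0..t} s *\<^sub>R (B * exp (B * s) * \<omega> z)" for n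
    proof (rule AE_I2)
      fix s
      have "\<bar>vel (\<lambda>\<zeta>. picard n \<zeta> s) z\<bar> \<le> B * exp (B * s) * \<omega> z" if "0 \<le> s"
        using that z B_nonneg by (intro vel_weighted joint_section[OF picard_measurable] picard_bound) auto
      then show "norm (indicator {0..t} s *\<^sub>R vel (\<lambda>\<zeta>. picard n \<zeta> s) z) \<le> indicator {0..t} s *\<^sub>R (B * exp (B * s) * \<omega> z)"
        by (auto simp: indicator_def)
    qed
  qed
  then have "(\<lambda>n. picard (Suc n) z t) \<longlonglongrightarrow> x0 z + (LBINT s:{0..t}. vel (\<lambda>\<zeta>. flow \<zeta> s) z)"
    unfolding picard.simps by (intro tendsto_intros)
  moreover have "(\<lambda>n. picard (Suc n) z t) \<longlonglongrightarrow> flow z t"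
    using picard_tendsto[OF assms] by (rule LIMSEQ_Suc)
  ultimately show ?thesis by (rule LIMSEQ_unique[rotated])
qed

lemma flow_vel_bound:
  assumes "0 \<le> s" "s \<le> T" "0 < z" "z < 1"
  shows "\<bar>vel (\<lambda>\<zeta>. flow \<zeta> s) z\<bar> \<le> B * exp (B * T) * \<omega> z"
proof -
  have "\<bar>vel (\<lambda>\<zeta>. flow \<zeta> s) z\<bar> \<le> B * exp (B * s) * \<omega> z"
    using assms B_nonneg by (intro vel_weighted joint_section[OF flow_measurable] flow_bound) auto
  also have "\<dots> \<le> B * exp (B * T) * \<omega> z"
    using assms B_nonneg \<omega>_ge_1[of z] by (intro mult_right_mono mult_left_mono) (auto intro: mult_left_mono)
  finally show ?thesis .
qed

lemma flow_eq_integral: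
  assumes t: "0 \<le> t" and z: "0 < z" "z < 1"
  shows "(\<lambda>s. vel (\<lambda>\<zeta>. flow \<zeta> s) z) integrable_on {0..t}"
    "flow z t = x0 z + integral {0..t} (\<lambda>s. vel (\<lambda>\<zeta>. flow \<zeta> s) z)"
  using set_borel_integral_eq_integral[OF vel_set_integrable[OF flow_measurable flow_bound z, of t]] flow_integral_eq[OF t z]
  by auto

lemma flow_0: "0 < z \<Longrightarrow> z < 1 \<Longrightarrow> flow z 0 = x0 z"
  using flow_eq_integral(2)[of 0 z] by simp

lemma flow_lipschitz:
  assumes s: "0 \<le> s" "s \<le> T" and t: "0 \<le> t" "t \<le> T" and z: "0 < z" "z < 1"
  shows "\<bar>flow z t - flow z s\<bar> \<le> B * exp (B * T) * \<bar>t - s\<bar> * \<omega> z"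
proof -
  let ?f = "\<lambda>s. vel (\<lambda>\<zeta>. flow \<zeta> s) z"
  have main: "\<bar>flow z t - flow z s\<bar> \<le> B * exp (B * T) * (t - s) * \<omega> z" if "0 \<le> s" "s \<le> t" "t \<le> T" for s t
  proof -
    have "integral {0..s} ?f + integral {s..t} ?f = integral {0..t} ?f"
      using that flow_eq_integral(1)[of t z] z by (intro Henstock_Kurzweil_Integration.integral_combine) auto
    then have d: "flow z t - flow z s = integral {s..t} ?f"
      using flow_eq_integral(2)[of t z] flow_eq_integral(2)[of s z] that z by simp
    have "?f integrable_on {s..t}"
      using flow_eq_integral(1)[of t z] that z by (auto intro: integrable_on_subinterval)
    then have "norm (integral {s..t} ?f) \<le> (B * exp (B * T) * \<omega> z) * measure lborel {s..t}"
      using that z B_nonneg \<omega>_ge_1[of z]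
      by (intro has_integral_bound_real[OF _ finite.emptyI integrable_integral]) (auto intro!: flow_vel_bound mult_nonneg_nonneg)
    then show ?thesis using that by (simp add: d ac_simps)
  qed
  show ?thesis
  proof (cases "s \<le> t")
    case True
    then show ?thesis using main[of s t] s t by simp
  next
    case False
    then show ?thesis using main[of t s] s t by (simp add: abs_minus_commute)
  qed
qed

lemma flow_L1_lipschitz:
  assumes s: "0 \<le> s" "s \<le> T" and t: "0 \<le> t" "t \<le> T"
  shows "(\<integral>z. \<bar>flow z t - flow z s\<bar> \<partial>unif) \<le> B * exp (B * T) * \<bar>t - s\<bar> * \<kappa>"
  by (rule weighted_integrable(2))
    (use s t in \<open>auto intro!: flow_lipschitz borel_measurable_diff joint_section[OF flow_measurable]\<close>)

text \<open>The flow is Lipschitz in time both at a fixed label and in mean, hence so is its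
  velocity on bounded time intervals; the integral equation can therefore be differentiated at every
  positive time.\<close>

lemma continuous_on_flow_vel:
  assumes z: "0 < z" "z < 1"
  shows "continuous_on {0..} (\<lambda>s. vel (\<lambda>\<zeta>. flow \<zeta> s) z)"
  unfolding continuous_on_eq_continuous_within
proof
  let ?f = "\<lambda>s. vel (\<lambda>\<zeta>. flow \<zeta> s) z"
  fix t :: real assume "t \<in> {0..}"
  then have t: "0 \<le> t" by auto
  define T where "T = t + 1"
  define C where "C = L * (B * exp (B * T) * \<omega> z + B * exp (B * T) * \<kappa>)"
  have lip: "\<bar>?f s - ?f t\<bar> \<le> C * \<bar>s - t\<bar>" if s: "0 \<le> s" "s \<le> T" for s
  proof -
    have tT: "t \<le> T" by (simp add: T_def)
    have "\<bar>?f s - ?f t\<bar> \<le> L * (\<bar>flow z s - flow z t\<bar> + (\<integral>\<zeta>. \<bar>flow \<zeta> s - flow \<zeta> t\<bar> \<partial>unif))"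
      using s t by (intro vel_diff flow_int) auto
    also have "\<dots> \<le> L * (B * exp (B * T) * \<bar>s - t\<bar> * \<omega> z + B * exp (B * T) * \<bar>s - t\<bar> * \<kappa>)"
      using flow_lipschitz[OF t tT s z] flow_L1_lipschitz[OF t tT s]
      by (intro mult_left_mono L_nonneg add_mono) auto
    finally show ?thesis by (simp add: C_def algebra_simps)
  qed
  have "((\<lambda>s. ?f s - ?f t) \<longlongrightarrow> 0) (at t within {0..})"
  proof (rule Lim_null_comparison[where g = "\<lambda>s. C * \<bar>s - t\<bar>"])
    have "\<forall>\<^sub>F s in at t within {0..}. s < T"
      by (rule order_tendstoD(2)[OF tendsto_ident_at]) (simp add: T_def)
    moreover have "\<forall>\<^sub>F s in at t within {0..}. 0 \<le> s"
      by (auto simp: eventually_at_filter)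
    ultimately show "\<forall>\<^sub>F s in at t within {0..}. norm (?f s - ?f t) \<le> C * \<bar>s - t\<bar>"
      by eventually_elim (use lip in auto)
    show "((\<lambda>s. C * \<bar>s - t\<bar>) \<longlongrightarrow> 0) (at t within {0..})"
      by (auto intro!: tendsto_eq_intros)
  qed
  then show "continuous (at t within {0..}) ?f"
    by (simp add: continuous_within LIM_zero_iff)
qed

lemma flow_deriv:
  assumes t: "0 < t" and z: "0 < z" "z < 1"
  shows "(flow z has_real_derivative vel (\<lambda>\<zeta>. flow \<zeta> t) z) (at t)"
proof -
  let ?f = "\<lambda>s. vel (\<lambda>\<zeta>. flow \<zeta> s) z"
  have "continuous_on {0..t + 1} ?f"
    by (rule continuous_on_subset[OF continuous_on_flow_vel[OF z]]) auto
  then have "((\<lambda>s. integral {0..s} ?f) has_real_derivative ?f t) (at t within {0..t + 1})"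
    using t by (intro integral_has_real_derivative) auto
  then have "((\<lambda>s. x0 z + integral {0..s} ?f) has_real_derivative ?f t) (at t within {0..t + 1})"
    by (auto intro!: derivative_eq_intros)
  then have "((\<lambda>s. x0 z + integral {0..s} ?f) has_real_derivative ?f t) (at t)"
    using t by (simp add: at_within_Icc_at)
  then show ?thesis
    by (rule has_field_derivative_transform_within_open[where S = "{0<..}"])
      (use t z flow_eq_integral(2) in auto)
qed

lemma continuous_on_flow:
  assumes z: "0 < z" "z < 1"
  shows "continuous_on {0..T} (flow z)"
proof (rule lipschitz_on_continuous_on)
  show "(B * exp (B * T) * \<omega> z)-lipschitz_on {0..T} (flow z)"
    using flow_lipschitz[OF _ _ _ _ z] B_nonneg \<omega>_ge_1[of z]
    by (intro lipschitz_onI mult_nonneg_nonneg) (auto simp: dist_real_def ac_simps)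
qed

text \<open>Here \<open>vt\<close> decreases everywhere, so its arguments need not yet be known as
  convolution values. The integral equation starts at time 0, so no limit in the starting time is
  taken.\<close>

lemma flow_expand:
  assumes z: "0 < z1" "z1 \<le> z2" "z2 < 1" and t: "0 \<le> t"
  shows "b * lam * (z2 - z1) * growth L t \<le> flow z2 t - flow z1 t"
proof -
  have "b * lam * (z2 - z1) * growth L (t - 0) \<le> flow z2 t - flow z1 t"
  proof (rule expansion_lower_bound[where d = "\<lambda>t. flow z2 t - flow z1 t" and s = 0, OF t])
    show "0 \<le> b * lam * (z2 - z1)" using b_pos lam_pos z by simp
    show "0 \<le> flow z2 0 - flow z1 0" using x0_mono[OF z] z by (simp add: flow_0)
    show "continuous_on {0..t} (\<lambda>t. flow z2 t - flow z1 t)"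
      using z by (intro continuous_intros continuous_on_flow) auto
    fix \<tau> assume \<tau>: "0 < \<tau>" "\<tau> < t"
    let ?Y = "\<lambda>\<zeta>. flow \<zeta> \<tau>"
    have "((\<lambda>t. flow z2 t - flow z1 t) has_real_derivative vel ?Y z2 - vel ?Y z1) (at \<tau>)"
      using z \<tau> by (intro derivative_intros flow_deriv) auto
    moreover have "b * lam * (z2 - z1) - L * \<bar>flow z2 \<tau> - flow z1 \<tau>\<bar> \<le> vel ?Y z2 - vel ?Y z1"
    proof -
      have Y: "integrable unif ?Y" using \<tau> by (intro flow_int) simp
      have "vt (ubar ?Y (?Y z2) - lam * z1) - vt (ubar ?Y (?Y z2) - lam * z2) \<le> - b * (lam * (z2 - z1))"
        using vt_decr[of "ubar ?Y (?Y z2) - lam * z2" "ubar ?Y (?Y z2) - lam * z1"] lam_pos z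
        by (simp add: algebra_simps)
      moreover have "\<bar>vt (ubar ?Y (?Y z2) - lam * z1) - vt (ubar ?Y (?Y z1) - lam * z1)\<bar> \<le> L * \<bar>?Y z2 - ?Y z1\<bar>"
      proof -
        have "\<bar>ubar ?Y (?Y z2) - ubar ?Y (?Y z1)\<bar> \<le> LU * \<bar>?Y z2 - ?Y z1\<bar>"
          using ubar_diff[OF U_diff' Y Y, of "?Y z2" "?Y z1"] by simp
        then have "Lt * \<bar>ubar ?Y (?Y z2) - ubar ?Y (?Y z1)\<bar> \<le> Lt * (LU * \<bar>?Y z2 - ?Y z1\<bar>)"
          by (rule mult_left_mono[OF _ Lt_nonneg])
        then show ?thesis
          using vt_diff[of "ubar ?Y (?Y z2) - lam * z1" "ubar ?Y (?Y z1) - lam * z1"]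
          by (simp add: L_def mult.assoc)
      qed
      ultimately show ?thesis unfolding vel_def by (simp add: algebra_simps)
    qed
    ultimately show "\<exists>D. ((\<lambda>t. flow z2 t - flow z1 t) has_real_derivative D) (at \<tau>) \<and> b * lam * (z2 - z1) - L * \<bar>flow z2 \<tau> - flow z1 \<tau>\<bar> \<le> D"
      by blast
  qed (use L_nonneg in auto)
  then show ?thesis by simp
qed

lemma flow_strict_mono:
  assumes "0 < z1" "z1 < z2" "z2 < 1" "0 < t"
  shows "flow z1 t < flow z2 t"
proof -
  have "0 < b * lam * (z2 - z1) * growth L t"
    using assms b_pos lam_pos growth_pos[OF L_nonneg, of t] by simp
  then show ?thesis using flow_expand[of z1 z2 t] assms by simp
qed

text \<open>Strict monotonicity in the label gives the particles to the left of
  \<open>flow z t\<close> total mass exactly \<open>z\<close>.\<close>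

lemma flow_conv:
  assumes t: "0 < t" and z: "0 < z" "z < 1"
  shows "conv_measure V (distr unif borel (\<lambda>\<zeta>. flow \<zeta> t)) (flow z t) = ubar (\<lambda>\<zeta>. flow \<zeta> t) (flow z t) - lam * z"
proof -
  have [measurable]: "(\<lambda>\<zeta>. flow \<zeta> t) \<in> borel_measurable borel" by (rule joint_section[OF flow_measurable])
  have iff: "flow \<zeta> t < flow z t \<longleftrightarrow> \<zeta> < z" if "0 < \<zeta>" "\<zeta> < 1" for \<zeta>
    using flow_strict_mono[of \<zeta> z t] flow_strict_mono[of z \<zeta> t] that t z by (cases \<zeta> z rule: linorder_cases) auto
  have "measure unif {\<zeta>. flow \<zeta> t < flow z t} \<le> z - 0"
    using z iff by (intro measure_unif_le) (auto intro: less_imp_le)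
  moreover have "z - 0 \<le> measure unif {\<zeta>. flow \<zeta> t < flow z t}"
    using z iff by (intro measure_unif_ge) auto
  ultimately have "measure unif {\<zeta>. flow \<zeta> t < flow z t} = z" by simp
  then show ?thesis using conv_measure_distr[OF flow_int, of t "flow z t"] t by simp
qed

end

section \<open>Existence of dissipative measure solutions\<close>

context nonlocal_kernel
begin

text \<open>The monotonicity of \<open>v\<close> is only assumed on the range of the convolution, but before the
  monotonicity of the flow is known its argument may leave that range; \<open>v\<close> is therefore
  continued with slope \<open>-b\<close>.\<close>

lemma velocity_extension:
  obtains vt Lt where "\<And>x y. \<bar>vt x - vt y\<bar> \<le> Lt * \<bar>x - y\<bar>"
    and "\<And>r1 r2. r1 \<le> r2 \<Longrightarrow> vt r2 - vt r1 \<le> - b * (r2 - r1)"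
    and "\<And>r. r \<in> decr_range \<Longrightarrow> vt r = v r"
proof (cases "decr_range = UNIV")
  case True
  then show ?thesis using that[of v Lv] v_diff v_decr_range by auto
next
  case False
  then obtain a where a: "a \<notin> decr_range" by auto
  have bdd: "bdd_below decr_range"
    using decr_range_up[of _ a] a by (intro bdd_belowI[of _ a]) (meson linorder_le_cases)
  have ne: "decr_range \<noteq> {}" using decr_range_def by (auto intro: exI[of _ 0])
  define m where "m = Inf decr_range"
  have m_le: "m \<le> r" if "r \<in> decr_range" for r
    unfolding m_def using that bdd by (rule cInf_lower)
  have above: "r \<in> decr_range" if "m < r" for r
    using that cInf_less_iff[OF ne bdd, of r] decr_range_up by (auto simp: m_def)
  \<comment> \<open>The infimum \<open>m\<close> need not belong to \<open>decr_range\<close>, so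
    the decrease has to be extended to it by approximation from the right.\<close>
  have decr: "v r2 - v r1 \<le> - b * (r2 - r1)" if "m \<le> r1" "r1 \<le> r2" for r1 r2
  proof (rule field_le_epsilon)
    fix e :: real assume e: "0 < e"
    \<comment> \<open>Moving an end point to the right by \<open>d\<close> changes the inequality by
      at most \<open>(b + Lv) * d = e\<close>.\<close>
    define d where "d = e / (b + Lv)"
    have bL: "0 < b + Lv" using b_pos Lv_nonneg by simp
    have d: "0 < d" "(b + Lv) * d = e" using e bL by (auto simp: d_def)
    have "v (r2 + d) - v (r1 + d) \<le> - b * (r2 - r1)"
      using v_decr_range[OF above, of "r1 + d" "r2 + d"] that d by simp
    show "v r2 - v r1 \<le> - b * (r2 - r1) + e"
    proof (cases "r1 + d \<le> r2")
      case True
      have "v r2 - v (r1 + d) \<le> - b * (r2 - (r1 + d))"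
        using v_decr_range[OF above, of "r1 + d" r2] that d True by simp
      moreover have "v (r1 + d) - v r1 \<le> Lv * d" using v_diff[of "r1 + d" r1] d by simp
      ultimately show ?thesis using d(2) by (simp add: algebra_simps)
    next
      case False
      have "v r2 - v r1 \<le> Lv * (r2 - r1)" using v_diff[of r2 r1] that by simp
      also have "\<dots> = - b * (r2 - r1) + (b + Lv) * (r2 - r1)" by (simp add: algebra_simps)
      also have "\<dots> \<le> - b * (r2 - r1) + (b + Lv) * d"
        using False bL by (intro add_left_mono mult_left_mono) auto
      finally show ?thesis using d(2) by simp
    qed
  qed
  define vt where "vt r = v (max r m) + b * max (m - r) 0" for r
  show ?thesis
  proof (rule that[of vt "Lv + b"])
    fix x y :: real
    have "\<bar>vt x - vt y\<bar> \<le> \<bar>v (max x m) - v (max y m)\<bar> + \<bar>b * (max (m - x) 0 - max (m - y) 0)\<bar>"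
      unfolding vt_def right_diff_distrib by linarith
    also have "\<dots> \<le> Lv * \<bar>max x m - max y m\<bar> + b * \<bar>max (m - x) 0 - max (m - y) 0\<bar>"
      using b_pos by (intro add_mono v_diff) (simp add: abs_mult)
    also have "\<dots> \<le> Lv * \<bar>x - y\<bar> + b * \<bar>x - y\<bar>"
      using b_pos by (intro add_mono mult_left_mono Lv_nonneg) auto
    finally show "\<bar>vt x - vt y\<bar> \<le> (Lv + b) * \<bar>x - y\<bar>" by (simp add: distrib_right)
  next
    fix r1 r2 :: real assume r: "r1 \<le> r2"
    have "v (max r2 m) - v (max r1 m) \<le> - b * (max r2 m - max r1 m)"
      using r by (intro decr) auto
    then have "vt r2 - vt r1 \<le> - b * ((max r2 m - max (m - r2) 0) - (max r1 m - max (m - r1) 0))"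
      by (simp add: vt_def algebra_simps)
    moreover have "max r m - max (m - r) 0 = r" for r :: real by auto
    ultimately show "vt r2 - vt r1 \<le> - b * (r2 - r1)" by simp
  next
    fix r assume "r \<in> decr_range"
    then have "m \<le> r" by (rule m_le)
    then show "vt r = v r" by (simp add: vt_def max_def)
  qed
qed

end

text \<open>A test function is given by its partial derivatives; joint continuity of the time
  derivative upgrades them to a total derivative, to which the chain rule along a trajectory
  applies.\<close>

lemma test_function_chain:
  assumes \<phi>: "test_function \<phi>" and X: "(X has_real_derivative X') (at t)"
  shows "((\<lambda>s. \<phi> (X s) s) has_real_derivative deriv (\<lambda>s. \<phi> (X t) s) t + X' * deriv (\<lambda>y. \<phi> y t) (X t)) (at t)"
proof -
  have dx: "((\<lambda>y. \<phi> y t) has_real_derivative deriv (\<lambda>y. \<phi> y t) x) (at x)" for x t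
    using \<phi> by (simp add: test_function_def DERIV_deriv_iff_real_differentiable)
  have dt: "((\<lambda>s. \<phi> x s) has_real_derivative deriv (\<lambda>s. \<phi> x s) t) (at t)" for x t
    using \<phi> by (simp add: test_function_def DERIV_deriv_iff_real_differentiable)
  \<comment> \<open>The time derivative enters \<open>has_derivative_partialsI\<close> as a bounded
    linear operator, and this identifies it with multiplication.\<close>
  have bl: "blinfun_apply (blinfun_scaleR_left D) = (*) D" for D :: real
    by (rule ext) simp
  let ?pt = "\<lambda>x t. deriv (\<lambda>s. \<phi> x s) t"
  have ct: "continuous_on UNIV (\<lambda>(x, t). ?pt x t)"
    using \<phi> by (simp add: test_function_def)
  have "((\<lambda>(x, s). \<phi> x s) has_derivative (\<lambda>(tx, ts). deriv (\<lambda>y. \<phi> y t) (X t) * tx + blinfun_apply (blinfun_scaleR_left (?pt (X t) t)) ts))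
    (at (X t, t) within UNIV \<times> UNIV)"
  proof (rule has_derivative_partialsI)
    show "((\<lambda>x. \<phi> x t) has_derivative (*) (deriv (\<lambda>y. \<phi> y t) (X t))) (at (X t))"
      using dx by (simp add: has_field_derivative_def)
    show "((\<lambda>s. \<phi> x s) has_derivative blinfun_apply (blinfun_scaleR_left (?pt x s))) (at s)" for x s
      using dt[of x s] unfolding has_field_derivative_def bl .
    have "continuous_on UNIV (\<lambda>q. blinfun_scaleR_left (?pt (fst q) (snd q)) :: real \<Rightarrow>\<^sub>L real)"
      using ct unfolding case_prod_beta' by (rule bounded_linear.continuous_on[OF bounded_linear_blinfun_scaleR_left])
    then show "continuous (at (X t, t) within UNIV \<times> UNIV) (\<lambda>(x, s). blinfun_scaleR_left (?pt x s) :: real \<Rightarrow>\<^sub>L real)"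
      unfolding case_prod_beta' UNIV_Times_UNIV continuous_on_eq_continuous_within by (rule bspec) simp
  qed simp_all
  then have F: "((\<lambda>(x, s). \<phi> x s) has_derivative (\<lambda>(tx, ts). deriv (\<lambda>y. \<phi> y t) (X t) * tx + blinfun_apply (blinfun_scaleR_left (?pt (X t) t)) ts)) (at (X t, t))"
    by (simp only: UNIV_Times_UNIV)
  have P: "((\<lambda>s. (X s, s)) has_derivative (\<lambda>h. (X' * h, h))) (at t)"
    using X unfolding has_field_derivative_def by (rule has_derivative_Pair) (rule has_derivative_ident)
  have "(\<lambda>h. (\<lambda>(tx, ts). deriv (\<lambda>y. \<phi> y t) (X t) * tx + blinfun_apply (blinfun_scaleR_left (?pt (X t) t)) ts) (X' * h, h))
    = (*) (?pt (X t) t + X' * deriv (\<lambda>y. \<phi> y t) (X t))"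
    by (rule ext) (simp add: algebra_simps)
  then show ?thesis
    using has_derivative_compose[OF P F] unfolding has_field_derivative_def by simp
qed

text \<open>The complement of the compact support is open, so both partial derivatives vanish off
  the support and are bounded by compactness.\<close>

lemma test_function_support:
  assumes \<phi>: "test_function \<phi>"
  obtains a c M where "0 < a" "a \<le> c" "0 \<le> M"
    and "\<And>x t. t \<le> a \<or> c \<le> t \<Longrightarrow> \<phi> x t = 0"
    and "\<And>x t. t < a \<or> c < t \<Longrightarrow> deriv (\<lambda>s. \<phi> x s) t = 0"
    and "\<And>x t. t < a \<or> c < t \<Longrightarrow> deriv (\<lambda>y. \<phi> y t) x = 0"
    and "\<And>x t. \<bar>deriv (\<lambda>s. \<phi> x s) t\<bar> \<le> M" and "\<And>x t. \<bar>deriv (\<lambda>y. \<phi> y t) x\<bar> \<le> M"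
proof -
  obtain K where K: "compact K" "K \<subseteq> UNIV \<times> {0<..}" "\<And>x t. (x, t) \<notin> K \<Longrightarrow> \<phi> x t = 0"
    using \<phi> by (auto simp: test_function_def)
  have opn: "open (- K)" using K(1) by (simp add: compact_imp_closed open_Compl)
  have t0: "deriv (\<lambda>s. \<phi> x s) t = 0" if "(x, t) \<notin> K" for x t
  proof (rule DERIV_imp_deriv, rule has_field_derivative_transform_within_open)
    show "((\<lambda>_. 0) has_real_derivative 0) (at t)" by simp
    show "open ((\<lambda>s. (x, s)) -` (- K))"
      using opn by (intro open_vimage) (auto intro!: continuous_intros)
  qed (use that K(3) in auto)
  have x0: "deriv (\<lambda>y. \<phi> y t) x = 0" if "(x, t) \<notin> K" for x t
  proof (rule DERIV_imp_deriv, rule has_field_derivative_transform_within_open)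
    show "((\<lambda>_. 0) has_real_derivative 0) (at x)" by simp
    show "open ((\<lambda>y. (y, t)) -` (- K))"
      using opn by (intro open_vimage) (auto intro!: continuous_intros)
  qed (use that K(3) in auto)
  have bound: "\<exists>M\<ge>0. \<forall>x t. \<bar>f x t\<bar> \<le> M"
    if "continuous_on UNIV (\<lambda>(x, t). f x t)" "\<And>x t. (x, t) \<notin> K \<Longrightarrow> f x t = 0" for f :: "real \<Rightarrow> real \<Rightarrow> real"
  proof -
    have "bounded ((\<lambda>(x, t). f x t) ` K)"
      using K(1) that(1) by (intro compact_imp_bounded compact_continuous_image) (auto intro: continuous_on_subset)
    then obtain M where "\<forall>y\<in>(\<lambda>(x, t). f x t) ` K. norm y \<le> M" unfolding bounded_iff by blast
    then have M: "\<bar>f x t\<bar> \<le> M" if "(x, t) \<in> K" for x t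
      using imageI[OF that, of "\<lambda>(x, t). f x t"] by auto
    have "\<bar>f x t\<bar> \<le> \<bar>M\<bar>" for x t
      using that(2)[of x t] M[of x t] by (cases "(x, t) \<in> K") linarith+
    then show ?thesis by (intro exI[of _ "\<bar>M\<bar>"]) auto
  qed
  obtain M1 where M1: "0 \<le> M1" "\<And>x t. \<bar>deriv (\<lambda>s. \<phi> x s) t\<bar> \<le> M1"
    using bound[of "\<lambda>x t. deriv (\<lambda>s. \<phi> x s) t"] t0 \<phi> by (auto simp: test_function_def)
  obtain M2 where M2: "0 \<le> M2" "\<And>x t. \<bar>deriv (\<lambda>y. \<phi> y t) x\<bar> \<le> M2"
    using bound[of "\<lambda>x t. deriv (\<lambda>y. \<phi> y t) x"] x0 \<phi> by (auto simp: test_function_def)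
  obtain a c where ac: "0 < a" "a \<le> c" "\<And>x t. t \<le> a \<or> c \<le> t \<Longrightarrow> (x, t) \<notin> K"
  proof (cases "K = {}")
    case True
    then show ?thesis using that[of 1 1] by auto
  next
    case False
    have "compact (snd ` K)" using K(1) by (intro compact_continuous_image continuous_intros)
    then obtain l u where l: "l \<in> snd ` K" "\<And>t. t \<in> snd ` K \<Longrightarrow> l \<le> t" and u: "\<And>t. t \<in> snd ` K \<Longrightarrow> t \<le> u"
      using False compact_attains_inf[of "snd ` K"] compact_attains_sup[of "snd ` K"] by blast
    have "0 < l" using l(1) K(2) by auto
    show ?thesis
    proof (rule that[of "l / 2" "u + 1"])
      \<comment> \<open>Room is left on both sides, so that the function itself vanishes at the end
        times \<open>a\<close> and \<open>c\<close>.\<close>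
      show "0 < l / 2" using \<open>0 < l\<close> by simp
      show "l / 2 \<le> u + 1" using \<open>0 < l\<close> u[OF l(1)] by simp
      fix x t assume "t \<le> l / 2 \<or> u + 1 \<le> t"
      then show "(x, t) \<notin> K" using l(2)[of t] u[of t] \<open>0 < l\<close> image_eqI[of t snd "(x, t)" K] by auto
    qed
  qed
  show ?thesis
  proof (rule that[of a c "max M1 M2"])
    show "0 \<le> max M1 M2" using M1 by simp
    show "\<phi> x t = 0" if "t \<le> a \<or> c \<le> t" for x t using ac(3)[OF that] K(3) by blast
    show "deriv (\<lambda>s. \<phi> x s) t = 0" if "t < a \<or> c < t" for x t using ac(3)[of t x] that t0 by auto
    show "deriv (\<lambda>y. \<phi> y t) x = 0" if "t < a \<or> c < t" for x t using ac(3)[of t x] that x0 by auto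
    show "\<bar>deriv (\<lambda>s. \<phi> x s) t\<bar> \<le> max M1 M2" for x t using M1(2)[of x t] by simp
    show "\<bar>deriv (\<lambda>y. \<phi> y t) x\<bar> \<le> max M1 M2" for x t using M2(2)[of t x] by simp
  qed (use ac in auto)
qed

section \<open>The law of the flow as a weak solution\<close>

context lagrangian_flow
begin

abbreviation "mu t \<equiv> distr unif borel (\<lambda>z. flow z t)"

lemma flow_section: "(\<lambda>z. flow z t) \<in> borel_measurable borel"
  by (rule joint_section[OF flow_measurable])

lemma in_Lp_\<omega>: "1 \<le> p \<Longrightarrow> in_Lp p x0 \<Longrightarrow> in_Lp p \<omega>"
  using in_Lp_abs_add[OF _ in_Lp_const, of p x0 1] by (simp add: \<omega>_def[abs_def])

lemma mu_moment:
  assumes p: "1 \<le> p" and x0: "in_Lp p x0" and t: "0 \<le> t"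
  shows "mu t \<in> prob_moment p"
proof (rule distr_unif_prob_moment, rule in_Lp_mono[OF p in_Lp_cmult[OF p in_Lp_\<omega>[OF p x0]] flow_section])
  show "AE z in unif. \<bar>flow z t\<bar> \<le> \<bar>exp (B * t) * \<omega> z\<bar>"
    using flow_bound[OF t] by (intro AE_unifI order_trans[OF _ abs_ge_self]) auto
qed

lemma mu_wasserstein:
  assumes p: "1 \<le> p" and x0: "in_Lp p x0" and s: "0 \<le> s" "s \<le> T" and t: "0 \<le> t" "t \<le> T"
  shows "wasserstein p (mu s) (mu t) \<le> B * exp (B * T) * \<bar>s - t\<bar> * Lp_norm p \<omega>"
proof -
  note \<omega> = in_Lp_\<omega>[OF p x0]
  let ?c = "B * exp (B * T) * \<bar>s - t\<bar>"
  have c: "0 \<le> ?c" using B_nonneg by simp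
  have d: "AE z in unif. \<bar>flow z s - flow z t\<bar> \<le> \<bar>?c * \<omega> z\<bar>"
    using flow_lipschitz[OF t s] by (intro AE_unifI order_trans[OF _ abs_ge_self]) auto
  have meas: "(\<lambda>z. flow z s - flow z t) \<in> borel_measurable borel"
    by (intro borel_measurable_diff flow_section)
  have "wasserstein p (mu s) (mu t) \<le> Lp_norm p (\<lambda>z. flow z s - flow z t)"
    by (intro wasserstein_distr_le p flow_section in_Lp_mono[OF p in_Lp_cmult[OF p \<omega>] meas d])
  also have "\<dots> \<le> Lp_norm p (\<lambda>z. ?c * \<omega> z)"
    by (rule Lp_norm_mono[OF p in_Lp_cmult[OF p \<omega>] meas d])
  also have "\<dots> \<le> ?c * Lp_norm p \<omega>"
    by (rule Lp_norm_cmult[OF p \<omega> c])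
  finally show ?thesis .
qed

lemma mu_Linf:
  assumes t: "0 < t"
  shows "Linf_norm (mu t) < \<infinity>"
proof -
  let ?g = "b * lam * growth L t"
  have g: "0 < ?g" using b_pos lam_pos growth_pos[OF L_nonneg t] by simp
  have "Linf_norm (mu t) \<le> ennreal (1 / ?g)"
  proof (rule expanding_distr_density[OF flow_section])
    fix z1 z2 :: real assume z: "0 < z1" "z1 < z2" "z2 < 1"
    have "(z2 - z1) * ?g \<le> flow z2 t - flow z1 t"
      using flow_expand[of z1 z2 t] z t by (simp add: ac_simps)
    then show "z2 - z1 \<le> 1 / ?g * (flow z2 t - flow z1 t)"
      using g by (simp add: pos_le_divide_eq)
  qed (use g in simp)
  then show ?thesis by (simp add: order_le_less_trans)
qed

text \<open>Once the argument is recognised as a convolution value it lies in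
  \<open>decr_range\<close>, where the continued velocity agrees with \<open>v\<close>.\<close>

lemma vel_eq_conv:
  assumes vt: "\<And>r. r \<in> decr_range \<Longrightarrow> vt r = v r" and t: "0 < t" and z: "0 < z" "z < 1"
  shows "vel (\<lambda>\<zeta>. flow \<zeta> t) z = v (conv_measure V (mu t) (flow z t))"
  using vt[OF conv_in_decr_range[OF flow_int, of t "flow z t"]] t
  by (simp add: flow_conv[OF t z] vel_def)

text \<open>In terms of labels the two integrands add up to the time derivative of
  \<open>\<phi> (flow z t) t\<close> along one trajectory. Its integral vanishes because
  \<open>\<phi>\<close> is 0 at both end times, and Fubini exchanges time and label.\<close>

lemma mu_weak_formulation:
  assumes vt: "\<And>r. r \<in> decr_range \<Longrightarrow> vt r = v r" and \<phi>: "test_function \<phi>"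
  shows "(LBINT t:{0<..}. (\<integral>x. deriv (\<lambda>s. \<phi> x s) t \<partial>mu t))
    + (LBINT t:{0<..}. (\<integral>x. v (conv_measure V (mu t) x) * deriv (\<lambda>y. \<phi> y t) x \<partial>mu t)) = 0"
proof -
  obtain a c M where ac: "0 < a" "a \<le> c" and M0: "0 \<le> M"
    and \<phi>0: "\<And>x t. t \<le> a \<or> c \<le> t \<Longrightarrow> \<phi> x t = 0"
    and t0: "\<And>x t. t < a \<or> c < t \<Longrightarrow> deriv (\<lambda>s. \<phi> x s) t = 0"
    and x0': "\<And>x t. t < a \<or> c < t \<Longrightarrow> deriv (\<lambda>y. \<phi> y t) x = 0"
    and Mt: "\<And>x t. \<bar>deriv (\<lambda>s. \<phi> x s) t\<bar> \<le> M" and Mx: "\<And>x t. \<bar>deriv (\<lambda>y. \<phi> y t) x\<bar> \<le> M"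
    by (rule test_function_support[OF \<phi>]) blast
  define pt where "pt x t = deriv (\<lambda>s. \<phi> x s) t" for x t
  define px where "px x t = deriv (\<lambda>y. \<phi> y t) x" for x t
  have ct: "continuous_on UNIV (\<lambda>(x, t). pt x t)" and cx: "continuous_on UNIV (\<lambda>(x, t). px x t)"
    using \<phi> by (auto simp: test_function_def pt_def px_def)
  have pm: "(\<lambda>q. pt (fst q) (snd q)) \<in> borel_measurable (borel \<Otimes>\<^sub>M borel)"
    "(\<lambda>q. px (fst q) (snd q)) \<in> borel_measurable (borel \<Otimes>\<^sub>M borel)"
    using borel_measurable_continuous_onI[OF ct] borel_measurable_continuous_onI[OF cx]
    by (simp_all add: case_prod_beta' borel_prod)
  define G1 where "G1 t z = pt (flow z t) t" for t z
  define G2 where "G2 t z = vel (\<lambda>\<zeta>. flow \<zeta> t) z * px (flow z t) t" for t z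
  have swap: "(\<lambda>q. (snd q, fst q)) \<in> (lborel \<Otimes>\<^sub>M unif) \<rightarrow>\<^sub>M (borel \<Otimes>\<^sub>M borel)" by measurable
  have fm [measurable]: "(\<lambda>q. flow (snd q) (fst q)) \<in> borel_measurable (lborel \<Otimes>\<^sub>M unif)"
    using measurable_compose[OF swap flow_measurable] by simp
  have vm [measurable]: "(\<lambda>q. vel (\<lambda>\<zeta>. flow \<zeta> (fst q)) (snd q)) \<in> borel_measurable (lborel \<Otimes>\<^sub>M unif)"
    using measurable_compose[OF swap vel_measurable[OF flow_measurable]] by simp
  have pf: "(\<lambda>q. (flow (snd q) (fst q), fst q)) \<in> (lborel \<Otimes>\<^sub>M unif) \<rightarrow>\<^sub>M (borel \<Otimes>\<^sub>M borel)" by measurable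
  have [measurable]: "(\<lambda>q. pt (flow (snd q) (fst q)) (fst q)) \<in> borel_measurable (lborel \<Otimes>\<^sub>M unif)"
    "(\<lambda>q. px (flow (snd q) (fst q)) (fst q)) \<in> borel_measurable (lborel \<Otimes>\<^sub>M unif)"
    using measurable_compose[OF pf pm(1)] measurable_compose[OF pf pm(2)] by simp_all
  interpret P: pair_sigma_finite lborel unif ..
  let ?H = "\<lambda>G t z. indicator {0<..} t *\<^sub>R G t z"
  \<comment> \<open>The first term bounds the time derivative of \<open>\<phi>\<close>, the second
    the product of the velocity, at most \<open>B * exp (B * c) * \<omega> z\<close>, with the space
    derivative.\<close>
  define C where "C = M + B * exp (B * c) * M"
  have C0: "0 \<le> C" using M0 B_nonneg by (simp add: C_def)
  have dom: "integrable (lborel \<Otimes>\<^sub>M unif) (\<lambda>q. indicator {a..c} (fst q) * (C * \<omega> (snd q)))"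
  proof (rule P.Fubini_integrable)
    have [measurable]: "\<omega> \<in> borel_measurable borel" unfolding \<omega>_def[abs_def] by simp
    show "(\<lambda>q. indicator {a..c} (fst q) * (C * \<omega> (snd q))) \<in> borel_measurable (lborel \<Otimes>\<^sub>M unif)" by measurable
    have eq: "(\<lambda>t. \<integral>z. norm (indicator {a..c} (fst (t, z)) * (C * \<omega> (snd (t, z)))) \<partial>unif)
      = (\<lambda>t. (\<integral>z. \<bar>C * \<omega> z\<bar> \<partial>unif) * indicator {a..c} t)"
      by (auto simp: indicator_def)
    show "integrable lborel (\<lambda>t. \<integral>z. norm (indicator {a..c} (fst (t, z)) * (C * \<omega> (snd (t, z)))) \<partial>unif)"
      unfolding eq using ac by (intro integrable_mult_right integrable_real_indicator) auto
    show "AE t in lborel. integrable unif (\<lambda>z. indicator {a..c} (fst (t, z)) * (C * \<omega> (snd (t, z))))"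
      using \<omega>_int by simp
  qed
  have Hint: "integrable (lborel \<Otimes>\<^sub>M unif) (\<lambda>(t, z). ?H G t z)"
    if m: "(\<lambda>q. G (fst q) (snd q)) \<in> borel_measurable (lborel \<Otimes>\<^sub>M unif)"
      and b: "\<And>t z. a \<le> t \<Longrightarrow> t \<le> c \<Longrightarrow> 0 < z \<Longrightarrow> z < 1 \<Longrightarrow> \<bar>G t z\<bar> \<le> C * \<omega> z"
      and o: "\<And>t z. t < a \<or> c < t \<Longrightarrow> G t z = 0" for G :: "real \<Rightarrow> real \<Rightarrow> real"
  proof (rule Bochner_Integration.integrable_bound[OF dom])
    have "(\<lambda>q. indicator {0<..} (fst q) *\<^sub>R G (fst q) (snd q)) \<in> borel_measurable (lborel \<Otimes>\<^sub>M unif)"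
      using m by measurable
    then show "(\<lambda>(t, z). ?H G t z) \<in> borel_measurable (lborel \<Otimes>\<^sub>M unif)" by (simp add: split_beta)
    have "AE q in lborel \<Otimes>\<^sub>M unif. 0 < snd q \<and> snd q < 1"
    proof (rule P.AE_pair_measure)
      show "{q \<in> space (lborel \<Otimes>\<^sub>M unif). 0 < snd q \<and> snd q < (1::real)} \<in> sets (lborel \<Otimes>\<^sub>M unif)" by measurable
      show "AE t in lborel. AE z in unif. 0 < snd (t, z) \<and> snd (t, z) < (1::real)"
        by (intro AE_I2 AE_unifI) simp
    qed
    then show "AE q in lborel \<Otimes>\<^sub>M unif. norm (case q of (t, z) \<Rightarrow> ?H G t z) \<le> norm (indicator {a..c} (fst q) * (C * \<omega> (snd q)))"
    proof eventually_elim
      case (elim q)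
      obtain t z where q: "q = (t, z)" by (cases q)
      show ?case
        using b[of t z] o[of t z] elim ac by (cases "a \<le> t \<and> t \<le> c") (auto simp: q indicator_def)
    qed
  qed
  have b1: "\<bar>G1 t z\<bar> \<le> C * \<omega> z" and b2: "\<bar>G2 t z\<bar> \<le> C * \<omega> z"
    if "a \<le> t" "t \<le> c" "0 < z" "z < 1" for t z
  proof -
    have "\<bar>G1 t z\<bar> \<le> M" using Mt by (simp add: G1_def pt_def)
    also have "M \<le> C" using M0 B_nonneg by (simp add: C_def)
    also have "C \<le> C * \<omega> z" using C0 by (rule le_mult_\<omega>)
    finally show "\<bar>G1 t z\<bar> \<le> C * \<omega> z" .
    have "\<bar>G2 t z\<bar> \<le> (B * exp (B * c) * \<omega> z) * M"
      unfolding G2_def abs_mult px_def using that ac B_nonneg \<omega>_ge_1[of z]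
      by (intro mult_mono flow_vel_bound Mx) auto
    also have "\<dots> \<le> C * \<omega> z"
      using M0 \<omega>_ge_1[of z] by (simp add: C_def algebra_simps)
    finally show "\<bar>G2 t z\<bar> \<le> C * \<omega> z" .
  qed
  have H1: "integrable (lborel \<Otimes>\<^sub>M unif) (\<lambda>(t, z). ?H G1 t z)"
    using t0 by (intro Hint b1) (auto simp: G1_def pt_def[symmetric])
  have H2: "integrable (lborel \<Otimes>\<^sub>M unif) (\<lambda>(t, z). ?H G2 t z)"
    using x0' by (intro Hint b2) (auto simp: G2_def px_def[symmetric])
  have sect: "(\<lambda>x. pt x t) \<in> borel_measurable borel" "(\<lambda>x. px x t) \<in> borel_measurable borel" for t
    using joint_section(1)[of pt, OF pm(1)] joint_section(1)[of px, OF pm(2)] by auto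
  have conv_m: "(\<lambda>x. conv_measure V (mu t) x) \<in> borel_measurable borel" for t
  proof -
    interpret R: real_distribution "mu t" by (rule real_distribution_distr_unif[OF flow_section])
    show ?thesis unfolding conv_measure_def
      by (rule R.borel_measurable_lebesgue_integral) measurable
  qed
  have I1: "(LBINT t:{0<..}. (\<integral>x. deriv (\<lambda>s. \<phi> x s) t \<partial>mu t)) = (\<integral>t. \<integral>z. ?H G1 t z \<partial>unif \<partial>lborel)"
    unfolding set_lebesgue_integral_def
  proof (rule Bochner_Integration.integral_cong[OF refl])
    fix t :: real
    have "(\<integral>x. pt x t \<partial>mu t) = (\<integral>z. G1 t z \<partial>unif)"
      unfolding G1_def using sect flow_section by (subst integral_distr) auto
    then show "indicator {0<..} t *\<^sub>R (\<integral>x. deriv (\<lambda>s. \<phi> x s) t \<partial>mu t) = (\<integral>z. ?H G1 t z \<partial>unif)"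
      by (simp add: pt_def)
  qed
  have I2: "(LBINT t:{0<..}. (\<integral>x. v (conv_measure V (mu t) x) * deriv (\<lambda>y. \<phi> y t) x \<partial>mu t)) = (\<integral>t. \<integral>z. ?H G2 t z \<partial>unif \<partial>lborel)"
    unfolding set_lebesgue_integral_def
  proof (rule Bochner_Integration.integral_cong[OF refl])
    fix t :: real
    show "indicator {0<..} t *\<^sub>R (\<integral>x. v (conv_measure V (mu t) x) * deriv (\<lambda>y. \<phi> y t) x \<partial>mu t) = (\<integral>z. ?H G2 t z \<partial>unif)"
    proof (cases "0 < t")
      case True
      have [measurable]: "(\<lambda>x. v (conv_measure V (mu t) x)) \<in> borel_measurable borel"
        by (rule measurable_compose[OF conv_m borel_measurable_v])
      note [measurable] = sect[of t] flow_section[of t]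
      have "(\<integral>x. v (conv_measure V (mu t) x) * px x t \<partial>mu t) = (\<integral>z. v (conv_measure V (mu t) (flow z t)) * px (flow z t) t \<partial>unif)"
        by (subst integral_distr) auto
      also have "\<dots> = (\<integral>z. G2 t z \<partial>unif)"
      proof (rule integral_cong_AE)
        show "(\<lambda>z. v (conv_measure V (mu t) (flow z t)) * px (flow z t) t) \<in> borel_measurable unif"
          by simp
        have "(\<lambda>z. vel (\<lambda>\<zeta>. flow \<zeta> t) z) \<in> borel_measurable borel"
          by (rule joint_section(1)[OF vel_measurable[OF flow_measurable]])
        then show "G2 t \<in> borel_measurable unif" unfolding G2_def[abs_def] by simp
        show "AE z in unif. v (conv_measure V (mu t) (flow z t)) * px (flow z t) t = G2 t z"
          using vel_eq_conv[OF vt True] by (intro AE_unifI) (simp add: G2_def)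
      qed
      finally show ?thesis by (simp add: px_def)
    qed simp
  qed
  have path: "(\<integral>t. ?H G1 t z + ?H G2 t z \<partial>lborel) = 0" if z: "0 < z" "z < 1" for z
  proof -
    have fc: "continuous_on {a..c} (flow z)"
      by (rule continuous_on_subset[OF continuous_on_flow[OF z, of c]]) (use ac in auto)
    have vc: "continuous_on {a..c} (\<lambda>t. vel (\<lambda>\<zeta>. flow \<zeta> t) z)"
      by (rule continuous_on_subset[OF continuous_on_flow_vel[OF z]]) (use ac in auto)
    have pc: "continuous_on {a..c} (\<lambda>t. (flow z t, t))" by (intro continuous_intros fc)
    have cont: "continuous_on {a..c} (\<lambda>t. G1 t z + G2 t z)"
      unfolding G1_def G2_def
      using continuous_on_compose2[OF ct pc] continuous_on_compose2[OF cx pc]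
      by (intro continuous_intros vc) auto
    have "(\<integral>t. ?H G1 t z + ?H G2 t z \<partial>lborel) = (LBINT t:{0<..}. G1 t z + G2 t z)"
      unfolding set_lebesgue_integral_def by (simp add: distrib_left)
    also have "\<dots> = integral {a..c} (\<lambda>t. G1 t z + G2 t z)"
      using t0 x0' ac by (intro set_integral_supported(2) cont) (auto simp: G1_def G2_def pt_def px_def)
    also have "((\<lambda>t. G1 t z + G2 t z) has_integral \<phi> (flow z c) c - \<phi> (flow z a) a) {a..c}"
    proof (rule fundamental_theorem_of_calculus)
      fix t assume t: "t \<in> {a..c}"
      have "((\<lambda>t. \<phi> (flow z t) t) has_real_derivative G1 t z + G2 t z) (at t)"
        unfolding G1_def G2_def pt_def px_def
        using t ac z by (intro test_function_chain[OF \<phi>] flow_deriv) auto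
      then show "((\<lambda>t. \<phi> (flow z t) t) has_vector_derivative G1 t z + G2 t z) (at t within {a..c})"
        by (simp add: has_real_derivative_iff_has_vector_derivative has_vector_derivative_at_within)
    qed (rule ac)
    then have "integral {a..c} (\<lambda>t. G1 t z + G2 t z) = 0"
      using \<phi>0 by (simp add: has_integral_iff)
    finally show ?thesis .
  qed
  have "(\<integral>t. \<integral>z. ?H G1 t z \<partial>unif \<partial>lborel) + (\<integral>t. \<integral>z. ?H G2 t z \<partial>unif \<partial>lborel)
    = (\<integral>z. \<integral>t. ?H G1 t z \<partial>lborel \<partial>unif) + (\<integral>z. \<integral>t. ?H G2 t z \<partial>lborel \<partial>unif)"
    using P.Fubini_integral[OF H1] P.Fubini_integral[OF H2] by simp
  also have "\<dots> = (\<integral>z. (\<integral>t. ?H G1 t z \<partial>lborel) + (\<integral>t. ?H G2 t z \<partial>lborel) \<partial>unif)"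
    using P.integrable_snd[OF H1] P.integrable_snd[OF H2] by (subst Bochner_Integration.integral_add) auto
  also have "\<dots> = (\<integral>z. 0 \<partial>unif)"
  proof (rule integral_cong_AE)
    have inner: "AE z in unif. 0 < z \<and> z < 1" by (rule AE_unifI) simp
    show "(\<lambda>z. (\<integral>t. ?H G1 t z \<partial>lborel) + (\<integral>t. ?H G2 t z \<partial>lborel)) \<in> borel_measurable unif"
      using P.integrable_snd[OF H1] P.integrable_snd[OF H2]
      by (intro borel_measurable_integrable Bochner_Integration.integrable_add) auto
    show "AE z in unif. (\<integral>t. ?H G1 t z \<partial>lborel) + (\<integral>t. ?H G2 t z \<partial>lborel) = 0"
      using P.AE_integrable_snd[OF H1] P.AE_integrable_snd[OF H2] inner
    proof eventually_elim
      case (elim z)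
      then show ?case using path[of z] Bochner_Integration.integral_add[OF elim(1,2)] by simp
    qed
  qed simp
  finally show ?thesis unfolding I1 I2 by simp
qed

end

lemma (in nonlocal_kernel) dissipative_solution_exists:
  assumes p: "1 \<le> p" and rho0: "rho0 \<in> prob_moment p"
  shows "\<exists>rho. dissipative_measure_solution V v p rho0 rho"
proof -
  obtain vt Lt where vt: "\<And>x y. \<bar>vt x - vt y\<bar> \<le> Lt * \<bar>x - y\<bar>"
    "\<And>r1 r2. r1 \<le> r2 \<Longrightarrow> vt r2 - vt r1 \<le> - b * (r2 - r1)" "\<And>r. r \<in> decr_range \<Longrightarrow> vt r = v r"
    using velocity_extension by blast
  have rho_distribution: "real_distribution rho0" using rho0 by (rule prob_moment_real_distribution)
  have Lp: "in_Lp p (quantile rho0)" using rho0 by (rule in_Lp_quantile)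
  interpret lagrangian_flow V v lam b vt Lt "quantile rho0"
    using vt in_Lp_integrable[OF p Lp] quantile_mono[OF rho_distribution] by unfold_locales
  define rho where "rho t = (if t = 0 then rho0 else mu t)" for t
  have rho: "rho t = mu t" if "0 \<le> t" for t
  proof (cases "t = 0")
    case True
    have "mu 0 = distr unif borel (quantile rho0)"
      using flow_0 flow_section x0_measurable by (intro distr_cong_AE AE_unifI) auto
    then show ?thesis using True by (simp add: rho_def distr_quantile rho_distribution)
  qed (simp add: rho_def)
  have cont: "((\<lambda>s. wasserstein p (rho s) (rho t)) \<longlongrightarrow> 0) (at t within {0..})" if t: "0 \<le> t" for t
  proof (rule Lim_null_comparison)
    let ?C = "B * exp (B * (t + 1)) * Lp_norm p \<omega>"
    have "\<forall>\<^sub>F s in at t within {0..}. s < t + 1"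
      by (rule order_tendstoD(2)[OF tendsto_ident_at]) simp
    moreover have "\<forall>\<^sub>F s in at t within {0..}. 0 \<le> s" by (auto simp: eventually_at_filter)
    ultimately show "\<forall>\<^sub>F s in at t within {0..}. norm (wasserstein p (rho s) (rho t)) \<le> ?C * \<bar>s - t\<bar>"
    proof eventually_elim
      case (elim s)
      then show ?case
        using mu_wasserstein[OF p Lp, of s "t + 1" t] t by (simp add: rho wasserstein_def ac_simps)
    qed
    show "((\<lambda>s. ?C * \<bar>s - t\<bar>) \<longlongrightarrow> 0) (at t within {0..})"
      by (auto intro!: tendsto_eq_intros)
  qed
  have weak: "(LBINT t:{0<..}. (\<integral>x. deriv (\<lambda>s. \<phi> x s) t \<partial>rho t))
    + (LBINT t:{0<..}. (\<integral>x. v (conv_measure V (rho t) x) * deriv (\<lambda>y. \<phi> y t) x \<partial>rho t)) = 0"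
    if "test_function \<phi>" for \<phi>
  proof -
    have "(LBINT t:{0<..}. (\<integral>x. deriv (\<lambda>s. \<phi> x s) t \<partial>rho t)) = (LBINT t:{0<..}. (\<integral>x. deriv (\<lambda>s. \<phi> x s) t \<partial>mu t))"
      by (rule set_lebesgue_integral_cong) (auto simp: rho)
    moreover have "(LBINT t:{0<..}. (\<integral>x. v (conv_measure V (rho t) x) * deriv (\<lambda>y. \<phi> y t) x \<partial>rho t))
      = (LBINT t:{0<..}. (\<integral>x. v (conv_measure V (mu t) x) * deriv (\<lambda>y. \<phi> y t) x \<partial>mu t))"
      by (rule set_lebesgue_integral_cong) (auto simp: rho)
    ultimately show ?thesis using mu_weak_formulation[OF vt(3) that] by simp
  qed
  have "dissipative_measure_solution V v p rho0 rho"
    unfolding dissipative_measure_solution_def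
  proof (intro conjI allI impI)
    show "rho 0 = rho0" by (simp add: rho_def)
    show "rho t \<in> prob_moment p" if "0 \<le> t" for t using mu_moment[OF p Lp that] that by (simp add: rho)
    show "Linf_norm (rho t) < \<infinity>" if "0 < t" for t using mu_Linf[OF that] that by (simp add: rho)
  qed (use cont weak in auto)
  then show ?thesis by blast
qed

section \<open>The well-posedness theorem\<close>

lemma (in weak_solution) quantile_deriv:
  assumes "0 < z" "z < 1" "0 < t"
  shows "((\<lambda>s. X z s) has_real_derivative
    v ((LBINT \<zeta>:{0..1}. U (X z t - X \<zeta> t)) - lam * z)) (at t)"
proof -
  have [measurable]: "quantile (rho t) \<in> borel_measurable borel"
    using assms by (intro X_measurable) simp
  have "ubar (quantile (rho t)) (X z t) = (LBINT \<zeta>:{0..1}. U (X z t - X \<zeta> t))"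
    unfolding ubar_def by (rule integral_unif) simp
  then show ?thesis using X_deriv[OF assms] by simp
qed

text \<open>The labels 0 and 1, where the quantile is arbitrary, sweep out a null set in the
  plane.\<close>

lemma AE_unit_strip:
  fixes P :: "real \<Rightarrow> real \<Rightarrow> bool"
  assumes "\<And>z t. 0 < z \<Longrightarrow> z < 1 \<Longrightarrow> 0 < t \<Longrightarrow> P z t"
  shows "AE (z, t) in lborel. z \<in> {0..1} \<and> t > 0 \<longrightarrow> P z t"
proof -
  have "emeasure (lborel \<Otimes>\<^sub>M lborel) ({0, 1} \<times> UNIV :: (real \<times> real) set) = emeasure lborel {0, 1 :: real} * emeasure lborel (UNIV :: real set)"
    by (rule lborel.emeasure_pair_measure_Times) auto
  also have "emeasure lborel {0, 1 :: real} = 0" by (intro emeasure_lborel_countable) simp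
  finally have "({0, 1} \<times> UNIV :: (real \<times> real) set) \<in> null_sets lborel"
    using borel_closed[OF closed_Times[of "{0, 1 :: real}" "UNIV :: real set"]]
    by (simp add: null_sets_def lborel_prod)
  then have "AE q in lborel. q \<notin> ({0, 1} \<times> UNIV :: (real \<times> real) set)"
    by (rule AE_not_in)
  then show ?thesis
    by (rule eventually_mono) (use assms in \<open>auto simp: less_le\<close>)
qed

text \<open>The rate obtained has the factor 2, and \<open>2 powr ((p + 1) / p)\<close> is at least
  2 since its exponent is at least 1.\<close>

lemma stability_exponent_ge:
  assumes "1 \<le> p" "0 \<le> a" "0 \<le> c"
  shows "2 * (a * c) \<le> stability_exponent p a c"
proof -
  have "2 \<le> (if p = \<infinity> then 2 else 2 powr ((enn2real p + 1) / enn2real p))"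
  proof (cases "p = \<infinity>")
    case False
    then have "1 \<le> (enn2real p + 1) / enn2real p"
      using enn2real_ge_1[OF assms(1)] by (simp add: divide_simps)
    then have "2 powr 1 \<le> 2 powr ((enn2real p + 1) / enn2real p)"
      by (intro powr_mono) auto
    then show ?thesis using False by simp
  qed simp
  then have "2 * (a * c) \<le> (if p = \<infinity> then 2 else 2 powr ((enn2real p + 1) / enn2real p)) * (a * c)"
    using assms by (intro mult_right_mono) auto
  then show ?thesis by (simp only: stability_exponent_def mult.assoc)
qed

theorem theorem2p3:
  fixes V v :: "real \<Rightarrow> real" and lam b :: real
  assumes supp_V: "closure {x. V x \<noteq> 0} \<subseteq> {..0}"
    and V_left_cont: "continuous (at_left 0) V"
    and V_left_lim: "(V \<longlongrightarrow> lam) (at_left 0)"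
    and lam_pos: "lam > 0"
    and V_lip: "\<exists>L. L-lipschitz_on {..0} V"
    and v_lip: "\<exists>L. L-lipschitz_on UNIV v"
    and b_pos: "b > 0"
    and v_decr: "\<And>r1 r2. 0 \<le> r1 \<Longrightarrow> r1 \<le> r2 \<Longrightarrow> v r2 - v r1 \<le> - b * (r2 - r1)"
    \<comment> \<open>Vacuous if \<open>V \<ge> 0\<close>: a kernel with negative values needs the decrease of \<open>v\<close> on the
        whole range of values of the convolution, otherwise atoms may persist.\<close>
    and v_decr_neg: "\<And>x r1 r2. V x < 0 \<Longrightarrow> V x \<le> r1 \<Longrightarrow> r1 \<le> r2 \<Longrightarrow> v r2 - v r1 \<le> - b * (r2 - r1)"
  defines "U \<equiv> extended_kernel V lam"
  shows "\<forall>p\<ge>1.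
    (\<forall>\<rho>\<^sub>0\<in>prob_moment p.
       (\<exists>\<rho>. dissipative_measure_solution V v p \<rho>\<^sub>0 \<rho>)
     \<and> (\<forall>\<rho> \<rho>'. dissipative_measure_solution V v p \<rho>\<^sub>0 \<rho> \<and> dissipative_measure_solution V v p \<rho>\<^sub>0 \<rho>'
           \<longrightarrow> (\<forall>t\<ge>0. \<rho> t = \<rho>' t))
     \<and> (\<forall>\<rho>. dissipative_measure_solution V v p \<rho>\<^sub>0 \<rho> \<longrightarrow>
           quantile (\<rho> 0) = quantile \<rho>\<^sub>0
         \<and> (AE (z, t) in lborel. z \<in> {0..1} \<and> t > 0 \<longrightarrow>
              ((\<lambda>s. quantile (\<rho> s) z) has_real_derivative
                v ((LBINT \<zeta>:{0..1}. U (quantile (\<rho> t) z - quantile (\<rho> t) \<zeta>)) - lam * z)) (at t))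
         \<and> Linf_loc_Linf \<rho>
         \<and> (\<forall>t>0. Linf_norm (\<rho> t)
              \<le> ennreal (smoothing_bound (lip_seminorm UNIV v * lip_seminorm UNIV U) b lam t))))
  \<and> (\<forall>\<rho>\<^sub>0\<^sub>1\<in>prob_moment p. \<forall>\<rho>\<^sub>0\<^sub>2\<in>prob_moment p. \<forall>\<rho>\<^sub>1 \<rho>\<^sub>2.
       dissipative_measure_solution V v p \<rho>\<^sub>0\<^sub>1 \<rho>\<^sub>1 \<and> dissipative_measure_solution V v p \<rho>\<^sub>0\<^sub>2 \<rho>\<^sub>2 \<longrightarrow>
       (\<forall>t\<ge>0. wasserstein p (\<rho>\<^sub>1 t) (\<rho>\<^sub>2 t)
          \<le> exp (stability_exponent p (lip_seminorm UNIV v) (lip_seminorm {..0} V) * t)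
              * wasserstein p \<rho>\<^sub>0\<^sub>1 \<rho>\<^sub>0\<^sub>2))"
proof -
  interpret nonlocal_kernel V v lam b
    by unfold_locales (fact supp_V V_left_lim lam_pos V_lip v_lip b_pos v_decr v_decr_neg)+
  have weak: "weak_solution V v lam b p \<rho>\<^sub>0 \<rho>"
    if "1 \<le> p" "dissipative_measure_solution V v p \<rho>\<^sub>0 \<rho>" for p \<rho>\<^sub>0 \<rho>
    using that by unfold_locales
  have props: "quantile (\<rho> 0) = quantile \<rho>\<^sub>0
         \<and> (AE (z, t) in lborel. z \<in> {0..1} \<and> t > 0 \<longrightarrow>
              ((\<lambda>s. quantile (\<rho> s) z) has_real_derivative
                v ((LBINT \<zeta>:{0..1}. U (quantile (\<rho> t) z - quantile (\<rho> t) \<zeta>)) - lam * z)) (at t))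
         \<and> Linf_loc_Linf \<rho>
         \<and> (\<forall>t>0. Linf_norm (\<rho> t) \<le> ennreal (smoothing_bound (Lv * lip_seminorm UNIV U) b lam t))"
    if p: "1 \<le> p" and sol: "dissipative_measure_solution V v p \<rho>\<^sub>0 \<rho>" for p \<rho>\<^sub>0 \<rho>
  proof -
    interpret S: weak_solution V v lam b p \<rho>\<^sub>0 \<rho> by (rule weak[OF p sol])
    show ?thesis
      using S.Linf_loc_Linf_rho S.Linf_norm_le AE_unit_strip[OF S.quantile_deriv] sol
      by (simp add: U_def dissipative_measure_solution_def)
  qed
  have stab: "wasserstein p (\<rho>\<^sub>1 t) (\<rho>\<^sub>2 t) \<le> exp (stability_exponent p Lv LV * t) * wasserstein p \<rho>\<^sub>0\<^sub>1 \<rho>\<^sub>0\<^sub>2"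
    if p: "1 \<le> p" and s: "dissipative_measure_solution V v p \<rho>\<^sub>0\<^sub>1 \<rho>\<^sub>1" "dissipative_measure_solution V v p \<rho>\<^sub>0\<^sub>2 \<rho>\<^sub>2"
      and t: "0 \<le> t" for p \<rho>\<^sub>0\<^sub>1 \<rho>\<^sub>0\<^sub>2 \<rho>\<^sub>1 \<rho>\<^sub>2 t
  proof -
    have "wasserstein p (\<rho>\<^sub>1 t) (\<rho>\<^sub>2 t) \<le> exp (2 * (Lv * LV) * t) * wasserstein p (\<rho>\<^sub>1 0) (\<rho>\<^sub>2 0)"
      by (rule weak_solution_stability[OF weak[OF p s(1)] weak[OF p s(2)] t])
    also have "\<dots> \<le> exp (stability_exponent p Lv LV * t) * wasserstein p (\<rho>\<^sub>1 0) (\<rho>\<^sub>2 0)"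
      using stability_exponent_ge[OF p Lv_nonneg LV_nonneg] t
      by (intro mult_right_mono) (auto simp: wasserstein_def intro: mult_right_mono)
    also have "\<rho>\<^sub>1 0 = \<rho>\<^sub>0\<^sub>1" using s(1) by (simp add: dissipative_measure_solution_def)
    also have "\<rho>\<^sub>2 0 = \<rho>\<^sub>0\<^sub>2" using s(2) by (simp add: dissipative_measure_solution_def)
    finally show ?thesis .
  qed
  have unique: "\<rho> t = \<rho>' t"
    if "1 \<le> p" "dissipative_measure_solution V v p \<rho>\<^sub>0 \<rho>" "dissipative_measure_solution V v p \<rho>\<^sub>0 \<rho>'" "0 \<le> t"
    for p \<rho>\<^sub>0 \<rho> \<rho>' t
    by (rule weak_solution_unique[OF weak[OF that(1,2)] weak[OF that(1,3)] that(4)])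
  show ?thesis
    \<comment> \<open>The patterns let \<open>conjI\<close> split only the outer conjunctions, so
      the conclusion of \<open>props\<close> remains a single goal.\<close>
    by (intro allI impI ballI conjI[of "\<forall>\<rho>\<^sub>0\<in>_. _ \<rho>\<^sub>0"] conjI[of "\<exists>\<rho>. _ \<rho>"] conjI[of "\<forall>\<rho> \<rho>'. _ \<rho> \<rho>'"])
      (use dissipative_solution_exists unique props stab in blast)+
qed

end
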